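(* (Primary Andronov–Hopf bifurcation $H_0$.) The normal form system $$\dot y_1=y_2,\quad \dot y_2=[\alpha_1+\phi_1]y_1+[\alpha_2+\phi_2]y_2,\quad \dot z=[i+\alpha_3+\phi_3+i\phi_4]z$$ leaves the $(y_1,y_2)$-plane invariant, and on this plane it reduces to $$\dot y_1=y_2,\qquad \dot y_2=[\alpha_1+\phi_1(y_1^2,0)]y_1+[\alpha_2+\phi_2(y_1^2,0)]y_2,\qquad z=0 .$$ For fixed $\alpha_1<0$, this system has an Andronov–Hopf bifurcation as $\alpha_2$ crosses through zero, for any $\alpha_3\neq0$. The new limit cycle has a small frequency, asymptotic to $\sqrt{-\alpha_1}$. The change of variables $x=y_1$, $y=-y_2/\omega$, where $\omega^2=-\alpha_1$, transforms the reduced system (at $\alpha_2=0$) to the planar system $$\begin{pmatrix}\dot x\\ \dot y\end{pmatrix}=\begin{pmatrix}0&-\omega\\ \omega&0\end{pmatrix}\begin{pmatrix}x\\ y\end{pmatrix}+\begin{pmatrix}0\\ -\frac1\omega\phi_1(x^2,0)x+\phi_2(x^2,0)y\end{pmatrix}.$$ The planar system has the polar normal form, with $x+iy=\rho e^{i\varphi}$, $$\dot\rho=\rho\Bigl[\frac{\alpha_2}{2}+\frac18\phi_{2,10}\rho^2+\cdots\Bigr],\qquad \dot\varphi=\sqrt{-\alpha_1-\Bigl(\frac{\alpha_2}{2}\Bigr)^2}+b\rho^2+\cdots .$$ From this it follows that the limit cycle has amplitude given by $$\rho=\sqrt{-\frac{4\alpha_2}{\phi_{2,10}}}+\cdots$$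 and is supercritical if $\phi_{2,10}<0$ and subcritical if $\phi_{2,10}>0$.
   Context: Here $y_1,y_2\in\mathbb{R}$, $z\in\mathbb{C}$, and $\alpha_1,\alpha_2,\alpha_3$ are real unfolding parameters near $0$. The $\phi_j=\phi_j(y_1^2,z\bar z)$, $j=1,\dots,4$, are real-valued formal power series (which may not converge) in $y_1^2$ and $z\bar z$ with $\phi_j(0,0)=0$; $\phi_{2,10}$ is the coefficient of $y_1^2$ in $\phi_2$, assumed nonzero (nondegenerate bifurcation). The bifurcation is from the trivial equilibrium at the origin; $b$ is a constant and dots denote higher order terms. Supercritical (respectively subcritical) means that the limit cycle exists for $\alpha_2>0$ (respectively $\alpha_2<0$). *)

theory Defs
  imports "HOL-Analysis.Analysis" "HOL-Computational_Algebra.Formal_Power_Series"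
begin

section \<open>Smooth functions and smooth realizations of formal power series\<close>

text \<open>The definitions below are meant for open sets \<^term>\<open>U\<close>.\<close>

fun Ck_on :: "nat \<Rightarrow> 'a::euclidean_space set \<Rightarrow> ('a \<Rightarrow> 'b::real_normed_vector) \<Rightarrow> bool" where
  "Ck_on 0 U f \<longleftrightarrow> continuous_on U f"
| "Ck_on (Suc n) U f \<longleftrightarrow>
     (\<forall>x\<in>U. f differentiable (at x)) \<and>
     (\<forall>e\<in>Basis. Ck_on n U (\<lambda>x. frechet_derivative f (at x) e))"

definition smooth_on :: "'a::euclidean_space set \<Rightarrow> ('a \<Rightarrow> 'b::real_normed_vector) \<Rightarrow> bool" where
  "smooth_on U f \<longleftrightarrow> (\<forall>n. Ck_on n U f)"

definition dir_deriv :: "'a::real_normed_vector \<Rightarrow> ('a \<Rightarrow> real) \<Rightarrow> 'a \<Rightarrow> real" where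
  "dir_deriv e f = (\<lambda>x. frechet_derivative f (at x) e)"

text \<open>A formal power series in two variables \<open>u\<close>, \<open>v\<close> is an element of \<^typ>\<open>real fps fps\<close>;
  the coefficient of \<open>u^i v^j\<close> is \<open>coeff2 \<phi> i j\<close>.  As the series need not converge, it
  enters a differential equation through an arbitrary smooth function having it as its Taylor series
  at the origin.\<close>

definition coeff2 :: "real fps fps \<Rightarrow> nat \<Rightarrow> nat \<Rightarrow> real" where
  "coeff2 \<phi> i j = fps_nth (fps_nth \<phi> i) j"

definition realizes :: "(real \<times> real) set \<Rightarrow> (real \<times> real \<Rightarrow> real) \<Rightarrow> real fps fps \<Rightarrow> bool" where
  "realizes U f \<phi> \<longleftrightarrow> smooth_on U f \<and>
     (\<forall>i j. (dir_deriv (1, 0) ^^ i) ((dir_deriv (0, 1) ^^ j) f) (0, 0)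
              = fact i * fact j * coeff2 \<phi> i j)"


section \<open>Solutions, closed orbits, limit cycles\<close>

definition is_solution ::
    "('a::real_normed_vector \<Rightarrow> 'a) \<Rightarrow> 'a set \<Rightarrow> real set \<Rightarrow> (real \<Rightarrow> 'a) \<Rightarrow> bool" where
  "is_solution F S I x \<longleftrightarrow>
     (\<forall>t\<in>I. x t \<in> S \<and> (x has_vector_derivative F (x t)) (at t within I))"

text \<open>\<^term>\<open>T\<close> is the minimal period, which also excludes equilibria.\<close>

definition closed_orbit ::
    "('a::real_normed_vector \<Rightarrow> 'a) \<Rightarrow> 'a set \<Rightarrow> 'a set \<Rightarrow> real \<Rightarrow> bool" where
  "closed_orbit F S \<Gamma> T \<longleftrightarrow>
     (\<exists>x. is_solution F S UNIV x \<and> 0 < T \<and> (\<forall>t. x (t + T) = x t) \<and>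
          (\<forall>s. 0 < s \<and> s < T \<longrightarrow> x s \<noteq> x 0) \<and> \<Gamma> = range x)"

definition limit_cycle ::
    "('a::real_normed_vector \<Rightarrow> 'a) \<Rightarrow> 'a set \<Rightarrow> 'a set \<Rightarrow> real \<Rightarrow> bool" where
  "limit_cycle F S \<Gamma> T \<longleftrightarrow> closed_orbit F S \<Gamma> T \<and>
     (\<exists>V. open V \<and> \<Gamma> \<subseteq> V \<and> (\<forall>\<Gamma>' T'. closed_orbit F S \<Gamma>' T' \<and> \<Gamma>' \<subseteq> V \<longrightarrow> \<Gamma>' = \<Gamma>))"


section \<open>Andronov--Hopf bifurcation\<close>

text \<open>The action of \<open>L - \<kappa>\<close> on the complexification of a real space: the pair
  \<open>(u, v)\<close> stands for \<open>u + i v\<close>.\<close>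

definition complexified_shift ::
    "('a::euclidean_space \<Rightarrow> 'a) \<Rightarrow> complex \<Rightarrow> 'a \<times> 'a \<Rightarrow> 'a \<times> 'a" where
  "complexified_shift L \<kappa> = (\<lambda>(u, v).
     (L u - (Re \<kappa> *\<^sub>R u - Im \<kappa> *\<^sub>R v), L v - (Im \<kappa> *\<^sub>R u + Re \<kappa> *\<^sub>R v)))"

definition is_eigenvalue :: "('a::euclidean_space \<Rightarrow> 'a) \<Rightarrow> complex \<Rightarrow> bool" where
  "is_eigenvalue L \<kappa> \<longleftrightarrow> (\<exists>w. w \<noteq> 0 \<and> complexified_shift L \<kappa> w = 0)"

text \<open>Algebraic multiplicity one: the generalized eigenspace has complex dimension 1,
  that is, real dimension 2.\<close>

definition is_simple_eigenvalue :: "('a::euclidean_space \<Rightarrow> 'a) \<Rightarrow> complex \<Rightarrow> bool" where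
  "is_simple_eigenvalue L \<kappa> \<longleftrightarrow> is_eigenvalue L \<kappa> \<and>
     dim {w. \<exists>n. (complexified_shift L \<kappa> ^^ n) w = 0} = 2"

text \<open>\<^term>\<open>p\<close> is an equilibrium for all parameters near \<open>\<mu>0\<close>, and a simple pair of eigenvalues of
  the linearization crosses the imaginary axis with nonzero speed at \<open>\<mu>0\<close>, away from all other
  eigenvalues on that axis.\<close>

definition hopf_eigenvalue_crossing ::
    "(real \<Rightarrow> 'a::euclidean_space \<Rightarrow> 'a) \<Rightarrow> 'a \<Rightarrow> real \<Rightarrow> bool" where
  "hopf_eigenvalue_crossing F p \<mu>0 \<longleftrightarrow>
     (\<exists>\<epsilon>>0. \<exists>\<kappa> d.
        (\<forall>\<mu>. \<bar>\<mu> - \<mu>0\<bar> < \<epsilon> \<longrightarrow>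
            F \<mu> p = 0 \<and> F \<mu> differentiable (at p) \<and>
            is_eigenvalue (frechet_derivative (F \<mu>) (at p)) (\<kappa> \<mu>)) \<and>
        Re (\<kappa> \<mu>0) = 0 \<and> 0 < Im (\<kappa> \<mu>0) \<and>
        is_simple_eigenvalue (frechet_derivative (F \<mu>0) (at p)) (\<kappa> \<mu>0) \<and>
        (\<forall>\<nu>. is_eigenvalue (frechet_derivative (F \<mu>0) (at p)) \<nu> \<and> Re \<nu> = 0 \<longrightarrow>
            \<nu> = \<kappa> \<mu>0 \<or> \<nu> = cnj (\<kappa> \<mu>0)) \<and>
        (\<kappa> has_vector_derivative d) (at \<mu>0) \<and> Re d \<noteq> 0)"

text \<open>A limit cycle \<open>\<Gamma> \<mu>\<close> of minimal period \<open>T \<mu>\<close> bifurcates from \<^term>\<open>p\<close> on the side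
  \<open>s (\<mu> - \<mu>0) > 0\<close> with \<open>s = 1\<close> or \<open>s = -1\<close>.  In a fixed neighbourhood \<open>V\<close> of \<^term>\<open>p\<close> it is the
  only closed orbit, there are none on the other side or at \<open>\<mu>0\<close>, and it shrinks to \<^term>\<open>p\<close>.\<close>

definition limit_cycle_branch ::
    "(real \<Rightarrow> 'a::euclidean_space \<Rightarrow> 'a) \<Rightarrow> 'a set \<Rightarrow> 'a \<Rightarrow> real \<Rightarrow> real \<Rightarrow>
     (real \<Rightarrow> 'a set) \<Rightarrow> (real \<Rightarrow> real) \<Rightarrow> bool" where
  "limit_cycle_branch F S p \<mu>0 s \<Gamma> T \<longleftrightarrow>
     (\<exists>\<epsilon>>0. \<exists>V. open V \<and> p \<in> V \<and>
        (\<forall>\<mu>. 0 < s * (\<mu> - \<mu>0) \<and> s * (\<mu> - \<mu>0) < \<epsilon> \<longrightarrow>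
            limit_cycle (F \<mu>) S (\<Gamma> \<mu>) (T \<mu>) \<and> \<Gamma> \<mu> \<subseteq> V \<and>
            (\<forall>\<Gamma>' T'. closed_orbit (F \<mu>) S \<Gamma>' T' \<and> \<Gamma>' \<subseteq> V \<longrightarrow> \<Gamma>' = \<Gamma> \<mu>)) \<and>
        (\<forall>\<mu>. - \<epsilon> < s * (\<mu> - \<mu>0) \<and> s * (\<mu> - \<mu>0) \<le> 0 \<longrightarrow>
            \<not> (\<exists>\<Gamma>' T'. closed_orbit (F \<mu>) S \<Gamma>' T' \<and> \<Gamma>' \<subseteq> V))) \<and>
     (\<forall>r>0. \<forall>\<^sub>F \<mu> in at \<mu>0 within {\<mu>. 0 < s * (\<mu> - \<mu>0)}. \<Gamma> \<mu> \<subseteq> ball p r)"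

definition supercritical_branch where
  "supercritical_branch F S p \<mu>0 \<Gamma> T \<longleftrightarrow> limit_cycle_branch F S p \<mu>0 1 \<Gamma> T"

definition subcritical_branch where
  "subcritical_branch F S p \<mu>0 \<Gamma> T \<longleftrightarrow> limit_cycle_branch F S p \<mu>0 (- 1) \<Gamma> T"

definition andronov_hopf_bifurcation where
  "andronov_hopf_bifurcation F S p \<mu>0 \<Gamma> T \<longleftrightarrow>
     hopf_eigenvalue_crossing F p \<mu>0 \<and>
     (supercritical_branch F S p \<mu>0 \<Gamma> T \<or> subcritical_branch F S p \<mu>0 \<Gamma> T)"


section \<open>Polar normal form of a planar family\<close>

text \<open>A smooth family of local diffeomorphisms \<open>H \<mu>\<close> of the plane (identified with the complex
  numbers) fixing the origin, with linear part the identity at \<open>\<mu> = 0\<close>.\<close>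

definition near_identity_change ::
    "real \<Rightarrow> real \<Rightarrow> (real \<Rightarrow> complex \<Rightarrow> complex) \<Rightarrow> bool" where
  "near_identity_change \<epsilon> r H \<longleftrightarrow>
     smooth_on ({- \<epsilon> <..< \<epsilon>} \<times> ball 0 r) (\<lambda>(\<mu>, \<zeta>). H \<mu> \<zeta>) \<and>
     (\<forall>\<mu>. \<bar>\<mu>\<bar> < \<epsilon> \<longrightarrow> H \<mu> 0 = 0 \<and> inj_on (H \<mu>) (ball 0 r) \<and>
        (\<forall>\<zeta>\<in>ball 0 r. inj (frechet_derivative (H \<mu>) (at \<zeta>)))) \<and>
     (H 0 has_derivative id) (at 0)"

text \<open>In the coordinates \<open>w = H \<mu> (x + i y) = \<rho> exp (i \<theta>)\<close> the family \<^term>\<open>F\<close> reads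
  \<open>\<rho>' = \<rho> (\<sigma>(\<mu>) + A(\<mu>) \<rho>\<^sup>2 + O(\<rho>^4))\<close>, \<open>\<theta>' = \<Omega>(\<mu>) + B(\<mu>) \<rho>\<^sup>2 + O(\<rho>^4)\<close>
  with \<open>A(\<mu>) = a + O(\<mu>)\<close> and \<open>B(\<mu>) = b + O(\<mu>)\<close>, everything uniformly in \<open>\<mu>\<close>.  So the terms
  hidden in the dots after \<open>\<sigma>(\<mu>) + a \<rho>\<^sup>2\<close> and \<open>\<Omega>(\<mu>) + b \<rho>\<^sup>2\<close> are \<open>O(\<mu> \<rho>\<^sup>2)\<close>, independent of
  the angle, and \<open>O(\<rho>^4)\<close>.\<close>

definition polar_normal_form ::
    "(real \<Rightarrow> real \<times> real \<Rightarrow> real \<times> real) \<Rightarrow> (real \<times> real) set \<Rightarrow> (real \<Rightarrow> complex \<Rightarrow> complex) \<Rightarrow>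
     (real \<Rightarrow> real) \<Rightarrow> (real \<Rightarrow> real) \<Rightarrow> real \<Rightarrow> real \<Rightarrow> bool" where
  "polar_normal_form F S H \<sigma> \<Omega> a b \<longleftrightarrow>
     (\<exists>\<epsilon>>0. \<exists>r>0. \<exists>C A B R Q.
        near_identity_change \<epsilon> r H \<and>
        (\<forall>\<mu>. \<bar>\<mu>\<bar> < \<epsilon> \<longrightarrow> \<bar>A \<mu> - a\<bar> \<le> C * \<bar>\<mu>\<bar> \<and> \<bar>B \<mu> - b\<bar> \<le> C * \<bar>\<mu>\<bar>) \<and>
        (\<forall>\<mu> \<rho> \<theta>. \<bar>\<mu>\<bar> < \<epsilon> \<and> 0 < \<rho> \<longrightarrow>
            \<bar>R \<mu> \<rho> \<theta>\<bar> \<le> C * \<rho> ^ 4 \<and> \<bar>Q \<mu> \<rho> \<theta>\<bar> \<le> C * \<rho> ^ 4) \<and>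
        (\<forall>\<mu> I x y \<rho> \<theta>.
            \<bar>\<mu>\<bar> < \<epsilon> \<and> is_interval I \<and> is_solution (F \<mu>) S I (\<lambda>t. (x t, y t)) \<and>
            (\<forall>t\<in>I. Complex (x t) (y t) \<in> ball 0 r \<and> 0 < \<rho> t \<and>
               H \<mu> (Complex (x t) (y t)) = of_real (\<rho> t) * cis (\<theta> t)) \<and>
            continuous_on I \<theta> \<longrightarrow>
            (\<forall>t\<in>I.
               (\<rho> has_real_derivative
                  \<rho> t * (\<sigma> \<mu> + A \<mu> * (\<rho> t)\<^sup>2 + R \<mu> (\<rho> t) (\<theta> t))) (at t within I) \<and>
               (\<theta> has_real_derivative
                  \<Omega> \<mu> + B \<mu> * (\<rho> t)\<^sup>2 + Q \<mu> (\<rho> t) (\<theta> t)) (at t within I))))"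


section \<open>The vector fields\<close>

text \<open>\<^term>\<open>U\<close> is the common domain of the functions of \<open>(y1\<^sup>2, z cnj z)\<close> in the vector fields.\<close>

definition full_field ::
    "(real \<times> real \<Rightarrow> real) \<Rightarrow> (real \<times> real \<Rightarrow> real) \<Rightarrow> (real \<times> real \<Rightarrow> real) \<Rightarrow>
     (real \<times> real \<Rightarrow> real) \<Rightarrow> real \<Rightarrow> real \<Rightarrow> real \<Rightarrow>
     real \<times> real \<times> complex \<Rightarrow> real \<times> real \<times> complex" where
  "full_field f1 f2 f3 f4 \<alpha>1 \<alpha>2 \<alpha>3 = (\<lambda>(y1, y2, z).
     let q = (y1\<^sup>2, (cmod z)\<^sup>2) in
       (y2,
        (\<alpha>1 + f1 q) * y1 + (\<alpha>2 + f2 q) * y2,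
        (\<i> + of_real \<alpha>3 + of_real (f3 q) + \<i> * of_real (f4 q)) * z))"

definition full_domain :: "(real \<times> real) set \<Rightarrow> (real \<times> real \<times> complex) set" where
  "full_domain U = {(y1, y2, z). (y1\<^sup>2, (cmod z)\<^sup>2) \<in> U}"

definition reduced_field ::
    "(real \<times> real \<Rightarrow> real) \<Rightarrow> (real \<times> real \<Rightarrow> real) \<Rightarrow> real \<Rightarrow> real \<Rightarrow>
     real \<times> real \<Rightarrow> real \<times> real" where
  "reduced_field f1 f2 \<alpha>1 \<alpha>2 = (\<lambda>(y1, y2).
     (y2, (\<alpha>1 + f1 (y1\<^sup>2, 0)) * y1 + (\<alpha>2 + f2 (y1\<^sup>2, 0)) * y2))"

text \<open>The planar system in \<open>x = y1\<close>, \<open>y = - y2 / \<omega>\<close>, unfolded by \<open>\<alpha>2\<close>: the rotation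
  \<open>(- \<omega> y, \<omega> x)\<close> plus nonlinear terms for \<open>\<alpha>2 = 0\<close>, and the term \<open>\<alpha>2 y\<close> otherwise.\<close>

definition planar_field ::
    "(real \<times> real \<Rightarrow> real) \<Rightarrow> (real \<times> real \<Rightarrow> real) \<Rightarrow> real \<Rightarrow> real \<Rightarrow>
     real \<times> real \<Rightarrow> real \<times> real" where
  "planar_field f1 f2 \<omega> \<alpha>2 = (\<lambda>(x, y).
     (- \<omega> * y, \<omega> * x) + (0, - (1 / \<omega>) * f1 (x\<^sup>2, 0) * x + f2 (x\<^sup>2, 0) * y) + (0, \<alpha>2 * y))"

definition planar_domain :: "(real \<times> real) set \<Rightarrow> (real \<times> real) set" where
  "planar_domain U = {(x, y). (x\<^sup>2, 0) \<in> U}"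

end

(* In the eigencoordinate of the linear part the vector field is odd, so a polynomial change of
   variables that removes the non-resonant cubic terms leaves a remainder of fifth order and gives the
   polar normal form.  At a maximum and at a minimum of the radius rho along a closed orbit the normal
   form yields alpha_2 / 2 + A rho^2 = O(rho^4); this excludes closed orbits on the wrong side of the
   bifurcation and confines all others to a thin annulus around rho^2 = - 4 alpha_2 / phi_{2,10}.

   In that annulus V = |alpha_2| / |zeta|^2, as a function of the polar angle, satisfies
   dV/dtheta = |alpha_2| (al + be V + O(alpha_2)) with 2 pi-periodic al, be of explicit nonzero mean.
   The contraction principle on periodic functions produces a periodic solution, so no existence theory
   for initial value problems is needed; time is recovered by inverting the integral of dtheta/dt.
   The weighted squared distance of any closed orbit to this solution is strictly monotone unless it
   vanishes, which gives uniqueness.  In the full system |z|^2 is strictly monotone near the origin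
   because alpha_3 is nonzero, so all closed orbits there lie in the plane z = 0. *)

theory Submission
  imports Defs
begin

section \<open>Smooth functions\<close>

text \<open>The variable V is chosen for two reasons: on the expected cycle it is of order one
  whatever the size of alpha_2, and it turns the Bernoulli-type equation for the radius into one
  that is affine to first order. Plain Picard iteration fails, because a periodic solution of
  \<open>v' = e F\<close> contains a free constant on which the iteration does not contract. The
  affine part supplies it: the mean of \<open>F\<close> vanishes exactly when
  \<open>ab + bb k + mean Q = 0\<close> with \<open>Q = O(e)\<close>, and this can be solved for the
  constant \<open>k\<close> because \<open>bb\<close> is nonzero. Contraction and uniqueness need
  Lipschitz dependence on V, while the remainder of the normal form is estimated in size only. Hence
  the cycle is built in the polar coordinates of \<zeta> itself, and the normal form serves to
  localize closed orbits and to state the polar equations. Of the smoothness of \<open>f1\<close>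
  and \<open>f2\<close> the planar argument keeps a linear coefficient and a remainder
  \<open>r\<close> with \<open>|r u - r v| <= K max |u| |v| |u - v|\<close>, so a divergent series
  does no harm.\<close>

lemma Ck_on_cong:
  assumes "open U" "\<And>x. x \<in> U \<Longrightarrow> f x = g x"
  shows "Ck_on n U f \<longleftrightarrow> Ck_on n U g"
  using assms(2)
proof (induction n arbitrary: f g)
  case 0
  then show ?case by (simp cong: continuous_on_cong)
next
  case (Suc n)
  have hd: "(f has_derivative D) (at x) \<longleftrightarrow> (g has_derivative D) (at x)" if "x \<in> U" for x D
    using has_derivative_transform_within_open[OF _ assms(1) that] Suc.prems by metis
  have d: "f differentiable (at x) \<longleftrightarrow> g differentiable (at x)" if "x \<in> U" for x
    using hd[OF that] unfolding differentiable_def by blast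
  have fd: "frechet_derivative f (at x) = frechet_derivative g (at x)" if "x \<in> U" for x
    unfolding frechet_derivative_def using hd[OF that] by simp
  have "Ck_on n U (\<lambda>x. frechet_derivative f (at x) e) \<longleftrightarrow> Ck_on n U (\<lambda>x. frechet_derivative g (at x) e)" for e
    by (rule Suc.IH) (simp add: fd)
  with d show ?case by simp
qed

lemma Ck_on_imp_continuous_on: "Ck_on n U f \<Longrightarrow> continuous_on U f"
  by (cases n) (auto intro!: continuous_at_imp_continuous_on differentiable_imp_continuous_within)

lemma Ck_on_Suc_imp: "Ck_on (Suc n) U f \<Longrightarrow> Ck_on n U f"
proof (induction n arbitrary: f)
  case 0
  show ?case using Ck_on_imp_continuous_on[OF 0] by simp
next
  case (Suc n)
  then show ?case by (metis Ck_on.simps(2))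
qed

text \<open>Uniqueness of the derivative lets any explicit \<open>D\<close> stand for
  \<open>frechet_derivative\<close>; all closure rules below go through this rule.\<close>

lemma Ck_on_SucI:
  assumes "open U" "\<And>x. x \<in> U \<Longrightarrow> (f has_derivative D x) (at x)"
    "\<And>e. e \<in> Basis \<Longrightarrow> Ck_on n U (\<lambda>x. D x e)"
  shows "Ck_on (Suc n) U f"
proof -
  have "frechet_derivative f (at x) = D x" if "x \<in> U" for x
    using assms(2)[OF that] frechet_derivative_at by metis
  then have "Ck_on n U (\<lambda>x. frechet_derivative f (at x) e) \<longleftrightarrow> Ck_on n U (\<lambda>x. D x e)" for e
    using assms(1) by (intro Ck_on_cong) auto
  then show ?thesis using assms by (auto simp: differentiable_def)
qed

lemma Ck_on_SucD:
  assumes "Ck_on (Suc n) U f" "x \<in> U"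
  shows "(f has_derivative frechet_derivative f (at x)) (at x)"
  using assms frechet_derivative_works by auto

lemma Ck_on_subset: "Ck_on n U f \<Longrightarrow> V \<subseteq> U \<Longrightarrow> Ck_on n V f"
proof (induction n arbitrary: f)
  case 0
  then show ?case by (simp add: continuous_on_subset)
next
  case (Suc n)
  then show ?case by (simp add: subset_iff)
qed

lemma Ck_on_const: "open U \<Longrightarrow> Ck_on n U (\<lambda>x. c)"
proof (induction n arbitrary: c)
  case (Suc n)
  then show ?case by (intro Ck_on_SucI[where D = "\<lambda>_ _. 0"]) auto
qed auto

lemma Ck_on_bounded_linear:
  assumes "open U" "bounded_linear L"
  shows "Ck_on n U L"
proof (cases n)
  case (Suc m)
  then show ?thesis
    using assms by (auto intro!: Ck_on_SucI[where D = "\<lambda>_. L"] Ck_on_const bounded_linear_imp_has_derivative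
      simp del: Ck_on.simps(2))
qed (use assms in \<open>auto intro: linear_continuous_on\<close>)

lemma Ck_on_add:
  assumes "open U" "Ck_on n U f" "Ck_on n U g"
  shows "Ck_on n U (\<lambda>x. f x + g x)"
  using assms(2,3)
proof (induction n arbitrary: f g)
  case (Suc n)
  then show ?case
    using assms(1) Suc.prems
    by (intro Ck_on_SucI[where D = "\<lambda>x e. frechet_derivative f (at x) e + frechet_derivative g (at x) e"])
      (auto intro!: has_derivative_add Ck_on_SucD simp del: Ck_on.simps(2), auto)
qed (auto intro: continuous_on_add)

lemma Ck_on_bounded_linear_comp:
  assumes "open U" "bounded_linear L" "Ck_on n U f"
  shows "Ck_on n U (\<lambda>x. L (f x))"
  using assms(3)
proof (induction n arbitrary: f)
  case 0
  then show ?case using bounded_linear.continuous_on[OF assms(2)] by auto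
next
  case (Suc n)
  show ?case
    using assms(1) Suc.prems
    by (intro Ck_on_SucI[where D = "\<lambda>x e. L (frechet_derivative f (at x) e)"])
      (auto intro!: bounded_linear.has_derivative[OF assms(2)] Ck_on_SucD Suc.IH simp del: Ck_on.simps(2), auto)
qed

lemma Ck_on_mult:
  fixes f g :: "'a::euclidean_space \<Rightarrow> 'b::real_normed_algebra"
  assumes "open U" "Ck_on n U f" "Ck_on n U g"
  shows "Ck_on n U (\<lambda>x. f x * g x)"
  using assms(2,3)
proof (induction n arbitrary: f g)
  case (Suc n)
  \<comment> \<open>The product rule mixes derivatives with the factors themselves, so the factors
    are lowered to order \<open>n\<close> before the induction hypothesis applies.\<close>
  have c: "Ck_on n U f" "Ck_on n U g" using Suc.prems Ck_on_Suc_imp by auto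
  show ?case
    using assms(1) Suc.prems
    by (intro Ck_on_SucI[where D = "\<lambda>x e. f x * frechet_derivative g (at x) e + frechet_derivative f (at x) e * g x"])
      (auto intro!: has_derivative_mult Ck_on_SucD Suc.IH Ck_on_add c simp del: Ck_on.simps(2), auto)
qed (auto intro: continuous_on_mult)

text \<open>Bootstrapping: the derivative of the reciprocal is built from the reciprocal itself and
  from the derivative of \<open>f\<close>, so with \<open>f\<close> held fixed order
  \<open>n\<close> of the reciprocal gives order \<open>n + 1\<close>. The square root is treated in
  the same way.\<close>

lemma Ck_on_inverse:
  fixes f :: "'a::euclidean_space \<Rightarrow> 'b::real_normed_field"
  assumes "open U" "Ck_on n U f" "\<And>x. x \<in> U \<Longrightarrow> f x \<noteq> 0"
  shows "Ck_on n U (\<lambda>x. inverse (f x))"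
  using assms(2)
proof (induction n)
  case (Suc n)
  have c: "Ck_on n U (\<lambda>x. inverse (f x))" using Suc Ck_on_Suc_imp by auto
  have "Ck_on n U (\<lambda>x. frechet_derivative f (at x) e)" if "e \<in> Basis" for e
    using Suc.prems that by simp
  then have "Ck_on n U (\<lambda>x. (- 1) * (inverse (f x) * frechet_derivative f (at x) e * inverse (f x)))"
    if "e \<in> Basis" for e
    using that c assms(1) by (intro Ck_on_mult Ck_on_const) auto
  then show ?case
    using assms(1,3) Suc.prems
    by (intro Ck_on_SucI[where D = "\<lambda>x e. - (inverse (f x) * frechet_derivative f (at x) e * inverse (f x))"])
      (auto intro!: Deriv.has_derivative_inverse Ck_on_SucD simp del: Ck_on.simps(2))
qed (use assms in \<open>auto intro: continuous_on_inverse\<close>)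

lemma Ck_on_sqrt:
  fixes f :: "'a::euclidean_space \<Rightarrow> real"
  assumes "open U" "Ck_on n U f" "\<And>x. x \<in> U \<Longrightarrow> f x > 0"
  shows "Ck_on n U (\<lambda>x. sqrt (f x))"
  using assms(2)
proof (induction n)
  case (Suc n)
  have c: "Ck_on n U (\<lambda>x. sqrt (f x))" using Suc Ck_on_Suc_imp by auto
  have s: "sqrt (f x) \<noteq> 0" if "x \<in> U" for x using assms(3)[OF that] by simp
  have "Ck_on n U (\<lambda>x. frechet_derivative f (at x) e)" if "e \<in> Basis" for e
    using Suc.prems that by simp
  then have k: "Ck_on n U (\<lambda>x. frechet_derivative f (at x) e * ((1/2) * inverse (sqrt (f x))))"
    if "e \<in> Basis" for e
    using that c s assms(1) by (intro Ck_on_mult Ck_on_const Ck_on_inverse) auto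
  have "((\<lambda>x. sqrt (f x)) has_derivative (\<lambda>e. frechet_derivative f (at x) e * ((1/2) * inverse (sqrt (f x))))) (at x)"
    if "x \<in> U" for x
    using has_derivative_real_sqrt[OF assms(3)[OF that] Ck_on_SucD[OF Suc.prems that]]
    by (simp add: field_simps)
  then show ?case
    using k assms(1) by (intro Ck_on_SucI) auto
qed (use assms in \<open>auto intro: continuous_on_real_sqrt\<close>)

section \<open>Closure rules for smooth functions\<close>

lemma smooth_on_const: "open U \<Longrightarrow> smooth_on U (\<lambda>x. c)"
  by (simp add: smooth_on_def Ck_on_const)

lemma smooth_on_add: "open U \<Longrightarrow> smooth_on U f \<Longrightarrow> smooth_on U g \<Longrightarrow> smooth_on U (\<lambda>x. f x + g x)"
  by (simp add: smooth_on_def Ck_on_add)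

lemma smooth_on_mult:
  fixes f g :: "'a::euclidean_space \<Rightarrow> 'b::real_normed_algebra"
  shows "open U \<Longrightarrow> smooth_on U f \<Longrightarrow> smooth_on U g \<Longrightarrow> smooth_on U (\<lambda>x. f x * g x)"
  by (simp add: smooth_on_def Ck_on_mult)

lemma smooth_on_inverse:
  fixes f :: "'a::euclidean_space \<Rightarrow> 'b::real_normed_field"
  shows "open U \<Longrightarrow> smooth_on U f \<Longrightarrow> (\<And>x. x \<in> U \<Longrightarrow> f x \<noteq> 0) \<Longrightarrow> smooth_on U (\<lambda>x. inverse (f x))"
  by (simp add: smooth_on_def Ck_on_inverse)

lemma smooth_on_sqrt:
  fixes f :: "'a::euclidean_space \<Rightarrow> real"
  shows "open U \<Longrightarrow> smooth_on U f \<Longrightarrow> (\<And>x. x \<in> U \<Longrightarrow> f x > 0) \<Longrightarrow> smooth_on U (\<lambda>x. sqrt (f x))"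
  by (simp add: smooth_on_def Ck_on_sqrt)

lemma smooth_on_bounded_linear_comp:
  "open U \<Longrightarrow> bounded_linear L \<Longrightarrow> smooth_on U f \<Longrightarrow> smooth_on U (\<lambda>x. L (f x))"
  by (simp add: smooth_on_def Ck_on_bounded_linear_comp)

lemma smooth_on_bounded_linear:
  "open U \<Longrightarrow> bounded_linear L \<Longrightarrow> smooth_on U L"
  by (simp add: smooth_on_def Ck_on_bounded_linear)

lemma smooth_on_uminus: "open U \<Longrightarrow> smooth_on U f \<Longrightarrow> smooth_on U (\<lambda>x. - f x)"
  by (rule smooth_on_bounded_linear_comp[OF _ bounded_linear_minus[OF bounded_linear_ident]])

lemma smooth_on_diff: "open U \<Longrightarrow> smooth_on U f \<Longrightarrow> smooth_on U g \<Longrightarrow> smooth_on U (\<lambda>x. f x - g x)"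
  using smooth_on_add[OF _ _ smooth_on_uminus, of U f g] by simp

lemma smooth_on_power:
  fixes f :: "'a::euclidean_space \<Rightarrow> 'b::real_normed_field"
  shows "open U \<Longrightarrow> smooth_on U f \<Longrightarrow> smooth_on U (\<lambda>x. f x ^ n)"
  by (induction n) (auto intro: smooth_on_const smooth_on_mult)

lemma smooth_on_imp_continuous_on: "smooth_on U f \<Longrightarrow> continuous_on U f"
  using Ck_on_imp_continuous_on smooth_on_def by blast

lemma smooth_on_imp_differentiable: "smooth_on U f \<Longrightarrow> x \<in> U \<Longrightarrow> f differentiable (at x)"
  unfolding smooth_on_def by (metis Ck_on.simps(2))

section \<open>The cubic normal form\<close>

text \<open>If \<open>f - id\<close> has constant \<open>q < 1\<close> relative to \<open>x\<close>,
  then \<open>|f y - f x| >= (1 - q) |y - x|\<close>, and this lower bound passes to the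
  derivative.\<close>

lemma has_derivative_near_identity_inj:
  fixes f :: "'a::real_normed_vector \<Rightarrow> 'a"
  assumes D: "(f has_derivative D) (at x)" and S: "open S" "x \<in> S" and q: "q < 1"
    and lip: "\<And>y. y \<in> S \<Longrightarrow> norm ((f y - f x) - (y - x)) \<le> q * norm (y - x)"
  shows "inj D"
proof -
  interpret D: bounded_linear D using D by (rule has_derivative_bounded_linear)
  have "v = 0" if "D v = 0" for v
  proof (rule ccontr)
    assume v: "v \<noteq> 0"
    \<comment> \<open>Any value strictly between 0 and \<open>1 - q\<close> will do: along a kernel
      vector the increment is at most \<open>e |y - x|\<close>, which contradicts the lower
      bound.\<close>
    define e where "e = (1 - q) / 2"
    have e: "0 < e" "e < 1 - q" using q by (auto simp: e_def)
    obtain r where r: "0 < r" "\<And>y. norm (y - x) < r \<Longrightarrow> norm (f y - f x - D (y - x)) \<le> e * norm (y - x)"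
      using D e(1) unfolding has_derivative_at_alt by blast
    obtain s where s: "0 < s" "ball x s \<subseteq> S" using S open_contains_ball by blast
    define t where "t = min r s / (2 * norm v)"
    have t: "0 < t" using r s v by (simp add: t_def)
    have tv: "t * norm v = min r s / 2" using v by (simp add: t_def)
    define y where "y = x + t *\<^sub>R v"
    have yx: "norm (y - x) = t * norm v" using t by (simp add: y_def)
    have lt: "norm (y - x) < r" "norm (y - x) < s" using yx tv r(1) s(1) by (auto simp: min_def split: if_splits)
    have "y \<in> S" using s(2) lt(2) by (auto simp: dist_norm norm_minus_commute)
    have "norm (f y - f x) \<le> e * norm (y - x)"
      using r(2)[OF lt(1)] that by (simp add: y_def D.scaleR)
    moreover have "norm (y - x) \<le> norm (f y - f x) + q * norm (y - x)"
      using lip[OF \<open>y \<in> S\<close>] norm_triangle_ineq4[of "f y - f x" "(f y - f x) - (y - x)"] by simp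
    ultimately have "(1 - q) * norm (y - x) \<le> e * norm (y - x)" by (simp add: algebra_simps)
    moreover have "norm (y - x) > 0" using yx t v by simp
    ultimately show False using e by simp
  qed
  then show ?thesis
    by (simp add: linear_injective_0 D.linear_axioms)
qed

text \<open>Each difference of cubic monomials telescopes into three terms with one factor
  \<open>a - b\<close>, possibly conjugated, and two factors bounded by \<open>R\<close>; hence the
  3.\<close>

lemma norm_cube_diff_le:
  fixes a b :: complex
  assumes "norm a \<le> R" "norm b \<le> R"
  shows "norm (a^3 - b^3) \<le> 3 * R\<^sup>2 * norm (a - b)"
    "norm (a * (cnj a)\<^sup>2 - b * (cnj b)\<^sup>2) \<le> 3 * R\<^sup>2 * norm (a - b)"
    "norm (a\<^sup>2 * cnj a - b\<^sup>2 * cnj b) \<le> 3 * R\<^sup>2 * norm (a - b)"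
proof -
  have R: "0 \<le> R" using assms(1) norm_ge_zero order_trans by blast
  have p: "norm (u * v) \<le> R\<^sup>2" if "norm u \<le> R" "norm v \<le> R" for u v :: complex
    using that R by (simp add: norm_mult power2_eq_square mult_mono)
  have k: "norm (u1 * v1 * d1 + u2 * v2 * d2 + u3 * v3 * d3) \<le> 3 * R\<^sup>2 * e"
    if "norm u1 \<le> R" "norm v1 \<le> R" "norm u2 \<le> R" "norm v2 \<le> R" "norm u3 \<le> R" "norm v3 \<le> R"
      "norm d1 = e" "norm d2 = e" "norm d3 = e" for u1 v1 u2 v2 u3 v3 d1 d2 d3 :: complex and e
  proof -
    have "norm (u * v * d') \<le> R\<^sup>2 * e" if "norm u \<le> R" "norm v \<le> R" "norm d' = e" for u v d' :: complex
      using mult_right_mono[OF p[OF that(1,2)], of e] that(3) norm_ge_zero[of d'] by (simp add: norm_mult)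
    from this[OF that(1,2,7)] this[OF that(3,4,8)] this[OF that(5,6,9)]
    show ?thesis
      by (intro order_trans[OF norm_triangle_ineq] order_trans[OF add_right_mono[OF norm_triangle_ineq]]) auto
  qed
  have c: "cmod (cnj a - cnj b) = cmod (a - b)" by (metis complex_cnj_diff complex_mod_cnj)
  have 1: "a^3 - b^3 = a * a * (a - b) + a * b * (a - b) + b * b * (a - b)"
    by (simp add: power3_eq_cube algebra_simps)
  show "norm (a^3 - b^3) \<le> 3 * R\<^sup>2 * norm (a - b)"
    unfolding 1 using assms by (intro k) auto
  have 2: "a * (cnj a)\<^sup>2 - b * (cnj b)\<^sup>2 = cnj a * cnj a * (a - b) + b * cnj a * (cnj a - cnj b)
     + b * cnj b * (cnj a - cnj b)"
    by (simp add: power2_eq_square algebra_simps)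
  show "norm (a * (cnj a)\<^sup>2 - b * (cnj b)\<^sup>2) \<le> 3 * R\<^sup>2 * norm (a - b)"
    unfolding 2 using assms c by (intro k) auto
  have 3: "a\<^sup>2 * cnj a - b\<^sup>2 * cnj b = a * cnj a * (a - b) + b * cnj a * (a - b) + b * b * (cnj a - cnj b)"
    by (simp add: power2_eq_square algebra_simps)
  show "norm (a\<^sup>2 * cnj a - b\<^sup>2 * cnj b) \<le> 3 * R\<^sup>2 * norm (a - b)"
    unfolding 3 using assms c by (intro k) auto
qed

text \<open>The planar system \<open>x' = - \<omega> y\<close>, \<open>y' = \<omega> x - \<phi>1(x\<^sup>2) x / \<omega> + \<phi>2(x\<^sup>2) y + m y\<close> with
  \<open>\<phi>1(u) = p u + r1(u)\<close> and \<open>\<phi>2(u) = c u + r2(u)\<close>; the Lipschitz bounds say that \<open>r1\<close> and \<open>r2\<close>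
  are of second order together with their derivatives.\<close>

locale planar_hopf =
  fixes \<omega> p c :: real and r1 r2 :: "real \<Rightarrow> real" and K d :: real
  assumes \<omega>_pos: "0 < \<omega>" and c_nz: "c \<noteq> 0" and K_nonneg: "0 \<le> K" and d_pos: "0 < d"
    and r1_0: "r1 0 = 0" and r2_0: "r2 0 = 0"
    and r1_lip: "\<And>u v. \<bar>u\<bar> < d \<Longrightarrow> \<bar>v\<bar> < d \<Longrightarrow> \<bar>r1 u - r1 v\<bar> \<le> K * max \<bar>u\<bar> \<bar>v\<bar> * \<bar>u - v\<bar>"
    and r2_lip: "\<And>u v. \<bar>u\<bar> < d \<Longrightarrow> \<bar>v\<bar> < d \<Longrightarrow> \<bar>r2 u - r2 v\<bar> \<le> K * max \<bar>u\<bar> \<bar>v\<bar> * \<bar>u - v\<bar>"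
begin

lemma r1_bound: "\<bar>u\<bar> < d \<Longrightarrow> \<bar>r1 u\<bar> \<le> K * u\<^sup>2"
  using r1_lip[of u 0] d_pos by (simp add: r1_0 power2_eq_square mult_ac)

lemma r2_bound: "\<bar>u\<bar> < d \<Longrightarrow> \<bar>r2 u\<bar> \<le> K * u\<^sup>2"
  using r2_lip[of u 0] d_pos by (simp add: r2_0 power2_eq_square mult_ac)

definition n3 :: "real \<Rightarrow> real \<Rightarrow> real" where
  "n3 x y = - (p / \<omega>) * x^3 + c * x\<^sup>2 * y"

text \<open>Of fifth order at the origin, because \<open>r1\<close> and \<open>r2\<close> are
  quadratically small in their argument \<open>x^2\<close>.\<close>

definition n5 :: "real \<Rightarrow> real \<Rightarrow> real" where
  "n5 x y = - (1 / \<omega>) * r1 (x\<^sup>2) * x + r2 (x\<^sup>2) * y"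

definition sol :: "real \<Rightarrow> real set \<Rightarrow> (real \<Rightarrow> real) \<Rightarrow> (real \<Rightarrow> real) \<Rightarrow> bool" where
  "sol m I x y \<longleftrightarrow> (\<forall>t\<in>I. (x has_real_derivative - \<omega> * y t) (at t within I) \<and>
     (y has_real_derivative \<omega> * x t + n3 (x t) (y t) + n5 (x t) (y t) + m * y t) (at t within I))"

text \<open>\<open>lam\<close> is an eigenvalue of the linear part and \<open>zc\<close> the corresponding left eigenvector, normalised
  to be the identity at \<open>m = 0\<close>; \<open>xa\<close> and \<open>ya\<close> express \<open>x\<close> and \<open>y\<close> through \<open>z = zc\<close> as
  \<open>x = 2 Re (xa z)\<close>, \<open>y = 2 Re (ya z)\<close>.  In this coordinate the cubic terms of \<open>z'\<close> have the
  coefficients \<open>Njk\<close> of \<open>z^j (cnj z)^k\<close>, and \<open>hjk\<close> solves the homological equation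
  \<open>(j lam + k cnj lam - lam) hjk = - Njk\<close>; only the resonant term \<open>N21\<close> survives.\<close>

definition om :: "real \<Rightarrow> real" where "om m = sqrt (\<omega>\<^sup>2 - (m / 2)\<^sup>2)"
definition lam :: "real \<Rightarrow> complex" where "lam m = of_real (m / 2) + \<i> * of_real (om m)"
definition xa :: "real \<Rightarrow> complex" where "xa m = - cnj (lam m) / (lam m - cnj (lam m))"
definition ya :: "real \<Rightarrow> complex" where "ya m = of_real \<omega> / (lam m - cnj (lam m))"

text \<open>Only \<open>y'\<close> carries nonlinear terms, and it enters \<open>z'\<close> with the
  weight \<open>lam m / \<omega>\<close>; \<open>X\<close> and \<open>Y\<close> are the coefficients
  of one monomial in \<open>x^3\<close> and in \<open>x^2 y\<close>.\<close>

definition cf :: "real \<Rightarrow> complex \<Rightarrow> complex \<Rightarrow> complex" where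
  "cf m X Y = lam m / of_real \<omega> * (- of_real (p / \<omega>) * X + of_real c * Y)"

definition N30 where "N30 m = cf m (xa m ^ 3) ((xa m)\<^sup>2 * ya m)"
definition N21 where "N21 m = cf m (3 * (xa m)\<^sup>2 * cnj (xa m)) ((xa m)\<^sup>2 * cnj (ya m) + 2 * xa m * cnj (xa m) * ya m)"
definition N12 where "N12 m = cf m (3 * xa m * (cnj (xa m))\<^sup>2) ((cnj (xa m))\<^sup>2 * ya m + 2 * xa m * cnj (xa m) * cnj (ya m))"
definition N03 where "N03 m = cf m (cnj (xa m) ^ 3) ((cnj (xa m))\<^sup>2 * cnj (ya m))"

definition h30 where "h30 m = - N30 m / (2 * lam m)"
definition h12 where "h12 m = - N12 m / (2 * cnj (lam m))"
definition h03 where "h03 m = - N03 m / (3 * cnj (lam m) - lam m)"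

definition zc :: "real \<Rightarrow> complex \<Rightarrow> complex" where
  "zc m \<zeta> = of_real (Re \<zeta>) + lam m / of_real \<omega> * of_real (Im \<zeta>)"

definition cub :: "real \<Rightarrow> complex \<Rightarrow> complex" where
  "cub m z = h30 m * z^3 + h12 m * (z * (cnj z)\<^sup>2) + h03 m * (cnj z)^3"

definition nf :: "real \<Rightarrow> complex \<Rightarrow> complex" where
  "nf m \<zeta> = zc m \<zeta> + cub m (zc m \<zeta>)"

section \<open>Eigenvalues of the linear part and the eigencoordinate\<close>

lemma om_pos: "\<bar>m\<bar> < 2 * \<omega> \<Longrightarrow> 0 < om m"
  unfolding om_def real_sqrt_gt_0_iff using abs_square_less_1[of "m / (2*\<omega>)"] \<omega>_pos
  by (simp add: power_divide divide_simps power2_eq_square abs_mult split: if_splits)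

lemma om_sq: "\<bar>m\<bar> < 2 * \<omega> \<Longrightarrow> (om m)\<^sup>2 = \<omega>\<^sup>2 - (m / 2)\<^sup>2"
  using om_pos[of m] unfolding om_def by (simp add: real_sqrt_gt_0_iff)

lemma lam_simps: "Re (lam m) = m / 2" "Im (lam m) = om m"
  by (simp_all add: lam_def)

text \<open>The non-resonance conditions: the imaginary parts are \<open>om m\<close>,
  \<open>2 om m\<close> and \<open>- 4 om m\<close>.\<close>

lemma lam_nz: "\<bar>m\<bar> < 2 * \<omega> \<Longrightarrow> lam m \<noteq> 0" "\<bar>m\<bar> < 2 * \<omega> \<Longrightarrow> lam m - cnj (lam m) \<noteq> 0"
  "\<bar>m\<bar> < 2 * \<omega> \<Longrightarrow> 3 * cnj (lam m) - lam m \<noteq> 0"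
  using om_pos[of m] by (auto simp: complex_eq_iff lam_simps)

text \<open>The product of the two conjugate eigenvalues is the determinant
  \<open>\<omega>^2\<close> of the linear part.\<close>

lemma cmod_lam: assumes "\<bar>m\<bar> < 2 * \<omega>" shows "cmod (lam m) = \<omega>"
proof -
  have "(cmod (lam m))\<^sup>2 = \<omega>\<^sup>2" using om_sq[OF assms] by (simp add: cmod_power2 lam_simps)
  then show ?thesis using \<omega>_pos by (simp add: power2_eq_iff_nonneg)
qed

text \<open>The characteristic equation of the linear part, with trace \<open>m\<close> and
  determinant \<open>\<omega>^2\<close>.\<close>

lemma lam_sq: assumes "\<bar>m\<bar> < 2 * \<omega>" shows "(lam m)\<^sup>2 = of_real m * lam m - of_real (\<omega>\<^sup>2)"
  using om_sq[OF assms] by (simp add: complex_eq_iff lam_simps power2_eq_square)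

text \<open>\<omega> is the hypotenuse of a right triangle with legs \<open>om m\<close> and
  \<open>|m| / 2\<close>.\<close>

lemma om_diff: assumes "\<bar>m\<bar> < 2 * \<omega>" shows "\<bar>om m - \<omega>\<bar> \<le> \<bar>m\<bar> / 2"
proof -
  have "om m \<le> \<omega>" using om_sq[OF assms] \<omega>_pos
    by (auto intro: power2_le_imp_le[of "om m" \<omega>])
  moreover have "\<omega> \<le> om m + \<bar>m\<bar> / 2"
  proof (rule power2_le_imp_le)
    have "0 \<le> om m * \<bar>m\<bar>" using om_pos[OF assms] by simp
    then show "\<omega>\<^sup>2 \<le> (om m + \<bar>m\<bar> / 2)\<^sup>2"
      using om_sq[OF assms] by (simp add: power2_sum power_divide)
  qed (use om_pos[OF assms] in auto)
  ultimately show ?thesis by auto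
qed

lemma lam_near: assumes "\<bar>m\<bar> < 2 * \<omega>" shows "cmod (lam m / of_real \<omega> - \<i>) \<le> \<bar>m\<bar> / \<omega>"
proof -
  have "lam m / of_real \<omega> - \<i> = (of_real (m/2) + \<i> * of_real (om m - \<omega>)) / of_real \<omega>"
    using \<omega>_pos by (simp add: lam_def field_simps)
  also have "cmod \<dots> \<le> (\<bar>m / 2\<bar> + \<bar>om m - \<omega>\<bar>) / \<omega>"
  proof -
    have "cmod (of_real (m/2) + \<i> * of_real (om m - \<omega>)) \<le> \<bar>m / 2\<bar> + \<bar>om m - \<omega>\<bar>"
      by (rule order_trans[OF norm_triangle_ineq]) (simp only: norm_mult norm_of_real norm_ii, simp)
    then show ?thesis using \<omega>_pos by (simp only: norm_divide norm_of_real) (simp add: divide_right_mono)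
  qed
  also have "\<dots> \<le> \<bar>m\<bar> / \<omega>"
    using om_diff[OF assms] \<omega>_pos by (intro divide_right_mono) auto
  finally show ?thesis .
qed

text \<open>Cramer's rule: \<open>zc m \<zeta>\<close> and its conjugate form a linear system for
  \<open>Re \<zeta>\<close> and \<open>Im \<zeta>\<close> with determinant
  \<open>(cnj (lam m) - lam m) / \<omega>\<close>.\<close>

lemma zc_inverse:
  assumes "\<bar>m\<bar> < 2 * \<omega>"
  shows "of_real (Re \<zeta>) = xa m * zc m \<zeta> + cnj (xa m) * cnj (zc m \<zeta>)"
    "of_real (Im \<zeta>) = ya m * zc m \<zeta> + cnj (ya m) * cnj (zc m \<zeta>)"
proof -
  define l where "l = lam m"
  define J where "J = complex_of_real (Im \<zeta> / \<omega>)"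
  have nz: "l - cnj l \<noteq> 0" using lam_nz(2)[OF assms] by (auto simp: l_def)
  have w: "complex_of_real \<omega> \<noteq> 0" using \<omega>_pos by simp
  have z: "zc m \<zeta> = of_real (Re \<zeta>) + l * J" "cnj (zc m \<zeta>) = of_real (Re \<zeta>) + cnj l * J"
    by (simp_all add: zc_def l_def J_def)
  have cJ: "cnj J = J" by (simp add: J_def)
  have D: "cnj l - l = - (l - cnj l)" by simp
  have cx: "cnj (xa m) = l / (l - cnj l)" and cy: "cnj (ya m) = - of_real \<omega> / (l - cnj l)"
    by (simp_all add: xa_def ya_def l_def[symmetric] D del: minus_diff_eq)
  have "xa m * zc m \<zeta> + cnj (xa m) * cnj (zc m \<zeta>) = ((l - cnj l) * of_real (Re \<zeta>)) / (l - cnj l)"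
    unfolding cx unfolding z xa_def l_def[symmetric] times_divide_eq_left add_divide_distrib[symmetric]
    by (rule arg_cong[where f = "\<lambda>u. u / (l - cnj l)"]) (simp add: algebra_simps cJ)
  then show "of_real (Re \<zeta>) = xa m * zc m \<zeta> + cnj (xa m) * cnj (zc m \<zeta>)" using nz by simp
  have "ya m * zc m \<zeta> + cnj (ya m) * cnj (zc m \<zeta>) = ((l - cnj l) * (of_real \<omega> * J)) / (l - cnj l)"
    unfolding cy unfolding z ya_def l_def[symmetric] times_divide_eq_left add_divide_distrib[symmetric]
    by (rule arg_cong[where f = "\<lambda>u. u / (l - cnj l)"]) (simp add: algebra_simps cJ)
  then show "of_real (Im \<zeta>) = ya m * zc m \<zeta> + cnj (ya m) * cnj (zc m \<zeta>)" using nz w by (simp add: J_def)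
qed

lemma n3_expand:
  assumes "\<bar>m\<bar> < 2 * \<omega>"
  shows "lam m / of_real \<omega> * of_real (n3 (Re \<zeta>) (Im \<zeta>)) =
    N30 m * (zc m \<zeta>)^3 + N21 m * ((zc m \<zeta>)\<^sup>2 * cnj (zc m \<zeta>)) + N12 m * (zc m \<zeta> * (cnj (zc m \<zeta>))\<^sup>2)
      + N03 m * (cnj (zc m \<zeta>))^3"
proof -
  define z where "z = zc m \<zeta>"
  define X where "X = xa m"
  define Y where "Y = ya m"
  define L where "L = lam m / complex_of_real \<omega>"
  define P where "P = complex_of_real (p / \<omega>)"
  have "complex_of_real (n3 (Re \<zeta>) (Im \<zeta>)) = - P * (of_real (Re \<zeta>))^3 + of_real c * (of_real (Re \<zeta>))\<^sup>2 * of_real (Im \<zeta>)"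
    unfolding n3_def P_def by simp
  also have "\<dots> = - P * (X * z + cnj X * cnj z)^3 + of_real c * (X * z + cnj X * cnj z)\<^sup>2 * (Y * z + cnj Y * cnj z)"
    unfolding zc_inverse[OF assms, of \<zeta>] X_def Y_def z_def ..
  also have "\<dots> = - P * (X^3 * z^3 + 3 * X\<^sup>2 * cnj X * (z\<^sup>2 * cnj z) + 3 * X * (cnj X)\<^sup>2 * (z * (cnj z)\<^sup>2) + (cnj X)^3 * (cnj z)^3)
      + of_real c * (X\<^sup>2 * Y * z^3 + (X\<^sup>2 * cnj Y + 2 * X * cnj X * Y) * (z\<^sup>2 * cnj z)
        + ((cnj X)\<^sup>2 * Y + 2 * X * cnj X * cnj Y) * (z * (cnj z)\<^sup>2) + (cnj X)\<^sup>2 * cnj Y * (cnj z)^3)"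
  proof -
    have cube: "(a * z + b * w)^3 = a^3 * z^3 + 3 * a\<^sup>2 * b * (z\<^sup>2 * w) + 3 * a * b\<^sup>2 * (z * w\<^sup>2) + b^3 * w^3"
      and sq: "(a * z + b * w)\<^sup>2 * (e * z + f * w) = a\<^sup>2 * e * z^3 + (a\<^sup>2 * f + 2 * a * b * e) * (z\<^sup>2 * w)
        + (b\<^sup>2 * e + 2 * a * b * f) * (z * w\<^sup>2) + b\<^sup>2 * f * w^3" for a b e f z w :: complex
      by (simp_all add: power3_eq_cube power2_eq_square algebra_simps)
    show ?thesis unfolding mult.assoc[of "of_real c"] cube sq by simp
  qed
  finally have n: "complex_of_real (n3 (Re \<zeta>) (Im \<zeta>)) =
      - P * (X^3 * z^3 + 3 * X\<^sup>2 * cnj X * (z\<^sup>2 * cnj z) + 3 * X * (cnj X)\<^sup>2 * (z * (cnj z)\<^sup>2) + (cnj X)^3 * (cnj z)^3)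
      + of_real c * (X\<^sup>2 * Y * z^3 + (X\<^sup>2 * cnj Y + 2 * X * cnj X * Y) * (z\<^sup>2 * cnj z)
        + ((cnj X)\<^sup>2 * Y + 2 * X * cnj X * cnj Y) * (z * (cnj z)\<^sup>2) + (cnj X)\<^sup>2 * cnj Y * (cnj z)^3)" .
  \<comment> \<open>Stated for opaque variables, so that collecting the four monomials does not
    multiply out their coefficients.\<close>
  have lin: "L * (- P * (x1 * a + x2 * b + x3 * e + x4 * f) + C * (y1 * a + y2 * b + y3 * e + y4 * f)) =
      L * (- P * x1 + C * y1) * a + L * (- P * x2 + C * y2) * b + L * (- P * x3 + C * y3) * e
        + L * (- P * x4 + C * y4) * f" for C x1 x2 x3 x4 y1 y2 y3 y4 a b e f
    by (simp add: algebra_simps)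
  show ?thesis
    unfolding N30_def N21_def N12_def N03_def cf_def z_def[symmetric] X_def[symmetric] Y_def[symmetric]
      P_def[symmetric] L_def[symmetric] n by (rule lin)
qed

end

context planar_hopf
begin

section \<open>Dependence of the coefficients on the parameter\<close>

lemma smooth_on_lam:
  assumes U: "open U" and g: "smooth_on U g" "\<And>q. q \<in> U \<Longrightarrow> \<bar>g q\<bar> < 2 * \<omega>"
  shows "smooth_on U (\<lambda>q. lam (g q))" "smooth_on U (\<lambda>q. cnj (lam (g q)))"
proof -
  have g2: "smooth_on U (\<lambda>q. g q * (1/2))"
    using U g(1) by (intro smooth_on_mult smooth_on_const)
  have "smooth_on U (\<lambda>q. sqrt (\<omega>\<^sup>2 - (g q * (1/2))\<^sup>2))"
  proof (intro smooth_on_sqrt smooth_on_diff smooth_on_const smooth_on_power g2 U)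
    fix q assume "q \<in> U"
    from om_pos[OF g(2)[OF this]] show "0 < \<omega>\<^sup>2 - (g q * (1/2))\<^sup>2" by (simp add: om_def)
  qed
  then have "smooth_on U (\<lambda>q. complex_of_real (g q * (1/2)) + \<i> * complex_of_real (sqrt (\<omega>\<^sup>2 - (g q * (1/2))\<^sup>2)))"
    using g2 by (intro smooth_on_add smooth_on_mult[where f = "\<lambda>_. \<i>"] smooth_on_const U smooth_on_bounded_linear_comp[OF U bounded_linear_of_real])
  then show *: "smooth_on U (\<lambda>q. lam (g q))" by (simp add: lam_def om_def)
  show "smooth_on U (\<lambda>q. cnj (lam (g q)))"
    by (rule smooth_on_bounded_linear_comp[OF U bounded_linear_cnj *])
qed

text \<open>The parameter enters through an arbitrary smooth \<open>g\<close>: the first projection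
  gives joint smoothness in \<open>(m, \<zeta>)\<close>, the identity gives bounds and derivatives
  in \<open>m\<close> alone.\<close>

lemma smooth_on_coeffs:
  assumes U: "open U" and g: "smooth_on U g" "\<And>q. q \<in> U \<Longrightarrow> \<bar>g q\<bar> < 2 * \<omega>"
  shows "smooth_on U (\<lambda>q. h30 (g q))" "smooth_on U (\<lambda>q. h12 (g q))" "smooth_on U (\<lambda>q. h03 (g q))"
    "smooth_on U (\<lambda>q. N21 (g q))"
proof -
  note l = smooth_on_lam[OF assms]
  have x: "smooth_on U (\<lambda>q. xa (g q))" and y: "smooth_on U (\<lambda>q. ya (g q))"
    unfolding xa_def ya_def divide_inverse using lam_nz(2)[OF g(2)]
    by (intro smooth_on_mult smooth_on_uminus smooth_on_inverse smooth_on_diff l smooth_on_const U; simp)+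
  note cx = smooth_on_bounded_linear_comp[OF U bounded_linear_cnj x]
  note cy = smooth_on_bounded_linear_comp[OF U bounded_linear_cnj y]
  note si = smooth_on_mult smooth_on_add smooth_on_power smooth_on_uminus l x y cx cy smooth_on_const U
  have cf: "smooth_on U (\<lambda>q. cf (g q) (X q) (Y q))" if "smooth_on U X" "smooth_on U Y" for X Y
    unfolding cf_def divide_inverse by (intro si that)
  have n: "smooth_on U (\<lambda>q. N30 (g q))" "smooth_on U (\<lambda>q. N12 (g q))" "smooth_on U (\<lambda>q. N03 (g q))"
    and n21: "smooth_on U (\<lambda>q. N21 (g q))"
    unfolding N30_def N21_def N12_def N03_def
    by (rule cf; intro si)+
  show "smooth_on U (\<lambda>q. N21 (g q))" by (fact n21)
  show "smooth_on U (\<lambda>q. h30 (g q))" "smooth_on U (\<lambda>q. h12 (g q))" "smooth_on U (\<lambda>q. h03 (g q))"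
    unfolding h30_def h12_def h03_def divide_inverse
    using lam_nz(1,3)[OF g(2)] by (intro si n smooth_on_inverse smooth_on_diff; simp)+
qed

lemma smooth_on_nf:
  "smooth_on ({- \<omega> <..< \<omega>} \<times> ball 0 r) (\<lambda>(m, \<zeta>). nf m \<zeta>)"
proof -
  let ?U = "{- \<omega> <..< \<omega>} \<times> ball (0 :: complex) r"
  have U: "open ?U" by (intro open_Times) auto
  have g: "smooth_on ?U (\<lambda>q. fst q)" by (rule smooth_on_bounded_linear[OF U bounded_linear_fst])
  have gb: "\<bar>fst q\<bar> < 2 * \<omega>" if "q \<in> ?U" for q using that by auto
  have "bounded_linear (\<lambda>q::real \<times> complex. complex_of_real (Re (snd q)))"
    "bounded_linear (\<lambda>q::real \<times> complex. complex_of_real (Im (snd q)))"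
    by (intro bounded_linear_compose[OF bounded_linear_of_real] bounded_linear_compose[OF bounded_linear_Re]
        bounded_linear_compose[OF bounded_linear_Im] bounded_linear_snd)+
  then have z: "smooth_on ?U (\<lambda>q. zc (fst q) (snd q))"
    unfolding zc_def divide_inverse
    by (intro smooth_on_add smooth_on_mult smooth_on_const smooth_on_lam[OF U g] U smooth_on_bounded_linear gb)
  note cz = smooth_on_bounded_linear_comp[OF U bounded_linear_cnj z]
  have "smooth_on ?U (\<lambda>q. nf (fst q) (snd q))"
    unfolding nf_def cub_def
    by (intro smooth_on_add smooth_on_mult smooth_on_power smooth_on_coeffs[OF U g] z cz U gb)
  then show ?thesis by (simp add: case_prod_unfold)
qed

text \<open>Continuity on a compact interval that lies inside \<open>|m| < 2 \<omega>\<close>, where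
  the coefficients are smooth.\<close>

lemma coeffs_bounded:
  obtains B where "0 \<le> B" "\<And>m. \<bar>m\<bar> \<le> \<omega> \<Longrightarrow> cmod (h30 m) \<le> B" "\<And>m. \<bar>m\<bar> \<le> \<omega> \<Longrightarrow> cmod (h12 m) \<le> B"
    "\<And>m. \<bar>m\<bar> \<le> \<omega> \<Longrightarrow> cmod (h03 m) \<le> B" "\<And>m. \<bar>m\<bar> \<le> \<omega> \<Longrightarrow> cmod (N21 m) \<le> B"
proof -
  let ?U = "{- (2 * \<omega>) <..< 2 * \<omega>}"
  have g: "smooth_on ?U (\<lambda>m. m)" by (intro smooth_on_bounded_linear) auto
  have gb: "\<bar>m\<bar> < 2 * \<omega>" if "m \<in> ?U" for m using that by auto
  have bd: "\<exists>B. \<forall>m\<in>{- \<omega>..\<omega>}. cmod (h m) \<le> B" if "smooth_on ?U h" for h :: "real \<Rightarrow> complex"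
  proof -
    have "continuous_on {- \<omega>..\<omega>} h"
      by (rule continuous_on_subset[OF smooth_on_imp_continuous_on[OF that]]) (use \<omega>_pos in auto)
    then have "bounded (h ` {- \<omega>..\<omega>})"
      by (intro compact_imp_bounded compact_continuous_image) auto
    then show ?thesis by (auto simp: bounded_iff)
  qed
  note s = smooth_on_coeffs[of ?U "\<lambda>m. m", OF _ g gb, simplified]
  from bd[OF s(1)] bd[OF s(2)] bd[OF s(3)] bd[OF s(4)] obtain B1 B2 B3 B4 where
    B: "\<forall>m\<in>{- \<omega>..\<omega>}. cmod (h30 m) \<le> B1" "\<forall>m\<in>{- \<omega>..\<omega>}. cmod (h12 m) \<le> B2"
      "\<forall>m\<in>{- \<omega>..\<omega>}. cmod (h03 m) \<le> B3" "\<forall>m\<in>{- \<omega>..\<omega>}. cmod (N21 m) \<le> B4" by auto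
  have 0: "0 \<in> {- \<omega>..\<omega>}" using \<omega>_pos by auto
  have nn: "0 \<le> B1" "0 \<le> B2" "0 \<le> B3" "0 \<le> B4"
    using B[THEN bspec, OF 0] by (auto intro: order_trans[OF norm_ge_zero])
  show thesis
  proof (rule that[of "B1 + B2 + B3 + B4"])
    fix m :: real assume "\<bar>m\<bar> \<le> \<omega>"
    then have "m \<in> {- \<omega>..\<omega>}" by auto
    note b = B[THEN bspec, OF this]
    show "cmod (h30 m) \<le> B1 + B2 + B3 + B4" "cmod (h12 m) \<le> B1 + B2 + B3 + B4"
      "cmod (h03 m) \<le> B1 + B2 + B3 + B4" "cmod (N21 m) \<le> B1 + B2 + B3 + B4"
      using b nn by linarith+
  qed (use nn in auto)
qed

text \<open>Differentiability at 0: the linear part contributes the bound \<open>M\<close>, the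
  remainder contributes 1.\<close>

lemma N21_near:
  obtains C e where "0 \<le> C" "0 < e" "\<And>m. \<bar>m\<bar> < e \<Longrightarrow> cmod (N21 m - N21 0) \<le> C * \<bar>m\<bar>"
proof -
  let ?U = "{- (2 * \<omega>) <..< 2 * \<omega>}"
  have g: "smooth_on ?U (\<lambda>m. m)" by (intro smooth_on_bounded_linear) auto
  have gb: "\<bar>m\<bar> < 2 * \<omega>" if "m \<in> ?U" for m using that by auto
  have "N21 differentiable (at 0)"
    using smooth_on_imp_differentiable[OF smooth_on_coeffs(4)[of ?U "\<lambda>m. m", OF _ g gb], of 0] \<omega>_pos by simp
  then obtain D where D: "(N21 has_derivative D) (at 0)" by (auto simp: differentiable_def)
  then interpret D: bounded_linear D by (rule has_derivative_bounded_linear)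
  obtain M where M: "\<And>x. norm (D x) \<le> norm x * M" "0 \<le> M" using D.nonneg_bounded by blast
  obtain e where e: "0 < e" "\<And>y. norm (y - 0) < e \<Longrightarrow> norm (N21 y - N21 0 - D (y - 0)) \<le> 1 * norm (y - 0)"
    using D unfolding has_derivative_at_alt by (meson zero_less_one)
  have "cmod (N21 m - N21 0) \<le> (1 + M) * \<bar>m\<bar>" if "\<bar>m\<bar> < e" for m
  proof -
    have "cmod (N21 m - N21 0) \<le> cmod (N21 m - N21 0 - D m) + cmod (D m)"
      using norm_triangle_ineq[of "N21 m - N21 0 - D m" "D m"] by simp
    also have "\<dots> \<le> \<bar>m\<bar> + \<bar>m\<bar> * M" using e(2)[of m] that M(1)[of m] by (intro add_mono) auto
    finally show ?thesis by (simp add: algebra_simps)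
  qed
  then show thesis using M(2) e(1) by (intro that[of "1 + M" e]) auto
qed

text \<open>At \<open>m = 0\<close> the eigencoordinate is \<open>x + i y\<close>, and the resonant
  coefficient gets a real part from \<open>c x^2 y\<close> and only an imaginary one from
  \<open>p x^3\<close>. This is the factor 1/8 of the radial equation.\<close>

lemma Re_N21_0: "Re (N21 0) = c / 8"
proof -
  have l: "lam 0 = \<i> * of_real \<omega>" using \<omega>_pos by (simp add: lam_def om_def)
  have x: "xa 0 = 1 / 2" and y: "ya 0 = - \<i> / 2"
    using \<omega>_pos by (simp_all add: xa_def ya_def l divide_simps complex_eq_iff)
  show ?thesis using \<omega>_pos unfolding N21_def cf_def x y l
    by (simp add: complex_eq_iff power2_eq_square Re_divide Im_divide field_simps)
qed

lemma cmod_zc: assumes "\<bar>m\<bar> < 2 * \<omega>" shows "cmod (zc m \<zeta>) \<le> 2 * cmod \<zeta>"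
proof -
  have "cmod (zc m \<zeta>) \<le> \<bar>Re \<zeta>\<bar> + \<bar>Im \<zeta>\<bar>"
    unfolding zc_def by (rule order_trans[OF norm_triangle_ineq])
      (use \<omega>_pos cmod_lam[OF assms] in \<open>simp add: norm_mult norm_divide\<close>)
  then show ?thesis using abs_Re_le_cmod[of \<zeta>] abs_Im_le_cmod[of \<zeta>] by linarith
qed

text \<open>The deviation of \<open>nf\<close> from the identity splits into the linear defect
  \<open>lam m / \<omega> - \<i>\<close>, bounded by \<open>|m| / \<omega>\<close>, and the cubic
  part, whose Lipschitz constant on radius \<open>R\<close> is of order \<open>R^2\<close>.\<close>

lemma nf_near_identity:
  obtains B where "0 \<le> B" "\<And>m \<zeta> \<zeta>' R. \<bar>m\<bar> \<le> \<omega> \<Longrightarrow> cmod \<zeta> \<le> R \<Longrightarrow> cmod \<zeta>' \<le> R \<Longrightarrow>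
    cmod (nf m \<zeta> - nf m \<zeta>' - (\<zeta> - \<zeta>')) \<le> (\<bar>m\<bar> / \<omega> + B * R\<^sup>2) * cmod (\<zeta> - \<zeta>')"
proof -
  obtain B where B: "0 \<le> B" "\<And>m. \<bar>m\<bar> \<le> \<omega> \<Longrightarrow> cmod (h30 m) \<le> B" "\<And>m. \<bar>m\<bar> \<le> \<omega> \<Longrightarrow> cmod (h12 m) \<le> B"
    "\<And>m. \<bar>m\<bar> \<le> \<omega> \<Longrightarrow> cmod (h03 m) \<le> B" by (rule coeffs_bounded) blast
  \<comment> \<open>The 72 is \<open>3 * 12 * 2\<close>: three monomials with Lipschitz constant
    \<open>3 (2 R)^2\<close> each, and \<open>|z - z'|\<close> at most
    \<open>2 |\<zeta> - \<zeta>'|\<close>.\<close>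
  have "cmod (nf m \<zeta> - nf m \<zeta>' - (\<zeta> - \<zeta>')) \<le> (\<bar>m\<bar> / \<omega> + (72 * B) * R\<^sup>2) * cmod (\<zeta> - \<zeta>')"
    if m: "\<bar>m\<bar> \<le> \<omega>" and R: "cmod \<zeta> \<le> R" "cmod \<zeta>' \<le> R" for m \<zeta> \<zeta>' R
  proof -
    have m2: "\<bar>m\<bar> < 2 * \<omega>" using m \<omega>_pos by linarith
    define z z' where "z = zc m \<zeta>" and "z' = zc m \<zeta>'"
    have zR: "cmod z \<le> 2 * R" "cmod z' \<le> 2 * R"
      using cmod_zc[OF m2] R by (force simp: z_def z'_def intro: order_trans)+
    have "zc m \<zeta> - zc m \<zeta>' = zc m (\<zeta> - \<zeta>')" by (simp add: zc_def algebra_simps)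
    then have zz: "cmod (z - z') \<le> 2 * cmod (\<zeta> - \<zeta>')" using cmod_zc[OF m2] by (simp add: z_def z'_def)
    have "z - z' - (\<zeta> - \<zeta>') = (lam m / of_real \<omega> - \<i>) * of_real (Im (\<zeta> - \<zeta>'))"
    proof -
      have "\<zeta> - \<zeta>' = of_real (Re (\<zeta> - \<zeta>')) + \<i> * of_real (Im (\<zeta> - \<zeta>'))" by (rule complex_eq)
      then show ?thesis by (simp only: z_def z'_def zc_def) (simp add: algebra_simps)
    qed
    then have "cmod (z - z' - (\<zeta> - \<zeta>')) \<le> \<bar>m\<bar> / \<omega> * cmod (\<zeta> - \<zeta>')"
      using lam_near[OF m2] abs_Im_le_cmod[of "\<zeta> - \<zeta>'"] \<omega>_pos
      by (simp only: norm_mult norm_of_real) (intro mult_mono, auto)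
    moreover have "cmod (cub m z - cub m z') \<le> B * (36 * R\<^sup>2) * cmod (z - z')"
    proof -
      note n = norm_cube_diff_le[OF zR]
      have n': "cmod ((cnj z)^3 - (cnj z')^3) \<le> 3 * (2 * R)\<^sup>2 * cmod (z - z')"
        using n(1) by (metis complex_cnj_diff complex_cnj_power complex_mod_cnj)
      have e: "cub m z - cub m z' = h30 m * (z^3 - z'^3) + h12 m * (z * (cnj z)\<^sup>2 - z' * (cnj z')\<^sup>2)
        + h03 m * ((cnj z)^3 - (cnj z')^3)" by (simp add: cub_def algebra_simps)
      have "cmod (cub m z - cub m z') \<le> B * (3 * (2 * R)\<^sup>2 * cmod (z - z')) + B * (3 * (2 * R)\<^sup>2 * cmod (z - z'))
        + B * (3 * (2 * R)\<^sup>2 * cmod (z - z'))"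
        unfolding e using n n' B(2-4)[OF m] B(1)
        by (intro order_trans[OF norm_triangle_ineq] add_mono) (auto simp: norm_mult intro!: mult_mono)
      then show ?thesis by (simp add: algebra_simps)
    qed
    then have "cmod (cub m z - cub m z') \<le> B * (36 * R\<^sup>2) * (2 * cmod (\<zeta> - \<zeta>'))"
      using zz B(1) by (meson mult_left_mono order_trans mult_nonneg_nonneg zero_le_numeral zero_le_power2)
    moreover have "nf m \<zeta> - nf m \<zeta>' - (\<zeta> - \<zeta>') = (z - z' - (\<zeta> - \<zeta>')) + (cub m z - cub m z')"
      by (simp add: nf_def z_def z'_def)
    ultimately show ?thesis
      using norm_triangle_ineq[of "z - z' - (\<zeta> - \<zeta>')" "cub m z - cub m z'"]
      by (simp only: distrib_right)
  qed
  with B(1) show thesis by (intro that[of "72 * B"]) auto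
qed

lemma nf_0: "nf m 0 = 0" by (simp add: nf_def zc_def cub_def)

section \<open>The transformed vector field and its fifth-order remainder\<close>

definition zd :: "real \<Rightarrow> complex \<Rightarrow> complex" where
  "zd m \<zeta> = lam m * zc m \<zeta> + lam m / of_real \<omega> * of_real (n3 (Re \<zeta>) (Im \<zeta>) + n5 (Re \<zeta>) (Im \<zeta>))"

text \<open>The chain rule applied to \<open>nf\<close>: \<open>zd\<close> and \<open>wd\<close> are
  the velocities of \<open>zc\<close> and \<open>nf\<close> along a solution, written as functions
  of the point.\<close>

definition wd :: "real \<Rightarrow> complex \<Rightarrow> complex" where
  "wd m \<zeta> = zd m \<zeta> + h30 m * (3 * (zc m \<zeta>)\<^sup>2 * zd m \<zeta>)
     + h12 m * (zd m \<zeta> * (cnj (zc m \<zeta>))\<^sup>2 + zc m \<zeta> * (2 * cnj (zc m \<zeta>) * cnj (zd m \<zeta>)))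
     + h03 m * (3 * (cnj (zc m \<zeta>))\<^sup>2 * cnj (zd m \<zeta>))"

lemma sol_nf:
  assumes m: "\<bar>m\<bar> < 2 * \<omega>" and s: "sol m I x y" and t: "t \<in> I"
  shows "((\<lambda>t. nf m (Complex (x t) (y t))) has_vector_derivative wd m (Complex (x t) (y t))) (at t within I)"
proof -
  define z where "z = (\<lambda>t. zc m (Complex (x t) (y t)))"
  have zeq: "z = (\<lambda>t. of_real (x t) + lam m / of_real \<omega> * of_real (y t))" by (simp add: z_def zc_def)
  have x: "(x has_real_derivative - \<omega> * y t) (at t within I)"
    and y: "(y has_real_derivative \<omega> * x t + (n3 (x t) (y t) + n5 (x t) (y t)) + m * y t) (at t within I)"
    using s t unfolding sol_def by (auto simp: add.assoc)
  let ?n = "n3 (x t) (y t) + n5 (x t) (y t)"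
  let ?zd = "zd m (Complex (x t) (y t))"
  have "(z has_vector_derivative of_real (- \<omega> * y t) + lam m / of_real \<omega> * of_real (\<omega> * x t + ?n + m * y t)) (at t within I)"
    unfolding zeq by (intro has_vector_derivative_add has_vector_derivative_mult_right has_vector_derivative_of_real x y)
  moreover have "of_real (- \<omega> * y t) + lam m / of_real \<omega> * of_real (\<omega> * x t + ?n + m * y t) = ?zd"
  proof -
    \<comment> \<open>By the characteristic equation the two linear \<open>y\<close> terms combine,
      so that the linear part acts on \<open>z\<close> as multiplication by
      \<open>lam m\<close>.\<close>
    have "lam m * (lam m / of_real \<omega>) = of_real m * (lam m / of_real \<omega>) - of_real \<omega>"
      using lam_sq[OF m] \<omega>_pos by (simp add: power2_eq_square field_simps)
    then have "lam m * (lam m / of_real \<omega> * of_real (y t)) = (of_real m * (lam m / of_real \<omega>) - of_real \<omega>) * of_real (y t)"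
      by (simp only: mult.assoc[symmetric])
    then have l: "lam m * zc m (Complex (x t) (y t)) = lam m * of_real (x t) + (of_real m * (lam m / of_real \<omega>) - of_real \<omega>) * of_real (y t)"
      by (simp only: zc_def complex.sel distrib_left)
    show ?thesis
      unfolding zd_def l using \<omega>_pos by (simp add: algebra_simps)
  qed
  ultimately have z': "(z has_vector_derivative ?zd) (at t within I)" by simp
  then have cz': "((\<lambda>t. cnj (z t)) has_vector_derivative cnj ?zd) (at t within I)"
    by (rule has_vector_derivative_cnj)
  have p2: "((\<lambda>t. (f t)\<^sup>2) has_vector_derivative 2 * f t * f') (at t within I)"
    if "(f has_vector_derivative f') (at t within I)" for f :: "real \<Rightarrow> complex" and f'
    using has_vector_derivative_mult[OF that that] by (simp add: power2_eq_square algebra_simps)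
  have p3: "((\<lambda>t. (f t)^3) has_vector_derivative 3 * (f t)\<^sup>2 * f') (at t within I)"
    if "(f has_vector_derivative f') (at t within I)" for f :: "real \<Rightarrow> complex" and f'
    using has_vector_derivative_mult[OF that p2[OF that]] by (simp add: power3_eq_cube power2_eq_square algebra_simps)
  have "((\<lambda>t. z t + (h30 m * z t ^ 3 + h12 m * (z t * (cnj (z t))\<^sup>2) + h03 m * (cnj (z t))^3)) has_vector_derivative
     ?zd + (h30 m * (3 * (z t)\<^sup>2 * ?zd) + h12 m * (z t * (2 * cnj (z t) * cnj ?zd) + ?zd * (cnj (z t))\<^sup>2)
       + h03 m * (3 * (cnj (z t))\<^sup>2 * cnj ?zd))) (at t within I)"
    by (intro has_vector_derivative_add has_vector_derivative_mult_right has_vector_derivative_mult p2 p3 z' cz')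
  then show ?thesis
    unfolding nf_def cub_def wd_def z_def by (simp add: algebra_simps)
qed

text \<open>The defect of the truncated Poincare normal form
  \<open>w' = lam w + N21 w^2 cnj w\<close>.\<close>

definition rem :: "real \<Rightarrow> complex \<Rightarrow> complex" where
  "rem m \<zeta> = wd m \<zeta> - lam m * nf m \<zeta> - N21 m * ((nf m \<zeta>)\<^sup>2 * cnj (nf m \<zeta>))"

text \<open>The coefficients \<open>h30\<close>, \<open>h12\<close>, \<open>h03\<close> cancel all
  cubic terms except the resonant one. What is left carries \<open>n5\<close>, or is a quadratic
  monomial times the cubic \<open>q\<close>, or is the difference of the resonant monomial in
  \<open>z\<close> and in \<open>w\<close>, where \<open>z - w\<close> is cubic.\<close>

lemma rem_bound:
  obtains C where "0 \<le> C" "\<And>m \<zeta>. \<bar>m\<bar> \<le> \<omega> \<Longrightarrow> cmod \<zeta> \<le> 1 \<Longrightarrow> (cmod \<zeta>)\<^sup>2 < d \<Longrightarrow> cmod (rem m \<zeta>) \<le> C * cmod \<zeta> ^ 5"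
proof -
  obtain B where B: "0 \<le> B" "\<And>m. \<bar>m\<bar> \<le> \<omega> \<Longrightarrow> cmod (h30 m) \<le> B" "\<And>m. \<bar>m\<bar> \<le> \<omega> \<Longrightarrow> cmod (h12 m) \<le> B"
    "\<And>m. \<bar>m\<bar> \<le> \<omega> \<Longrightarrow> cmod (h03 m) \<le> B" "\<And>m. \<bar>m\<bar> \<le> \<omega> \<Longrightarrow> cmod (N21 m) \<le> B" by (rule coeffs_bounded) blast
  define A where "A = 2 + 24 * B"
  define M3 where "M3 = \<bar>p\<bar> / \<omega> + \<bar>c\<bar>"
  define M5 where "M5 = K / \<omega> + K"
  have nn: "0 \<le> A" "0 \<le> M3" "0 \<le> M5" "2 \<le> A" using B(1) K_nonneg \<omega>_pos by (auto simp: A_def M3_def M5_def)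
  \<comment> \<open>The summands belong to the resonant difference, to \<open>n5\<close> and to
    \<open>J\<close>, as bounded in \<open>b1\<close>, \<open>b2\<close> and
    \<open>b3\<close>.\<close>
  define C where "C = B * (3 * A\<^sup>2 * (24 * B)) + M5 + 36 * B * (M3 + M5)"
  have "cmod (rem m \<zeta>) \<le> C * cmod \<zeta> ^ 5"
    if m: "\<bar>m\<bar> \<le> \<omega>" and s1: "cmod \<zeta> \<le> 1" and sd: "(cmod \<zeta>)\<^sup>2 < d" for m \<zeta>
  proof -
    have m2: "\<bar>m\<bar> < 2 * \<omega>" using m \<omega>_pos by linarith
    define s where "s = cmod \<zeta>"
    have s: "0 \<le> s" "s \<le> 1" using s1 by (auto simp: s_def)
    define x y where "x = Re \<zeta>" and "y = Im \<zeta>"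
    have xy: "\<bar>x\<bar> \<le> s" "\<bar>y\<bar> \<le> s" by (auto simp: x_def y_def s_def abs_Re_le_cmod abs_Im_le_cmod)
    have x2: "x\<^sup>2 \<le> s\<^sup>2" using power_mono[OF xy(1) abs_ge_zero, of 2] unfolding power2_abs .
    have x3: "\<bar>x\<bar>^3 \<le> s^3" using power_mono[OF xy(1) abs_ge_zero, of 3] .
    define z where "z = zc m \<zeta>"
    define w where "w = nf m \<zeta>"
    have z: "cmod z \<le> 2 * s" using cmod_zc[OF m2] by (simp add: z_def s_def)
    have n3: "\<bar>n3 x y\<bar> \<le> M3 * s^3"
    proof -
      have "\<bar>n3 x y\<bar> \<le> \<bar>p\<bar> / \<omega> * \<bar>x\<bar>^3 + \<bar>c\<bar> * (x\<^sup>2 * \<bar>y\<bar>)"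
        unfolding n3_def using \<omega>_pos by (intro order_trans[OF abs_triangle_ineq]) (simp add: abs_mult power_abs mult_ac)
      also have "\<dots> \<le> \<bar>p\<bar> / \<omega> * s^3 + \<bar>c\<bar> * (s\<^sup>2 * s)"
        using x3 x2 xy s \<omega>_pos by (intro add_mono mult_left_mono mult_mono) auto
      finally show ?thesis by (simp add: M3_def algebra_simps power3_eq_cube power2_eq_square)
    qed
    have n5: "\<bar>n5 x y\<bar> \<le> M5 * s^5"
    proof -
      have "\<bar>x\<^sup>2\<bar> < d" using x2 sd by (simp add: s_def)
      note r = r1_bound[OF this] r2_bound[OF this]
      have "(x\<^sup>2)\<^sup>2 \<le> (s\<^sup>2)\<^sup>2" using x2 by (rule power_mono) simp
      then have r': "\<bar>r1 (x\<^sup>2)\<bar> \<le> K * s^4" "\<bar>r2 (x\<^sup>2)\<bar> \<le> K * s^4"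
        using r K_nonneg by (auto intro: order_trans[OF _ mult_left_mono] simp: power_mult[symmetric])
      have "\<bar>n5 x y\<bar> \<le> 1 / \<omega> * (\<bar>r1 (x\<^sup>2)\<bar> * \<bar>x\<bar>) + \<bar>r2 (x\<^sup>2)\<bar> * \<bar>y\<bar>"
        unfolding n5_def using \<omega>_pos by (intro order_trans[OF abs_triangle_ineq]) (simp add: abs_mult mult_ac)
      also have "\<dots> \<le> 1 / \<omega> * (K * s^4 * s) + K * s^4 * s"
        using r' xy s \<omega>_pos K_nonneg by (intro add_mono mult_left_mono mult_mono) auto
      finally show ?thesis by (simp add: M5_def algebra_simps eval_nat_numeral)
    qed
    define L where "L = lam m / complex_of_real \<omega>"
    have L1: "cmod L = 1" using cmod_lam[OF m2] \<omega>_pos by (simp add: L_def norm_divide)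
    define q where "q = L * of_real (n3 x y + n5 x y)"
    have q: "cmod q \<le> (M3 + M5) * s^3"
    proof -
      have "s^5 \<le> s^3" using s by (intro power_decreasing) auto
      then have "M5 * s^5 \<le> M5 * s^3" using nn by (intro mult_left_mono) auto
      then show ?thesis using n3 n5 abs_triangle_ineq[of "n3 x y" "n5 x y"]
        unfolding q_def norm_mult L1 norm_of_real by (simp add: algebra_simps)
    qed
    have zd: "zd m \<zeta> = lam m * z + q" by (simp add: zd_def z_def q_def L_def x_def y_def)
    have q': "q = N30 m * z^3 + N21 m * (z\<^sup>2 * cnj z) + N12 m * (z * (cnj z)\<^sup>2) + N03 m * (cnj z)^3 + L * of_real (n5 x y)"
      using n3_expand[OF m2, of \<zeta>] by (simp add: q_def L_def x_def y_def z_def distrib_left)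
    define J where "J = (3 * h30 m * z\<^sup>2 + h12 m * (cnj z)\<^sup>2) * q + (2 * h12 m * (z * cnj z) + 3 * h03 m * (cnj z)\<^sup>2) * cnj q"
    have nz: "lam m \<noteq> 0" "3 * cnj (lam m) - lam m \<noteq> 0" using lam_nz[OF m2] by auto
    \<comment> \<open>The homological equations, solved for the \<open>N\<close> coefficients;
      inserting them makes the cancellation a polynomial identity.\<close>
    have N: "N30 m = - (2 * lam m * h30 m)" "N12 m = - (2 * cnj (lam m) * h12 m)"
      "N03 m = - ((3 * cnj (lam m) - lam m) * h03 m)"
      using nz by (simp_all add: h30_def h12_def h03_def)
    have w: "w = z + (h30 m * z^3 + h12 m * (z * (cnj z)\<^sup>2) + h03 m * (cnj z)^3)"
      by (simp add: w_def nf_def cub_def z_def)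
    have "wd m \<zeta> = lam m * z + q + 3 * h30 m * z\<^sup>2 * (lam m * z) + h12 m * (cnj z)\<^sup>2 * (lam m * z)
      + 2 * h12 m * (z * cnj z) * (cnj (lam m) * cnj z) + 3 * h03 m * (cnj z)\<^sup>2 * (cnj (lam m) * cnj z) + J"
      unfolding wd_def zd J_def z_def[symmetric] by (simp add: algebra_simps)
    then have rem: "rem m \<zeta> = N21 m * (z\<^sup>2 * cnj z - w\<^sup>2 * cnj w) + L * of_real (n5 x y) + J"
      unfolding rem_def w_def[symmetric] q' w N by (simp add: algebra_simps power2_eq_square power3_eq_cube)
    \<comment> \<open>\<open>w - z\<close> is the cubic part of \<open>nf\<close>: three terms, each
      at most \<open>B (2 s)^3\<close>.\<close>
    have kb: "cmod (z - w) \<le> 24 * B * s^3"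
    proof -
      have z3: "cmod z ^ 3 \<le> 8 * s^3" using power_mono[OF z, of 3] by (simp add: power_mult_distrib)
      have t: "cmod (h * v) \<le> B * (8 * s^3)" if "cmod h \<le> B" "cmod v = cmod z ^ 3" for h v
        using that z3 B(1) by (simp add: norm_mult mult_mono)
      have "cmod (w - z) \<le> B * (8 * s^3) + B * (8 * s^3) + B * (8 * s^3)"
        unfolding w using B(2-4)[OF m]
        by (simp only: add_diff_cancel_left') (intro order_trans[OF norm_triangle_ineq] add_mono t;
            simp add: norm_mult norm_power power3_eq_cube power2_eq_square)
      then show ?thesis by (simp add: norm_minus_commute)
    qed
    have s31: "s^3 \<le> s" using s power_decreasing[of 1 3 s] by simp
    have wA: "cmod w \<le> A * s"
    proof -
      have "cmod w \<le> cmod z + cmod (z - w)" using norm_triangle_ineq4[of z "z - w"] by simp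
      also have "\<dots> \<le> 2 * s + 24 * B * s" using z kb s31 B(1) mult_left_mono[OF s31, of "24 * B"] by linarith
      finally show ?thesis by (simp add: A_def algebra_simps)
    qed
    have zA: "cmod z \<le> A * s" using z nn(4) s(1) mult_right_mono[of 2 A s] by linarith
    have b1: "cmod (N21 m * (z\<^sup>2 * cnj z - w\<^sup>2 * cnj w)) \<le> B * (3 * A\<^sup>2 * (24 * B)) * s^5"
    proof -
      have "cmod (z\<^sup>2 * cnj z - w\<^sup>2 * cnj w) \<le> 3 * (A * s)\<^sup>2 * (24 * B * s^3)"
        using norm_cube_diff_le(3)[OF zA wA] kb by (smt (verit) mult_left_mono zero_le_power2)
      then have "cmod (N21 m * (z\<^sup>2 * cnj z - w\<^sup>2 * cnj w)) \<le> B * (3 * (A * s)\<^sup>2 * (24 * B * s^3))"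
        unfolding norm_mult using B(5)[OF m] B(1) by (intro mult_mono) auto
      then show ?thesis by (simp add: power_mult_distrib algebra_simps eval_nat_numeral)
    qed
    have b2: "cmod (L * of_real (n5 x y)) \<le> M5 * s^5" using n5 by (simp add: norm_mult L1)
    have b3: "cmod J \<le> 36 * B * (M3 + M5) * s^5"
    proof -
      have z2: "cmod z ^ 2 \<le> 4 * s\<^sup>2" using power_mono[OF z, of 2] by (simp add: power_mult_distrib)
      have t: "cmod (h * v) \<le> B * (4 * s\<^sup>2)" if "cmod h \<le> B" "cmod v = cmod z ^ 2" for h v
        using that z2 B(1) by (simp add: norm_mult mult_mono)
      have 1: "cmod (3 * h30 m * z\<^sup>2 + h12 m * (cnj z)\<^sup>2) \<le> 3 * (B * (4 * s\<^sup>2)) + B * (4 * s\<^sup>2)"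
        using t[of "h30 m" "z\<^sup>2"] t[of "h12 m" "(cnj z)\<^sup>2"] B(2-4)[OF m]
        by (intro order_trans[OF norm_triangle_ineq] add_mono) (simp_all add: norm_mult norm_power mult_ac)
      have 2: "cmod (2 * h12 m * (z * cnj z) + 3 * h03 m * (cnj z)\<^sup>2) \<le> 2 * (B * (4 * s\<^sup>2)) + 3 * (B * (4 * s\<^sup>2))"
        using t[of "h12 m" "z * cnj z"] t[of "h03 m" "(cnj z)\<^sup>2"] B(2-4)[OF m]
        by (intro order_trans[OF norm_triangle_ineq] add_mono) (simp_all add: norm_mult norm_power mult_ac power2_eq_square)
      have "cmod J \<le> (3 * (B * (4 * s\<^sup>2)) + B * (4 * s\<^sup>2)) * ((M3 + M5) * s^3)
         + (2 * (B * (4 * s\<^sup>2)) + 3 * (B * (4 * s\<^sup>2))) * ((M3 + M5) * s^3)"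
        unfolding J_def using 1 2 q B(1) s
        by (intro order_trans[OF norm_triangle_ineq] add_mono) (simp_all only: norm_mult complex_mod_cnj, auto intro!: mult_mono)
      then show ?thesis by (simp add: algebra_simps eval_nat_numeral)
    qed
    have "cmod (rem m \<zeta>) \<le> B * (3 * A\<^sup>2 * (24 * B)) * s^5 + M5 * s^5 + 36 * B * (M3 + M5) * s^5"
      unfolding rem using b1 b2 b3 by (intro order_trans[OF norm_triangle_ineq] add_mono)
    then show ?thesis unfolding C_def s_def by (simp only: distrib_right)
  qed
  moreover have "0 \<le> C" using B(1) nn by (auto simp: C_def)
  ultimately show thesis by (intro that)
qed

end

section \<open>Polar coordinates and localization of closed orbits\<close>

text \<open>Near \<open>t\<close> the principal logarithm of \<open>w s / w t\<close> has real part
  \<open>ln (\<rho> s / \<rho> t)\<close> and imaginary part \<open>\<theta> s - \<theta> t\<close>,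
  since continuity of \<theta> keeps the latter inside the principal branch. Its derivative at
  \<open>t\<close> is \<open>w' / w t\<close>.\<close>

lemma polar_derivative:
  fixes w :: "real \<Rightarrow> complex"
  assumes w': "(w has_vector_derivative w') (at t within I)" and t: "t \<in> I"
    and polar: "\<And>s. s \<in> I \<Longrightarrow> 0 < \<rho> s \<and> w s = of_real (\<rho> s) * cis (\<theta> s)"
    and cont: "continuous_on I \<theta>"
  shows "(\<rho> has_real_derivative \<rho> t * Re (w' / w t)) (at t within I)"
    "(\<theta> has_real_derivative Im (w' / w t)) (at t within I)"
proof -
  have wt: "w t \<noteq> 0" using polar[OF t] by auto
  define L where "L s = complex_of_real (ln (\<rho> s / \<rho> t)) + \<i> * of_real (\<theta> s - \<theta> t)" for s
  obtain e where e: "e > 0" "\<And>s. s \<in> I \<Longrightarrow> dist s t < e \<Longrightarrow> dist (\<theta> s) (\<theta> t) < pi"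
    using cont t pi_gt_zero unfolding continuous_on_iff by meson
  have eq: "Ln (w s / w t) = L s" if s: "s \<in> I" "dist s t < e" for s
  proof -
    have r: "0 < \<rho> s" "0 < \<rho> t" using polar[OF s(1)] polar[OF t] by auto
    have "exp (L s) = of_real (\<rho> s / \<rho> t) * cis (\<theta> s - \<theta> t)"
      using r by (simp add: L_def exp_add cis_conv_exp[symmetric] exp_of_real flip: of_real_diff)
    also have "\<dots> = w s / w t"
      using polar[OF s(1)] polar[OF t] by (simp add: cis_divide[symmetric])
    finally have *: "w s / w t = exp (L s)" ..
    have "\<bar>\<theta> s - \<theta> t\<bar> < pi" using e(2)[OF s] by (simp add: dist_real_def)
    then have "Ln (exp (L s)) = L s" by (intro Ln_exp) (auto simp: L_def)
    then show ?thesis by (simp add: *)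
  qed
  have "(Ln has_field_derivative inverse (w t / w t)) (at (w t / w t) within (\<lambda>s. w s / w t) ` I)"
    using wt by (intro has_field_derivative_at_within[OF has_field_derivative_Ln]) auto
  from field_vector_diff_chain_within[OF has_vector_derivative_divide[OF w'] this]
  have "((\<lambda>s. Ln (w s / w t)) has_vector_derivative w' / w t) (at t within I)"
    using wt by (simp add: o_def)
  then have L': "(L has_vector_derivative w' / w t) (at t within I)"
    by (rule has_vector_derivative_transform_within[OF _ e(1) t eq])
  have "((\<lambda>s. Im (L s)) has_real_derivative Im (w' / w t)) (at t within I)"
    "((\<lambda>s. Re (L s)) has_real_derivative Re (w' / w t)) (at t within I)"
    using bounded_linear.has_vector_derivative[OF bounded_linear_Im L']
      bounded_linear.has_vector_derivative[OF bounded_linear_Re L']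
    by (simp_all add: has_real_derivative_iff_has_vector_derivative)
  note i = this
  have "((\<lambda>s. \<theta> t + Im (L s)) has_real_derivative Im (w' / w t)) (at t within I)"
    by (rule derivative_eq_intros i refl)+ simp
  then show "(\<theta> has_real_derivative Im (w' / w t)) (at t within I)" by (simp add: L_def)
  have "((\<lambda>s. \<rho> t * exp (Re (L s))) has_real_derivative \<rho> t * Re (w' / w t)) (at t within I)"
    by (rule derivative_eq_intros i refl)+ (use polar[OF t] in \<open>simp add: L_def\<close>)
  then show "(\<rho> has_real_derivative \<rho> t * Re (w' / w t)) (at t within I)"
  proof (rule has_field_derivative_transform_within[OF _ zero_less_one t])
    fix s assume "s \<in> I"
    then show "\<rho> t * exp (Re (L s)) = \<rho> s" using polar[OF t] polar[of s] by (simp add: L_def)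
  qed
qed

text \<open>Gronwall in both directions: \<open>u exp (- L t)\<close> does not increase and
  \<open>u exp (L t)\<close> does not decrease, so a zero at either end forces one at the
  other.\<close>

lemma zero_propagates:
  fixes u :: "real \<Rightarrow> real"
  assumes "a \<le> b" and nonneg: "\<And>t. t \<in> {a..b} \<Longrightarrow> 0 \<le> u t"
    and u': "\<And>t. t \<in> {a..b} \<Longrightarrow> (u has_real_derivative u' t) (at t within {a..b})"
    and L: "\<And>t. t \<in> {a..b} \<Longrightarrow> \<bar>u' t\<bar> \<le> L * u t"
  shows "u a = 0 \<longleftrightarrow> u b = 0"
proof -
  have d: "((\<lambda>t. u t * exp (k * t)) has_derivative (\<lambda>h. (u' t + k * u t) * exp (k * t) * h)) (at t within {a..b})"
    if "a \<le> t" "t \<le> b" for t k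
  proof -
    have t: "t \<in> {a..b}" using that by simp
    have "((\<lambda>t. u t * exp (k * t)) has_real_derivative (u' t + k * u t) * exp (k * t)) (at t within {a..b})"
      by (rule derivative_eq_intros u'[OF t] refl)+ (simp add: algebra_simps)
    then show ?thesis unfolding has_field_derivative_def by (rule has_derivative_eq_rhs) (simp add: fun_eq_iff)
  qed
  have "u b = 0" if "u a = 0"
  proof -
    obtain s where s: "s \<in> {a..b}" "u b * exp (- L * b) - u a * exp (- L * a) = (u' s + - L * u s) * exp (- L * s) * (b - a)"
      using mvt_very_simple[OF assms(1) d[of _ "- L"]] by blast
    have "u' s + - L * u s \<le> 0" using L[OF s(1)] by linarith
    then have "(u' s + - L * u s) * (exp (- L * s) * (b - a)) \<le> 0"
      using assms(1) by (intro mult_nonpos_nonneg) auto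
    then have "u b * exp (- L * b) \<le> 0" using s(2) that by (simp add: mult.assoc)
    then have "u b \<le> 0" by (simp add: mult_le_0_iff not_le[symmetric])
    then show ?thesis using nonneg[of b] assms(1) by simp
  qed
  moreover have "u a = 0" if "u b = 0"
  proof -
    obtain s where s: "s \<in> {a..b}" "u b * exp (L * b) - u a * exp (L * a) = (u' s + L * u s) * exp (L * s) * (b - a)"
      using mvt_very_simple[OF assms(1) d[of _ L]] by blast
    have "0 \<le> u' s + L * u s" using L[OF s(1)] by linarith
    then have "0 \<le> (u' s + L * u s) * (exp (L * s) * (b - a))"
      using assms(1) by (intro mult_nonneg_nonneg) auto
    then have "u a * exp (L * a) \<le> 0" using s(2) that by (simp add: mult.assoc)
    then have "u a \<le> 0" by (simp add: mult_le_0_iff not_le[symmetric])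
    then show ?thesis using nonneg[of a] assms(1) by simp
  qed
  ultimately show ?thesis by blast
qed

section \<open>Periodic functions and their extrema\<close>

lemma periodic_shift_int:
  fixes f :: "real \<Rightarrow> 'a"
  assumes "\<And>t. f (t + T) = f t"
  shows "f (t + of_int n * T) = f t"
proof (induction n rule: int_induct[where k = 0])
  case (step1 i)
  then show ?case using assms[of "t + of_int i * T"] by (simp add: algebra_simps)
next
  case (step2 i)
  then show ?case using assms[of "t + of_int (i - 1) * T"] by (simp add: algebra_simps)
qed simp

lemma periodic_reduce:
  fixes f :: "real \<Rightarrow> 'a"
  assumes "\<And>t. f (t + T) = f t" "0 < T"
  obtains s where "0 \<le> s" "s < T" "f s = f t"
proof -
  let ?n = "\<lfloor>t / T\<rfloor>"
  have "of_int ?n * T \<le> t" "t < (of_int ?n + 1) * T"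
    using assms(2) by (simp_all add: pos_le_divide_eq[symmetric] pos_divide_less_eq[symmetric])
  then show thesis
    using periodic_shift_int[of f T "t - of_int ?n * T" ?n, OF assms(1)]
    by (intro that[of "t - of_int ?n * T"]) (auto simp: algebra_simps)
qed

text \<open>The extrema over one period are global, hence critical. The exclusion and uniqueness
  arguments for closed orbits all evaluate an inequality at such a point.\<close>

lemma periodic_extrema:
  fixes f :: "real \<Rightarrow> real"
  assumes per: "\<And>t. f (t + T) = f t" and T: "0 < T" and f': "\<And>t. (f has_real_derivative f' t) (at t)"
  obtains a b where "f' a = 0" "f' b = 0" "\<And>t. f a \<le> f t" "\<And>t. f t \<le> f b"
proof -
  have c: "continuous_on {0..T} f" using f' DERIV_isCont by (blast intro: continuous_at_imp_continuous_on)
  obtain a where a: "\<And>t. t \<in> {0..T} \<Longrightarrow> f a \<le> f t"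
    using continuous_attains_inf[OF compact_Icc _ c] T by force
  obtain b where b: "\<And>t. t \<in> {0..T} \<Longrightarrow> f t \<le> f b"
    using continuous_attains_sup[OF compact_Icc _ c] T by force
  have a': "f a \<le> f t" and b': "f t \<le> f b" for t
    by (rule periodic_reduce[of f T t, OF per T]; metis a b atLeastAtMost_iff less_imp_le)+
  show thesis
    using DERIV_local_min[OF f' zero_less_one] DERIV_local_max[OF f' zero_less_one] a' b'
    by (intro that[of a b]) blast+
qed

lemma cmod_power2_deriv:
  assumes "(w has_vector_derivative w') (at t within I)"
  shows "((\<lambda>t. (cmod (w t))\<^sup>2) has_real_derivative 2 * Re (cnj (w t) * w')) (at t within I)"
proof -
  have "((\<lambda>t. cnj (w t) * w t) has_vector_derivative cnj (w t) * w' + cnj w' * w t) (at t within I)"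
    by (intro has_vector_derivative_mult has_vector_derivative_cnj assms)
  from bounded_linear.has_vector_derivative[OF bounded_linear_Re this]
  show ?thesis
    by (simp add: has_real_derivative_iff_has_vector_derivative cmod_power2) (simp add: power2_eq_square algebra_simps)
qed

section \<open>Common smallness conditions, polar normal form, amplitude of closed orbits\<close>

context planar_hopf
begin

text \<open>Collects the smallness conditions of the transformation once, and measures the remainder
  by the normal form radius \<open>|nf m \<zeta>|\<close> instead of
  \<open>|\<zeta>|\<close>.\<close>

lemma rem_bound_nf:
  obtains C \<epsilon> r where "0 \<le> C" "0 < \<epsilon>" "\<epsilon> \<le> \<omega> / 4" "0 < r" "r \<le> 1" "r\<^sup>2 \<le> d"
    "\<And>m \<zeta>. \<bar>m\<bar> < \<epsilon> \<Longrightarrow> cmod \<zeta> < r \<Longrightarrow> cmod (rem m \<zeta>) \<le> C * cmod (nf m \<zeta>) ^ 5"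
    "\<And>m \<zeta> \<zeta>'. \<bar>m\<bar> < \<epsilon> \<Longrightarrow> cmod \<zeta> < r \<Longrightarrow> cmod \<zeta>' < r \<Longrightarrow>
       cmod (nf m \<zeta> - nf m \<zeta>' - (\<zeta> - \<zeta>')) \<le> 1 / 2 * cmod (\<zeta> - \<zeta>')"
    "\<And>m \<zeta>. \<bar>m\<bar> < \<epsilon> \<Longrightarrow> cmod \<zeta> < r \<Longrightarrow> cmod (nf m \<zeta> - \<zeta>) \<le> C * (\<bar>m\<bar> + (cmod \<zeta>)\<^sup>2) * cmod \<zeta>"
    "\<And>m. \<bar>m\<bar> < \<epsilon> \<Longrightarrow> cmod (N21 m - N21 0) \<le> C * \<bar>m\<bar>"
proof -
  obtain C where C: "0 \<le> C" "\<And>m \<zeta>. \<bar>m\<bar> \<le> \<omega> \<Longrightarrow> cmod \<zeta> \<le> 1 \<Longrightarrow> (cmod \<zeta>)\<^sup>2 < d \<Longrightarrow> cmod (rem m \<zeta>) \<le> C * cmod \<zeta> ^ 5"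
    by (rule rem_bound) blast
  obtain B where B: "0 \<le> B" "\<And>m \<zeta> \<zeta>' R. \<bar>m\<bar> \<le> \<omega> \<Longrightarrow> cmod \<zeta> \<le> R \<Longrightarrow> cmod \<zeta>' \<le> R \<Longrightarrow>
    cmod (nf m \<zeta> - nf m \<zeta>' - (\<zeta> - \<zeta>')) \<le> (\<bar>m\<bar> / \<omega> + B * R\<^sup>2) * cmod (\<zeta> - \<zeta>')"
    by (rule nf_near_identity) blast
  obtain D e where D: "0 \<le> D" "0 < e" "\<And>m. \<bar>m\<bar> < e \<Longrightarrow> cmod (N21 m - N21 0) \<le> D * \<bar>m\<bar>"
    by (rule N21_near) blast
  \<comment> \<open>This gives \<open>B r^2 <= 1/4\<close>; together with
    \<open>|m| / \<omega> <= 1/4\<close> the deviation from the identity has Lipschitz constant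
    1/2.\<close>
  define r where "r = min 1 (min d (1 / (4 * (B + 1))))"
  have r: "0 < r" "r \<le> 1" "r \<le> d" "r \<le> 1 / (4 * (B + 1))" using d_pos B(1) by (auto simp: r_def)
  have rr: "r\<^sup>2 \<le> r" using r by (simp add: power2_eq_square mult_left_le)
  have Br: "B * r\<^sup>2 \<le> 1 / 4"
  proof -
    have "B * r\<^sup>2 \<le> (B + 1) * (1 / (4 * (B + 1)))" using rr r B(1) by (intro mult_mono) auto
    also have "\<dots> = 1 / 4" using B(1) by (simp add: field_simps)
    finally show ?thesis .
  qed
  define \<epsilon> where "\<epsilon> = min (\<omega> / 4) e"
  \<comment> \<open>The 32 is \<open>2^5\<close>, from \<open>|\<zeta>| <= 2 |nf m \<zeta>|\<close>
    in the fifth-order bound.\<close>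
  define C' where "C' = 32 * C + 1 / \<omega> + B + D"
  have nn: "0 \<le> 32 * C" "0 \<le> 1 / \<omega>" "0 \<le> B" "0 \<le> D" using C B D \<omega>_pos by auto
  have half: "cmod (nf m \<zeta> - nf m \<zeta>' - (\<zeta> - \<zeta>')) \<le> 1 / 2 * cmod (\<zeta> - \<zeta>')"
    if "\<bar>m\<bar> < \<epsilon>" "cmod \<zeta> < r" "cmod \<zeta>' < r" for m \<zeta> \<zeta>'
  proof -
    have m: "\<bar>m\<bar> \<le> \<omega> / 4" using that(1) by (simp add: \<epsilon>_def)
    then have "\<bar>m\<bar> / \<omega> \<le> 1 / 4" using \<omega>_pos by (simp add: field_simps)
    then have "\<bar>m\<bar> / \<omega> + B * r\<^sup>2 \<le> 1 / 2" using Br by linarith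
    moreover have "cmod (nf m \<zeta> - nf m \<zeta>' - (\<zeta> - \<zeta>')) \<le> (\<bar>m\<bar> / \<omega> + B * r\<^sup>2) * cmod (\<zeta> - \<zeta>')"
      using m that \<omega>_pos by (intro B(2)) auto
    ultimately show ?thesis by (meson mult_right_mono norm_ge_zero order_trans)
  qed
  have low: "cmod \<zeta> \<le> 2 * cmod (nf m \<zeta>)" if "\<bar>m\<bar> < \<epsilon>" "cmod \<zeta> < r" for m \<zeta>
    using half[OF that, of 0] r norm_triangle_ineq2[of \<zeta> "nf m \<zeta>"] by (simp add: nf_0 norm_minus_commute)
  show thesis
  proof (rule that[of C' \<epsilon> r])
    show "0 \<le> C'" "0 < \<epsilon>" "\<epsilon> \<le> \<omega> / 4" "0 < r" "r \<le> 1" "r\<^sup>2 \<le> d"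
      using nn \<omega>_pos D r rr by (auto simp: C'_def \<epsilon>_def)
    fix m \<zeta>
    assume m: "\<bar>m\<bar> < \<epsilon>"
    show "cmod (N21 m - N21 0) \<le> C' * \<bar>m\<bar>"
      using D(3)[of m] m nn by (auto simp: \<epsilon>_def C'_def intro: order_trans[OF _ mult_right_mono])
    assume \<zeta>: "cmod \<zeta> < r"
    have "(cmod \<zeta>)\<^sup>2 < r\<^sup>2" using \<zeta> by (intro power_strict_mono) auto
    then have "cmod (rem m \<zeta>) \<le> C * cmod \<zeta> ^ 5"
      using m \<zeta> r rr by (intro C(2)) (auto simp: \<epsilon>_def)
    also have "\<dots> \<le> C * (2 * cmod (nf m \<zeta>)) ^ 5"
      using low[OF m \<zeta>] C(1) by (intro mult_left_mono power_mono) auto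
    also have "\<dots> = 32 * C * cmod (nf m \<zeta>) ^ 5" by (simp add: power_mult_distrib)
    also have "\<dots> \<le> C' * cmod (nf m \<zeta>) ^ 5" using nn by (intro mult_right_mono) (auto simp: C'_def)
    finally show "cmod (rem m \<zeta>) \<le> C' * cmod (nf m \<zeta>) ^ 5" .
    have "cmod (nf m \<zeta> - \<zeta>) \<le> (\<bar>m\<bar> / \<omega> + B * (cmod \<zeta>)\<^sup>2) * cmod \<zeta>"
      using B(2)[of m \<zeta> "cmod \<zeta>" 0] m \<omega>_pos by (simp add: nf_0 \<epsilon>_def)
    also have "\<dots> \<le> (C' * \<bar>m\<bar> + C' * (cmod \<zeta>)\<^sup>2) * cmod \<zeta>"
    proof -
      have "1 / \<omega> \<le> C'" "B \<le> C'" using nn by (auto simp: C'_def)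
      from mult_right_mono[OF this(1), of "\<bar>m\<bar>"] mult_right_mono[OF this(2), of "(cmod \<zeta>)\<^sup>2"]
      have "\<bar>m\<bar> / \<omega> + B * (cmod \<zeta>)\<^sup>2 \<le> C' * \<bar>m\<bar> + C' * (cmod \<zeta>)\<^sup>2" by simp
      then show ?thesis by (rule mult_right_mono) simp
    qed
    finally show "cmod (nf m \<zeta> - \<zeta>) \<le> C' * (\<bar>m\<bar> + (cmod \<zeta>)\<^sup>2) * cmod \<zeta>" by (simp add: distrib_left)
    fix \<zeta>' assume "cmod \<zeta>' < r"
    then show "cmod (nf m \<zeta> - nf m \<zeta>' - (\<zeta> - \<zeta>')) \<le> 1 / 2 * cmod (\<zeta> - \<zeta>')"
      by (rule half[OF m \<zeta>])
  qed
qed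

lemma nf_lower:
  assumes "cmod (nf m \<zeta> - nf m 0 - (\<zeta> - 0)) \<le> 1 / 2 * cmod (\<zeta> - 0)"
  shows "cmod \<zeta> \<le> 2 * cmod (nf m \<zeta>)" "cmod (nf m \<zeta>) \<le> 2 * cmod \<zeta>"
  using assms norm_triangle_ineq2[of \<zeta> "nf m \<zeta>"] norm_triangle_ineq2[of "nf m \<zeta>" \<zeta>]
  by (auto simp: nf_0 norm_minus_commute)

lemma nf_has_derivative: "\<exists>D. (nf m has_derivative D) (at \<zeta>)"
proof -
  have c: "(cnj has_derivative cnj) (at z)" for z :: complex
    by (rule bounded_linear_imp_has_derivative[OF bounded_linear_cnj])
  have cz: "(zc m has_derivative zc m) (at z)" for z
  proof (rule bounded_linear_imp_has_derivative)
    show "bounded_linear (zc m)"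
      unfolding zc_def
      by (intro bounded_linear_add bounded_linear_compose[OF bounded_linear_of_real bounded_linear_Re]
          bounded_linear_const_mult bounded_linear_compose[OF bounded_linear_of_real bounded_linear_Im])
  qed
  have ccz: "((\<lambda>\<zeta>. cnj (zc m \<zeta>)) has_derivative (\<lambda>h. cnj (zc m h))) (at z)" for z
    by (rule has_derivative_compose[OF cz c])
  show ?thesis unfolding nf_def cub_def
    by (rule exI, (rule derivative_intros cz ccz)+)
qed

lemma nf_0_has_derivative: "(nf 0 has_derivative id) (at 0)"
proof -
  have z: "zc 0 = (\<lambda>\<zeta>. \<zeta>)"
    using \<omega>_pos by (intro ext) (simp add: zc_def lam_def om_def complex_eq_iff)
  have c: "(cnj has_derivative cnj) (at 0)"
    by (rule bounded_linear_imp_has_derivative[OF bounded_linear_cnj])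
  show ?thesis unfolding nf_def cub_def z
    by (rule derivative_eq_intros c refl)+ (auto simp: id_def)
qed

text \<open>Dividing the normal form by \<open>w\<close> gives
  \<open>w' / w = lam + N21 \<rho>^2 + rem / w\<close>; its real and imaginary parts are the two
  polar equations.\<close>

lemma polar_normal_form_exists:
  obtains \<epsilon> r C A B R Q where "0 < \<epsilon>" "0 < r" "r\<^sup>2 \<le> d"
    "near_identity_change \<epsilon> r nf"
    "\<And>\<mu>. \<bar>\<mu>\<bar> < \<epsilon> \<Longrightarrow> \<bar>A \<mu> - c / 8\<bar> \<le> C * \<bar>\<mu>\<bar> \<and> \<bar>B \<mu> - Im (N21 0)\<bar> \<le> C * \<bar>\<mu>\<bar>"
    "\<And>\<mu> \<rho> \<theta>. \<bar>\<mu>\<bar> < \<epsilon> \<Longrightarrow> 0 < \<rho> \<Longrightarrow> \<bar>R \<mu> \<rho> \<theta>\<bar> \<le> C * \<rho> ^ 4 \<and> \<bar>Q \<mu> \<rho> \<theta>\<bar> \<le> C * \<rho> ^ 4"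
    "\<And>\<mu> I x y \<rho> \<theta> t. \<bar>\<mu>\<bar> < \<epsilon> \<Longrightarrow> sol \<mu> I x y \<Longrightarrow>
       (\<forall>t\<in>I. Complex (x t) (y t) \<in> ball 0 r \<and> 0 < \<rho> t \<and>
          nf \<mu> (Complex (x t) (y t)) = of_real (\<rho> t) * cis (\<theta> t)) \<Longrightarrow> continuous_on I \<theta> \<Longrightarrow> t \<in> I \<Longrightarrow>
       (\<rho> has_real_derivative \<rho> t * (\<mu> / 2 + A \<mu> * (\<rho> t)\<^sup>2 + R \<mu> (\<rho> t) (\<theta> t))) (at t within I) \<and>
       (\<theta> has_real_derivative om \<mu> + B \<mu> * (\<rho> t)\<^sup>2 + Q \<mu> (\<rho> t) (\<theta> t)) (at t within I)"
proof -
  obtain C \<epsilon> r where K: "0 \<le> C" "0 < \<epsilon>" "\<epsilon> \<le> \<omega> / 4" "0 < r" "r \<le> 1" "r\<^sup>2 \<le> d"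
    and rb: "\<And>m \<zeta>. \<bar>m\<bar> < \<epsilon> \<Longrightarrow> cmod \<zeta> < r \<Longrightarrow> cmod (rem m \<zeta>) \<le> C * cmod (nf m \<zeta>) ^ 5"
    and half: "\<And>m \<zeta> \<zeta>'. \<bar>m\<bar> < \<epsilon> \<Longrightarrow> cmod \<zeta> < r \<Longrightarrow> cmod \<zeta>' < r \<Longrightarrow>
       cmod (nf m \<zeta> - nf m \<zeta>' - (\<zeta> - \<zeta>')) \<le> 1 / 2 * cmod (\<zeta> - \<zeta>')"
    and N: "\<And>m. \<bar>m\<bar> < \<epsilon> \<Longrightarrow> cmod (N21 m - N21 0) \<le> C * \<bar>m\<bar>"
    by (rule rem_bound_nf) blast
  have inj: "inj_on (nf m) (ball 0 r)" if m: "\<bar>m\<bar> < \<epsilon>" for m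
  proof (rule inj_onI)
    fix a b assume "a \<in> ball 0 r" "b \<in> ball 0 r" "nf m a = nf m b"
    then have "cmod (a - b) \<le> 1 / 2 * cmod (a - b)" using half[OF m, of a b] by (simp add: norm_minus_commute)
    then show "a = b" by simp
  qed
  have near: "near_identity_change \<epsilon> r nf"
    unfolding near_identity_change_def
  proof (intro conjI allI impI ballI nf_0 nf_0_has_derivative inj)
    show "smooth_on ({- \<epsilon> <..< \<epsilon>} \<times> ball 0 r) (\<lambda>(\<mu>, \<zeta>). nf \<mu> \<zeta>)"
      unfolding smooth_on_def
    proof
      fix n
      have sub: "{- \<epsilon> <..< \<epsilon>} \<times> ball (0 :: complex) r \<subseteq> {- \<omega> <..< \<omega>} \<times> ball 0 r"
        using K(3) \<omega>_pos by (intro Sigma_mono) auto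
      have "Ck_on n ({- \<omega> <..< \<omega>} \<times> ball 0 r) (\<lambda>(m, \<zeta>). nf m \<zeta>)"
        using smooth_on_nf unfolding smooth_on_def by (rule spec)
      then show "Ck_on n ({- \<epsilon> <..< \<epsilon>} \<times> ball 0 r) (\<lambda>(m, \<zeta>). nf m \<zeta>)"
        using sub by (rule Ck_on_subset)
    qed
    fix m :: real and \<zeta> :: complex
    assume m: "\<bar>m\<bar> < \<epsilon>" and z: "\<zeta> \<in> ball 0 r"
    obtain D where D: "(nf m has_derivative D) (at \<zeta>)" using nf_has_derivative by blast
    have "inj D"
      using half[OF m] z by (intro has_derivative_near_identity_inj[OF D open_ball z, of "1/2"]) auto
    then show "inj (frechet_derivative (nf m) (at \<zeta>))"
      using frechet_derivative_at[OF D] by simp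
  qed
  define w where "w \<rho> \<theta> = complex_of_real \<rho> * cis \<theta>" for \<rho> \<theta>
  \<comment> \<open>The remainder has to be a function of \<open>(\<rho>, \<theta>)\<close>, so it
    is pulled back through the inverse of \<open>nf m\<close>; the value 0 off the image keeps the
    bound for all \<rho>.\<close>
  define E where "E m \<rho> \<theta> = (if w \<rho> \<theta> \<in> nf m ` ball 0 r
     then rem m (inv_into (ball 0 r) (nf m) (w \<rho> \<theta>)) / w \<rho> \<theta> else 0)" for m \<rho> \<theta>
  have E: "cmod (E m \<rho> \<theta>) \<le> C * \<rho> ^ 4" if "\<bar>m\<bar> < \<epsilon>" "0 < \<rho>" for m \<rho> \<theta>
  proof (cases "w \<rho> \<theta> \<in> nf m ` ball 0 r")
    case True
    let ?\<zeta> = "inv_into (ball 0 r) (nf m) (w \<rho> \<theta>)"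
    have "?\<zeta> \<in> ball 0 r" "nf m ?\<zeta> = w \<rho> \<theta>" using inv_into_into[OF True] f_inv_into_f[OF True] by auto
    then have "cmod (rem m ?\<zeta>) \<le> C * cmod (w \<rho> \<theta>) ^ 5" using rb[OF that(1), of ?\<zeta>] by simp
    moreover have "cmod (w \<rho> \<theta>) = \<rho>" using that by (simp add: w_def norm_mult)
    ultimately show ?thesis using True that by (simp add: E_def norm_divide divide_simps eval_nat_numeral mult_ac)
  qed (use that K in \<open>simp add: E_def\<close>)
  show thesis
  proof (rule that[of \<epsilon> r "\<lambda>m. Re (N21 m)" C "\<lambda>m. Im (N21 m)" "\<lambda>m \<rho> \<theta>. Re (E m \<rho> \<theta>)" "\<lambda>m \<rho> \<theta>. Im (E m \<rho> \<theta>)"])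
    show "0 < \<epsilon>" "0 < r" "r\<^sup>2 \<le> d" "near_identity_change \<epsilon> r nf" by fact+
    fix m \<rho> \<theta> assume m: "\<bar>m\<bar> < \<epsilon>"
    show "\<bar>Re (N21 m) - c / 8\<bar> \<le> C * \<bar>m\<bar> \<and> \<bar>Im (N21 m) - Im (N21 0)\<bar> \<le> C * \<bar>m\<bar>"
      using N[OF m] abs_Re_le_cmod[of "N21 m - N21 0"] abs_Im_le_cmod[of "N21 m - N21 0"] by (simp add: Re_N21_0)
    show "\<bar>Re (E m \<rho> \<theta>)\<bar> \<le> C * \<rho> ^ 4 \<and> \<bar>Im (E m \<rho> \<theta>)\<bar> \<le> C * \<rho> ^ 4" if "0 < \<rho>"
      using E[OF m that, of \<theta>] abs_Re_le_cmod[of "E m \<rho> \<theta>"] abs_Im_le_cmod[of "E m \<rho> \<theta>"] by linarith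
  next
    fix m I x y \<rho> \<theta> t
    assume m: "\<bar>m\<bar> < \<epsilon>" and s: "sol m I x y" and t: "t \<in> I" and cont: "continuous_on I \<theta>"
      and polar: "\<forall>t\<in>I. Complex (x t) (y t) \<in> ball 0 r \<and> 0 < \<rho> t \<and>
          nf m (Complex (x t) (y t)) = of_real (\<rho> t) * cis (\<theta> t)"
    define \<zeta> where "\<zeta> = Complex (x t) (y t)"
    have \<zeta>: "\<zeta> \<in> ball 0 r" "0 < \<rho> t" "nf m \<zeta> = w (\<rho> t) (\<theta> t)" using polar t by (auto simp: \<zeta>_def w_def)
    have m2: "\<bar>m\<bar> < 2 * \<omega>" using m K(3) \<omega>_pos by linarith
    note pd = polar_derivative[OF sol_nf[OF m2 s t] t, of \<rho> \<theta>, folded \<zeta>_def]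
    have W: "w (\<rho> t) (\<theta> t) \<noteq> 0" using \<zeta>(2) by (simp add: w_def)
    have e: "E m (\<rho> t) (\<theta> t) = rem m \<zeta> / w (\<rho> t) (\<theta> t)"
      using \<zeta> by (auto simp: E_def \<zeta>(3)[symmetric] inv_into_f_f[OF inj[OF m]])
    have "w (\<rho> t) (\<theta> t) * cnj (w (\<rho> t) (\<theta> t)) = of_real ((\<rho> t)\<^sup>2)"
    proof -
      have "cmod (w (\<rho> t) (\<theta> t)) = \<rho> t" using \<zeta>(2) by (simp add: w_def norm_mult)
      then show ?thesis by (metis complex_norm_square)
    qed
    then have "wd m \<zeta> = (lam m + N21 m * of_real ((\<rho> t)\<^sup>2)) * w (\<rho> t) (\<theta> t) + rem m \<zeta>"
      unfolding rem_def \<zeta>(3) by (simp add: algebra_simps power2_eq_square)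
    then have q: "wd m \<zeta> / nf m \<zeta> = lam m + N21 m * of_real ((\<rho> t)\<^sup>2) + E m (\<rho> t) (\<theta> t)"
      using W unfolding e \<zeta>(3) by (simp add: field_simps)
    show "(\<rho> has_real_derivative \<rho> t * (m / 2 + Re (N21 m) * (\<rho> t)\<^sup>2 + Re (E m (\<rho> t) (\<theta> t)))) (at t within I) \<and>
       (\<theta> has_real_derivative om m + Im (N21 m) * (\<rho> t)\<^sup>2 + Im (E m (\<rho> t) (\<theta> t))) (at t within I)"
      using pd polar cont unfolding q by (simp add: lam_simps)
  qed
qed

text \<open>At a critical point of \<open>M = |w|^2\<close> one may divide by \<open>M\<close>. The
  resulting relation first yields \<open>M = O(|m|)\<close>, and then, with this inserted into the
  error, an \<open>M\<close> determined up to \<open>O(m^2)\<close>, that is an amplitude with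
  relative error \<open>O(|m|)\<close>.\<close>

lemma localization:
  obtains C \<epsilon> r where "0 \<le> C" "0 < \<epsilon>" "0 < r" "r\<^sup>2 \<le> d"
    "\<And>m x y T t. \<bar>m\<bar> < \<epsilon> \<Longrightarrow> sol m UNIV x y \<Longrightarrow> 0 < T \<Longrightarrow> (\<And>t. x (t + T) = x t \<and> y (t + T) = y t) \<Longrightarrow>
      (\<And>t. cmod (Complex (x t) (y t)) < r) \<Longrightarrow> (\<exists>t. Complex (x t) (y t) \<noteq> 0) \<Longrightarrow>
      m * c < 0 \<and> Complex (x t) (y t) \<noteq> 0 \<and>
      \<bar>cmod (nf m (Complex (x t) (y t))) - sqrt (- 4 * m / c)\<bar> \<le> C * \<bar>m\<bar> * sqrt (- 4 * m / c) \<and>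
      \<bar>cmod (Complex (x t) (y t)) - sqrt (- 4 * m / c)\<bar> \<le> C * \<bar>m\<bar> * sqrt (- 4 * m / c)"
proof -
  obtain C0 \<epsilon>0 r0 where K: "0 \<le> C0" "0 < \<epsilon>0" "\<epsilon>0 \<le> \<omega> / 4" "0 < r0" "r0 \<le> 1" "r0\<^sup>2 \<le> d"
    and rb: "\<And>m \<zeta>. \<bar>m\<bar> < \<epsilon>0 \<Longrightarrow> cmod \<zeta> < r0 \<Longrightarrow> cmod (rem m \<zeta>) \<le> C0 * cmod (nf m \<zeta>) ^ 5"
    and half: "\<And>m \<zeta> \<zeta>'. \<bar>m\<bar> < \<epsilon>0 \<Longrightarrow> cmod \<zeta> < r0 \<Longrightarrow> cmod \<zeta>' < r0 \<Longrightarrow>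
       cmod (nf m \<zeta> - nf m \<zeta>' - (\<zeta> - \<zeta>')) \<le> 1 / 2 * cmod (\<zeta> - \<zeta>')"
    and id: "\<And>m \<zeta>. \<bar>m\<bar> < \<epsilon>0 \<Longrightarrow> cmod \<zeta> < r0 \<Longrightarrow> cmod (nf m \<zeta> - \<zeta>) \<le> C0 * (\<bar>m\<bar> + (cmod \<zeta>)\<^sup>2) * cmod \<zeta>"
    and N: "\<And>m. \<bar>m\<bar> < \<epsilon>0 \<Longrightarrow> cmod (N21 m - N21 0) \<le> C0 * \<bar>m\<bar>"
    by (rule rem_bound_nf) blast
  have c: "0 < \<bar>c\<bar>" using c_nz by simp
  \<comment> \<open>With the bound on \<epsilon> below, the error \<open>C0 M + C0 |m|\<close> is at
    most \<open>|c| / 16\<close>, half of the coefficient \<open>|c| / 8\<close> of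
    \<open>M\<close>.\<close>
  define r where "r = min r0 (\<bar>c\<bar> / (128 * (C0 + 1)))"
  have r: "0 < r" "r \<le> r0" "r \<le> 1" "r \<le> \<bar>c\<bar> / (128 * (C0 + 1))" using K c by (auto simp: r_def)
  have rr: "r\<^sup>2 \<le> r" using r by (simp add: power2_eq_square mult_left_le)
  have Cr: "C0 * (4 * r\<^sup>2) \<le> \<bar>c\<bar> / 32"
  proof -
    have "C0 * (4 * r\<^sup>2) \<le> (C0 + 1) * (4 * (\<bar>c\<bar> / (128 * (C0 + 1))))" using rr r K(1) by (intro mult_mono) auto
    also have "\<dots> = \<bar>c\<bar> / 32" using K(1) by (simp add: field_simps)
    finally show ?thesis .
  qed
  \<comment> \<open>\<open>C1\<close> comes from \<open>M <= 8 |m| / |c|\<close> in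
    \<open>C0 M^2 + C0 |m| M\<close>; \<open>C3\<close> converts to the scale
    \<open>s0^2 = 4 |m| / |c|\<close>; \<open>C\<close> adds the distance between \<open>nf\<close>
    and the identity.\<close>
  define C1 where "C1 = C0 * (64 / c\<^sup>2 + 8 / \<bar>c\<bar>)"
  define C3 where "C3 = 2 * C1"
  define C where "C = C3 + 4 * C0 * (1 + 64 / \<bar>c\<bar>)"
  have nn: "0 \<le> C1" "0 \<le> C3" "0 \<le> 4 * C0 * (1 + 64 / \<bar>c\<bar>)" using K(1) by (auto simp: C1_def C3_def)
  define \<epsilon> where "\<epsilon> = min \<epsilon>0 (min (\<bar>c\<bar> / (32 * (C0 + 1))) (1 / (C3 + 1)))"
  have \<epsilon>: "0 < \<epsilon>" "\<epsilon> \<le> \<epsilon>0" "\<epsilon> \<le> \<bar>c\<bar> / (32 * (C0 + 1))" "\<epsilon> \<le> 1 / (C3 + 1)" using K c nn by (auto simp: \<epsilon>_def)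
  have main: "m * c < 0 \<and> Complex (x t) (y t) \<noteq> 0 \<and>
      \<bar>cmod (nf m (Complex (x t) (y t))) - sqrt (- 4 * m / c)\<bar> \<le> C * \<bar>m\<bar> * sqrt (- 4 * m / c) \<and>
      \<bar>cmod (Complex (x t) (y t)) - sqrt (- 4 * m / c)\<bar> \<le> C * \<bar>m\<bar> * sqrt (- 4 * m / c)"
    if m: "\<bar>m\<bar> < \<epsilon>" and s: "sol m UNIV x y" and T: "0 < T" and per: "\<And>t. x (t + T) = x t \<and> y (t + T) = y t"
      and small: "\<And>t. cmod (Complex (x t) (y t)) < r" and nz: "\<exists>t. Complex (x t) (y t) \<noteq> 0" for m x y T t
  proof -
    define \<zeta> where "\<zeta> t = Complex (x t) (y t)" for t
    define w where "w t = nf m (\<zeta> t)" for t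
    define M where "M t = (cmod (w t))\<^sup>2" for t
    have m0: "\<bar>m\<bar> < \<epsilon>0" using m \<epsilon> by linarith
    have m2: "\<bar>m\<bar> < 2 * \<omega>" using m0 K \<omega>_pos by linarith
    have \<zeta>r: "cmod (\<zeta> t) < r0" for t using small[of t] r(2) by (simp add: \<zeta>_def)
    have low: "cmod (\<zeta> t) \<le> 2 * cmod (w t)" "cmod (w t) \<le> 2 * cmod (\<zeta> t)" for t
      using nf_lower[OF half[OF m0 \<zeta>r, of 0 t]] K by (auto simp: w_def)
    have Mr: "M t \<le> 4 * r\<^sup>2" for t
    proof -
      have "cmod (w t) \<le> 2 * r" using low(2)[of t] small[of t] by (simp add: \<zeta>_def)
      from power_mono[OF this, of 2] show ?thesis by (simp add: M_def power_mult_distrib)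
    qed
    have M0: "0 \<le> M t" for t by (simp add: M_def)
    define M' where "M' t = 2 * Re (cnj (w t) * wd m (\<zeta> t))" for t
    have w': "(w has_vector_derivative wd m (\<zeta> t)) (at t)" for t
      using sol_nf[OF m2 s UNIV_I, of t] by (simp add: w_def[abs_def] \<zeta>_def)
    have M': "(M has_real_derivative M' t) (at t)" for t
      unfolding M_def M'_def by (rule cmod_power2_deriv[OF w'])
    have E: "\<bar>Re (cnj (w t) * rem m (\<zeta> t))\<bar> \<le> C0 * M t ^ 3" for t
    proof -
      have "\<bar>Re (cnj (w t) * rem m (\<zeta> t))\<bar> \<le> cmod (w t) * (C0 * cmod (w t) ^ 5)"
        using rb[OF m0 \<zeta>r, of t]
        by (intro order_trans[OF abs_Re_le_cmod]) (simp add: norm_mult w_def mult_left_mono)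
      then show ?thesis by (simp add: M_def eval_nat_numeral mult_ac)
    qed
    have M'_eq: "M' t = 2 * (m / 2 * M t + Re (N21 m) * (M t)\<^sup>2 + Re (cnj (w t) * rem m (\<zeta> t)))" for t
    proof -
      have "cnj (w t) * w t = of_real (M t)" unfolding M_def by (metis complex_norm_square mult.commute of_real_power)
      moreover have "cnj (w t) * wd m (\<zeta> t) = lam m * (cnj (w t) * w t) + N21 m * (cnj (w t) * w t)^2 + cnj (w t) * rem m (\<zeta> t)"
        unfolding rem_def w_def by (simp add: algebra_simps power2_eq_square)
      ultimately have "cnj (w t) * wd m (\<zeta> t) = lam m * of_real (M t) + N21 m * of_real ((M t)\<^sup>2) + cnj (w t) * rem m (\<zeta> t)"
        by simp
      then show ?thesis unfolding M'_def by (simp add: lam_simps)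
    qed
    \<comment> \<open>The origin is an equilibrium: from \<open>|M'| <= L M\<close>, a zero of
      \<open>M\<close> at one instant would spread to all times.\<close>
    have Mnz: "M t \<noteq> 0" for t
    proof
      assume t: "M t = 0"
      define L where "L = \<bar>m\<bar> + 2 * \<bar>Re (N21 m)\<bar> * (4 * r\<^sup>2) + 2 * C0 * (4 * r\<^sup>2)\<^sup>2"
      have L: "\<bar>M' s\<bar> \<le> L * M s" for s
      proof -
        have "\<bar>M' s\<bar> \<le> \<bar>m * M s\<bar> + \<bar>2 * Re (N21 m) * (M s)\<^sup>2\<bar> + \<bar>2 * Re (cnj (w s) * rem m (\<zeta> s))\<bar>"
          unfolding M'_eq by (simp only: distrib_left)
        also have "\<dots> \<le> \<bar>m\<bar> * M s + 2 * \<bar>Re (N21 m)\<bar> * (M s)\<^sup>2 + 2 * (C0 * M s ^ 3)"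
          using E[of s] M0[of s] by (simp add: abs_mult)
        also have "\<dots> = (\<bar>m\<bar> + 2 * \<bar>Re (N21 m)\<bar> * M s + 2 * C0 * (M s)\<^sup>2) * M s"
          by (simp add: algebra_simps eval_nat_numeral)
        also have "\<dots> \<le> L * M s"
          unfolding L_def using Mr[of s] M0[of s] K(1)
          by (intro mult_right_mono add_mono mult_left_mono power_mono) auto
        finally show ?thesis .
      qed
      have "M s = 0" for s
      proof (cases "s \<le> t")
        case True
        from zero_propagates[OF this, of M M' L] M0 L M' t show ?thesis
          by (auto intro: has_field_derivative_at_within)
      next
        case False
        from zero_propagates[of t s M M' L] False M0 L M' t show ?thesis
          by (auto intro: has_field_derivative_at_within)
      qed
      then have "\<zeta> s = 0" for s using low(1)[of s] by (simp add: M_def)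
      with nz show False by (auto simp: \<zeta>_def)
    qed
    have Mpos: "0 < M t" for t using Mnz M0 by (metis less_eq_real_def)
    have ex: "\<bar>m / 2 + c / 8 * M t\<bar> \<le> C0 * (M t)\<^sup>2 + C0 * \<bar>m\<bar> * M t" if "M' t = 0" for t
    proof -
      have "m / 2 * M t + Re (N21 m) * (M t)\<^sup>2 = - Re (cnj (w t) * rem m (\<zeta> t))"
        using that unfolding M'_eq by (simp only: mult_eq_0_iff eq_neg_iff_add_eq_0) simp
      then have "\<bar>(m / 2 + Re (N21 m) * M t) * M t\<bar> \<le> (C0 * (M t)\<^sup>2) * M t"
        using E[of t] by (simp add: algebra_simps eval_nat_numeral)
      then have 1: "\<bar>m / 2 + Re (N21 m) * M t\<bar> \<le> C0 * (M t)\<^sup>2"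
        using Mpos[of t] by (simp add: abs_mult)
      have "\<bar>Re (N21 m) - c / 8\<bar> \<le> C0 * \<bar>m\<bar>"
        using N[OF m0] abs_Re_le_cmod[of "N21 m - N21 0"] by (simp add: Re_N21_0)
      from mult_right_mono[OF this M0[of t]]
      have 2: "\<bar>Re (N21 m) * M t - c / 8 * M t\<bar> \<le> C0 * \<bar>m\<bar> * M t"
        unfolding left_diff_distrib[symmetric] abs_mult abs_of_nonneg[OF M0] .
      from 1 2 show ?thesis by linarith
    qed
    have Cm: "C0 * \<bar>m\<bar> \<le> \<bar>c\<bar> / 32"
    proof -
      have "C0 * \<bar>m\<bar> \<le> (C0 + 1) * (\<bar>c\<bar> / (32 * (C0 + 1)))" using m \<epsilon>(3) K(1) by (intro mult_mono) auto
      also have "\<dots> = \<bar>c\<bar> / 32" using K(1) by (simp add: field_simps)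
      finally show ?thesis .
    qed
    have ex2: "\<bar>m / 2 + c / 8 * M t\<bar> \<le> \<bar>c\<bar> / 16 * M t" if "M' t = 0" for t
    proof -
      have "C0 * M t \<le> \<bar>c\<bar> / 32" using mult_left_mono[OF Mr K(1), of t] Cr by linarith
      from mult_right_mono[OF this M0[of t]] mult_right_mono[OF Cm M0[of t]] ex[OF that]
      show ?thesis by (simp add: power2_eq_square algebra_simps)
    qed
    have perM: "M (t + T) = M t" for t using per by (simp add: M_def w_def \<zeta>_def)
    obtain a b where ab: "M' a = 0" "M' b = 0" "\<And>t. M a \<le> M t" "\<And>t. M t \<le> M b"
      by (rule periodic_extrema[of M T M', OF perM T M']) blast
    \<comment> \<open>Otherwise \<open>m / 2\<close> and \<open>c / 8 * M\<close> have the same sign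
      and cannot cancel to the accuracy of \<open>ex2\<close>.\<close>
    have mc: "m * c < 0"
    proof (rule ccontr)
      assume "\<not> m * c < 0"
      then have mc0: "0 \<le> m * c" by simp
      have "\<bar>c\<bar> / 8 * M a \<le> \<bar>m / 2 + c / 8 * M a\<bar>"
      proof (cases "0 < c")
        case True
        then have "0 \<le> m" using mc0 by (simp add: zero_le_mult_iff)
        with True show ?thesis using abs_ge_self[of "m / 2 + c / 8 * M a"] by simp
      next
        case False
        then have "m \<le> 0" "c < 0" using mc0 c_nz by (auto simp: zero_le_mult_iff)
        then show ?thesis using abs_ge_minus_self[of "m / 2 + c / 8 * M a"] by simp
      qed
      then have "\<bar>c\<bar> / 8 * M a \<le> \<bar>c\<bar> / 16 * M a" using ex2[OF ab(1)] by linarith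
      moreover have "0 < \<bar>c\<bar> * M a" using Mpos[of a] c by simp
      ultimately show False by simp
    qed
    define s0 where "s0 = sqrt (- 4 * m / c)"
    have s0sq: "s0\<^sup>2 = - 4 * m / c" and s0: "0 < s0"
      using mc c_nz by (auto simp: s0_def divide_simps zero_less_mult_iff mult_less_0_iff)
    have s0m: "s0\<^sup>2 = 4 * \<bar>m\<bar> / \<bar>c\<bar>" unfolding s0sq using mc by (auto simp: mult_less_0_iff abs_if)
    have ex3: "\<bar>m / 2 + c / 8 * M t\<bar> \<le> C1 * m\<^sup>2" if t: "M' t = 0" for t
    proof -
      have "\<bar>c\<bar> / 8 * M t = \<bar>c / 8 * M t\<bar>" using M0[of t] by (simp add: abs_mult)
      also have "\<dots> \<le> \<bar>m\<bar> / 2 + \<bar>c\<bar> / 16 * M t" using ex2[OF t] by linarith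
      finally have "\<bar>c\<bar> * M t \<le> 8 * \<bar>m\<bar>" by simp
      then have Mt: "M t \<le> 8 * \<bar>m\<bar> / \<bar>c\<bar>" using c by (simp add: field_simps)
      have "C0 * (M t)\<^sup>2 + C0 * \<bar>m\<bar> * M t \<le> C0 * (8 * \<bar>m\<bar> / \<bar>c\<bar>)\<^sup>2 + C0 * \<bar>m\<bar> * (8 * \<bar>m\<bar> / \<bar>c\<bar>)"
        using Mt M0[of t] K(1) by (intro add_mono mult_left_mono power_mono) auto
      also have "\<dots> = C1 * m\<^sup>2" unfolding C1_def
        by (simp add: power_divide power_mult_distrib algebra_simps) (simp add: power2_eq_square abs_mult[symmetric])
      finally show ?thesis using ex[OF t] by linarith
    qed
    \<comment> \<open>The expression is affine in \<open>M t\<close>, so it lies between its values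
      at the minimum and the maximum of \<open>M\<close>.\<close>
    have ex4: "\<bar>m / 2 + c / 8 * M t\<bar> \<le> C1 * m\<^sup>2" for t
    proof (cases "0 < c")
      case True
      then have "c / 8 * M a \<le> c / 8 * M t" "c / 8 * M t \<le> c / 8 * M b" using ab(3,4)[of t] by auto
      then show ?thesis using ex3[OF ab(1)] ex3[OF ab(2)] by linarith
    next
      case False
      then have "c / 8 * M t \<le> c / 8 * M a" "c / 8 * M b \<le> c / 8 * M t" using ab(3,4)[of t] by (auto intro: mult_left_mono_neg)
      then show ?thesis using ex3[OF ab(1)] ex3[OF ab(2)] by linarith
    qed
    have Ms0: "\<bar>M t - s0\<^sup>2\<bar> \<le> C3 * \<bar>m\<bar> * s0\<^sup>2" for t
    proof -
      have "M t - s0\<^sup>2 = 8 / c * (m / 2 + c / 8 * M t)" using c_nz by (simp add: s0sq field_simps)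
      then have "\<bar>M t - s0\<^sup>2\<bar> = 8 / \<bar>c\<bar> * \<bar>m / 2 + c / 8 * M t\<bar>" by (simp only: abs_mult abs_divide abs_numeral)
      also have "\<dots> \<le> 8 / \<bar>c\<bar> * (C1 * m\<^sup>2)" using ex4 c by (intro mult_left_mono) auto
      also have "\<dots> = C3 * \<bar>m\<bar> * s0\<^sup>2" unfolding C3_def s0m using c
        by (simp add: field_simps power2_eq_square abs_mult[symmetric])
      finally show ?thesis .
    qed
    \<comment> \<open>Division by \<open>|w| + s0 >= s0\<close> passes from squares to
      radii.\<close>
    have W: "\<bar>cmod (w t) - s0\<bar> \<le> C3 * \<bar>m\<bar> * s0" for t
    proof -
      have "M t - s0\<^sup>2 = (cmod (w t) - s0) * (cmod (w t) + s0)" by (simp add: M_def power2_eq_square algebra_simps)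
      then have "\<bar>cmod (w t) - s0\<bar> * (cmod (w t) + s0) \<le> C3 * \<bar>m\<bar> * s0\<^sup>2"
        using Ms0[of t] s0 by (simp add: abs_mult)
      moreover have "\<bar>cmod (w t) - s0\<bar> * s0 \<le> \<bar>cmod (w t) - s0\<bar> * (cmod (w t) + s0)"
        by (intro mult_left_mono) auto
      ultimately have "\<bar>cmod (w t) - s0\<bar> * s0 \<le> (C3 * \<bar>m\<bar> * s0) * s0" by (simp add: power2_eq_square)
      then show ?thesis using s0 by simp
    qed
    have "C3 * \<bar>m\<bar> \<le> 1"
    proof -
      have "C3 * \<bar>m\<bar> \<le> (C3 + 1) * (1 / (C3 + 1))" using m \<epsilon>(4) nn by (intro mult_mono) auto
      then show ?thesis using nn by simp
    qed
    then have "C3 * \<bar>m\<bar> * s0 \<le> 1 * s0" using s0 by (intro mult_right_mono) auto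
    then have W2: "cmod (w t) \<le> 2 * s0" for t using W[of t] by linarith
    have Z4: "cmod (\<zeta> t) \<le> 4 * s0" for t using W2[of t] low(1)[of t] by linarith
    have Z: "\<bar>cmod (\<zeta> t) - cmod (w t)\<bar> \<le> 4 * C0 * (1 + 64 / \<bar>c\<bar>) * \<bar>m\<bar> * s0" for t
    proof -
      have "(cmod (\<zeta> t))\<^sup>2 \<le> (4 * s0)\<^sup>2" using Z4 by (intro power_mono) auto
      then have q: "(cmod (\<zeta> t))\<^sup>2 \<le> 64 / \<bar>c\<bar> * \<bar>m\<bar>" by (simp add: power_mult_distrib s0m)
      have "\<bar>cmod (\<zeta> t) - cmod (w t)\<bar> \<le> cmod (w t - \<zeta> t)" using norm_triangle_ineq3[of "w t" "\<zeta> t"] by simp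
      also have "\<dots> \<le> C0 * (\<bar>m\<bar> + (cmod (\<zeta> t))\<^sup>2) * cmod (\<zeta> t)" unfolding w_def by (rule id[OF m0 \<zeta>r])
      also have "\<dots> \<le> C0 * (\<bar>m\<bar> + 64 / \<bar>c\<bar> * \<bar>m\<bar>) * (4 * s0)"
        using q Z4[of t] K(1) by (intro mult_mono mult_left_mono add_left_mono) auto
      finally show ?thesis by (simp add: algebra_simps)
    qed
    have "C * \<bar>m\<bar> * s0 = C3 * \<bar>m\<bar> * s0 + 4 * C0 * (1 + 64 / \<bar>c\<bar>) * \<bar>m\<bar> * s0"
      unfolding C_def by (simp only: distrib_right)
    moreover have "0 \<le> 4 * C0 * (1 + 64 / \<bar>c\<bar>) * \<bar>m\<bar> * s0"
      using mult_nonneg_nonneg[OF mult_nonneg_nonneg[OF nn(3) abs_ge_zero[of m]] less_imp_le[OF s0]] .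
    moreover have "0 \<le> C3 * \<bar>m\<bar> * s0"
      using mult_nonneg_nonneg[OF mult_nonneg_nonneg[OF nn(2) abs_ge_zero[of m]] less_imp_le[OF s0]] .
    moreover have "\<zeta> t \<noteq> 0" using Mnz[of t] by (auto simp: M_def w_def nf_0)
    ultimately show ?thesis using mc W[of t] Z[of t] unfolding s0_def[symmetric] \<zeta>_def[symmetric] w_def[symmetric]
      by (intro conjI) linarith+
  qed
  have "r\<^sup>2 \<le> d" using power_mono[OF r(2), of 2] r(1) K(6) by linarith
  moreover have "0 \<le> C" using nn by (simp add: C_def)
  ultimately show thesis using main r(1) \<epsilon>(1) that by blast
qed

end

section \<open>First order averaging\<close>

text \<open>The oriented integral from 0 to \<open>t\<close>: for either sign of \<open>t\<close>
  one of the two integrals runs over an empty or degenerate interval and is 0.\<close>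

definition antideriv :: "(real \<Rightarrow> real) \<Rightarrow> real \<Rightarrow> real" where
  "antideriv h t = integral {0..t} h - integral {t..0} h"

lemma antideriv_0: "antideriv h 0 = 0" by (simp add: antideriv_def)

lemma antideriv_has_derivative:
  assumes "continuous_on UNIV h"
  shows "(antideriv h has_real_derivative h t) (at t)"
proof -
  \<comment> \<open>From a base point left of both 0 and \<open>t\<close>, the two signs reduce to
    one ordinary integral up to a constant.\<close>
  define a b where "a = min 0 t - 1" and "b = max 0 t + 1"
  have ab: "a < t" "t < b" "a < 0" "0 < b" by (auto simp: a_def b_def)
  have c: "continuous_on S h" for S using assms continuous_on_subset by blast
  have i: "h integrable_on {u..v}" for u v by (rule integrable_continuous_real[OF c])
  have eq: "integral {a..s} h - integral {a..0} h = antideriv h s" if s: "s \<in> {a<..<b}" for s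
  proof (cases "0 \<le> s")
    case True
    then have "integral {s..0} h = 0" by (cases "s = 0") auto
    moreover have "integral {a..0} h + integral {0..s} h = integral {a..s} h"
      using True ab i by (intro Henstock_Kurzweil_Integration.integral_combine) auto
    ultimately show ?thesis by (simp add: antideriv_def)
  next
    case False
    then have "integral {0..s} h = 0" by simp
    moreover have "integral {a..s} h + integral {s..0} h = integral {a..0} h"
      using False s i by (intro Henstock_Kurzweil_Integration.integral_combine) auto
    ultimately show ?thesis by (simp add: antideriv_def)
  qed
  have "((\<lambda>s. integral {a..s} h) has_real_derivative h t) (at t within {a..b})"
    using ab by (intro integral_has_real_derivative c) auto
  then have "((\<lambda>s. integral {a..s} h) has_real_derivative h t) (at t)"
    using ab by (simp add: at_within_Icc_at)
  then have "((\<lambda>s. integral {a..s} h - integral {a..0} h) has_real_derivative h t) (at t)"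
    using DERIV_diff[OF _ DERIV_const] by fastforce
  then show ?thesis
  proof (rule has_field_derivative_transform_within_open)
    show "open {a<..<b}" "t \<in> {a<..<b}" using ab by auto
  qed (rule eq)
qed

lemma nondecreasing_if_deriv_nonneg:
  fixes f :: "real \<Rightarrow> real"
  assumes "\<And>x. (f has_real_derivative f' x) (at x)" "\<And>x. 0 \<le> f' x" "a \<le> b"
  shows "f a \<le> f b"
  using DERIV_nonneg_imp_nondecreasing[OF assms(3)] assms(1,2) by blast

lemma DERIV_const_diff:
  fixes f g :: "real \<Rightarrow> real"
  assumes "\<And>t. (f has_real_derivative h t) (at t)" "\<And>t. (g has_real_derivative h t) (at t)"
  shows "f s - f t = g s - g t"
proof -
  have "\<forall>t. ((\<lambda>t. f t - g t) has_real_derivative 0) (at t)"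
    by (auto intro!: derivative_eq_intros assms)
  from DERIV_isconst_all[OF this, of s t] show ?thesis by simp
qed

text \<open>Primitives are unique up to a constant; the rules for sums, multiples and differences
  are read off from candidate primitives.\<close>

lemma antideriv_eqI:
  assumes "\<And>t. (g has_real_derivative h t) (at t)" "continuous_on UNIV h"
  shows "antideriv h t = g t - g 0"
  using DERIV_const_diff[OF antideriv_has_derivative[OF assms(2)] assms(1), of t 0] by (simp add: antideriv_0)

lemma antideriv_add:
  assumes "continuous_on UNIV f" "continuous_on UNIV g"
  shows "antideriv (\<lambda>t. f t + g t) t = antideriv f t + antideriv g t"
  using antideriv_eqI[of "\<lambda>t. antideriv f t + antideriv g t" "\<lambda>t. f t + g t" t] assms
  by (auto simp: antideriv_0 intro!: derivative_eq_intros antideriv_has_derivative continuous_on_add)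

lemma antideriv_cmult:
  assumes "continuous_on UNIV f"
  shows "antideriv (\<lambda>t. f t * k) t = antideriv f t * k"
proof -
  have "((\<lambda>t. antideriv f t * k) has_real_derivative f t * k) (at t)" for t
    by (rule DERIV_cmult_right[OF antideriv_has_derivative[OF assms]])
  from antideriv_eqI[OF this, of t] show ?thesis using assms by (simp add: antideriv_0 continuous_on_mult)
qed

lemma antideriv_diff:
  assumes "continuous_on UNIV f" "continuous_on UNIV g"
  shows "antideriv (\<lambda>t. f t - g t) t = antideriv f t - antideriv g t"
  using antideriv_eqI[of "\<lambda>t. antideriv f t - antideriv g t" "\<lambda>t. f t - g t" t] assms
  by (auto simp: antideriv_0 intro!: derivative_eq_intros antideriv_has_derivative continuous_on_diff)

lemma antideriv_bounds:
  assumes c: "continuous_on UNIV h" and t: "0 \<le> t" and l: "\<And>s. l \<le> h s" and u: "\<And>s. h s \<le> u"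
  shows "l * t \<le> antideriv h t" "antideriv h t \<le> u * t"
proof -
  note p = antideriv_has_derivative[OF c]
  have 1: "((\<lambda>s. antideriv h s - l * s) has_real_derivative h s - l) (at s)" for s
    using DERIV_diff[OF p DERIV_cmult_Id] .
  have 2: "((\<lambda>s. u * s - antideriv h s) has_real_derivative u - h s) (at s)" for s
    using DERIV_diff[OF DERIV_cmult_Id p] .
  have 3: "antideriv h 0 - l * 0 \<le> antideriv h t - l * t"
    by (rule nondecreasing_if_deriv_nonneg[OF 1 _ t]) (simp add: l)
  have 4: "u * 0 - antideriv h 0 \<le> u * t - antideriv h t"
    by (rule nondecreasing_if_deriv_nonneg[OF 2 _ t]) (simp add: u)
  show "l * t \<le> antideriv h t" using 3 by (simp add: antideriv_0)
  show "antideriv h t \<le> u * t" using 4 by (simp add: antideriv_0)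
qed

lemma antideriv_abs_le:
  assumes "continuous_on UNIV h" "0 \<le> t" "\<And>s. \<bar>h s\<bar> \<le> u"
  shows "\<bar>antideriv h t\<bar> \<le> u * t"
proof -
  have "- u \<le> h s \<and> h s \<le> u" for s using assms(3)[of s] by (simp add: abs_le_iff)
  then show ?thesis using antideriv_bounds[OF assms(1,2), of "- u" u] by (simp add: abs_le_iff)
qed

lemma antideriv_shift:
  assumes "continuous_on UNIV h" "\<And>t. h (t + T) = h t"
  shows "antideriv h (t + T) = antideriv h t + antideriv h T"
proof -
  have "((\<lambda>t. antideriv h (t + T)) has_real_derivative h t) (at t)" for t
    using DERIV_shift[of "antideriv h" "h t" t T] antideriv_has_derivative[OF assms(1), of "t + T"] by (simp add: assms(2))
  from DERIV_const_diff[OF this antideriv_has_derivative[OF assms(1)], of t 0] show ?thesis by (simp add: antideriv_0)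
qed

text \<open>The antiderivative, normalised at 0, of \<open>h\<close> minus its mean over
  \<open>2 pi\<close>. For \<open>2 pi\<close>-periodic \<open>h\<close> it is periodic, which is
  what the fixed point operator needs.\<close>

definition osc :: "(real \<Rightarrow> real) \<Rightarrow> real \<Rightarrow> real" where
  "osc h t = antideriv h t - t / (2 * pi) * antideriv h (2 * pi)"

lemma osc_has_derivative:
  assumes "continuous_on UNIV h"
  shows "(osc h has_real_derivative h t - antideriv h (2 * pi) / (2 * pi)) (at t)"
proof -
  have "((\<lambda>t. t / (2 * pi) * antideriv h (2 * pi)) has_real_derivative 1 / (2 * pi) * antideriv h (2 * pi)) (at t)"
    by (rule DERIV_cmult_right[OF DERIV_cdivide[OF DERIV_ident]])
  from DERIV_diff[OF antideriv_has_derivative[OF assms] this] show ?thesis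
    by (simp add: osc_def[abs_def])
qed

lemma continuous_on_osc: "continuous_on UNIV h \<Longrightarrow> continuous_on UNIV (osc h)"
  by (rule DERIV_continuous_on) (rule osc_has_derivative)

lemma osc_periodic:
  assumes "continuous_on UNIV h" "\<And>t. h (t + 2 * pi) = h t"
  shows "osc h (t + 2 * pi) = osc h t"
  using antideriv_shift[OF assms] by (simp add: osc_def field_simps)

text \<open>By periodicity one period suffices, and there each of the two terms is at most
  \<open>2 pi u\<close>.\<close>

lemma osc_abs_le:
  assumes "continuous_on UNIV h" "\<And>t. h (t + 2 * pi) = h t" "\<And>s. \<bar>h s\<bar> \<le> u"
  shows "\<bar>osc h t\<bar> \<le> 4 * pi * u"
proof -
  obtain s where s: "0 \<le> s" "s < 2 * pi" "osc h s = osc h t"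
    by (rule periodic_reduce[of "osc h" "2 * pi" t, OF osc_periodic[OF assms(1,2)]]) auto
  have u: "0 \<le> u" using assms(3)[of 0] by linarith
  have "\<bar>antideriv h s\<bar> \<le> u * (2 * pi)"
    using antideriv_abs_le[OF assms(1) s(1) assms(3)] mult_left_mono[of s "2 * pi" u] s u by linarith
  moreover have "\<bar>s / (2 * pi) * antideriv h (2 * pi)\<bar> \<le> 1 * (u * (2 * pi))"
    unfolding abs_mult using antideriv_abs_le[OF assms(1) _ assms(3), of "2 * pi"] s by (intro mult_mono) auto
  ultimately have "\<bar>osc h s\<bar> \<le> 4 * pi * u"
  proof -
    have "4 * pi * u = u * (2 * pi) + 1 * (u * (2 * pi))" by simp
    moreover assume "\<bar>antideriv h s\<bar> \<le> u * (2 * pi)" "\<bar>s / (2 * pi) * antideriv h (2 * pi)\<bar> \<le> 1 * (u * (2 * pi))"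
    ultimately show ?thesis
      unfolding osc_def using abs_triangle_ineq4[of "antideriv h s" "s / (2 * pi) * antideriv h (2 * pi)"] by linarith
  qed
  then show ?thesis by (simp only: s(3))
qed

lemma osc_diff:
  assumes "continuous_on UNIV f" "continuous_on UNIV g"
  shows "osc (\<lambda>t. f t - g t) t = osc f t - osc g t"
  unfolding osc_def antideriv_diff[OF assms] by (simp add: algebra_simps)

text \<open>The truncation to \<open>[a, b]\<close> makes the fixed point operator globally
  defined, and its constant term is chosen so that the mean of the right-hand side vanishes at a
  fixed point.\<close>

lemma averaging_exists:
  fixes al be :: "real \<Rightarrow> real" and ab bb a b A M :: real
  assumes al: "continuous_on UNIV al" "\<And>t. al (t + 2 * pi) = al t" "\<And>t. \<bar>al t\<bar> \<le> A"
    and be: "continuous_on UNIV be" "\<And>t. be (t + 2 * pi) = be t" "\<And>t. \<bar>be t\<bar> \<le> A"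
    and mean: "antideriv al (2 * pi) = 2 * pi * ab" "antideriv be (2 * pi) = 2 * pi * bb"
    and bb: "bb \<noteq> 0" and V0: "a < - ab / bb" "- ab / bb < b" and M: "0 \<le> M"
  obtains e0 where "0 < e0" "e0 \<le> 1"
    "\<And>e \<Psi>. 0 < e \<Longrightarrow> e < e0 \<Longrightarrow>
      (\<And>t V. V \<in> {a..b} \<Longrightarrow> \<bar>\<Psi> t V\<bar> \<le> M * e) \<Longrightarrow>
      (\<And>t V V'. V \<in> {a..b} \<Longrightarrow> V' \<in> {a..b} \<Longrightarrow> \<bar>\<Psi> t V - \<Psi> t V'\<bar> \<le> M * e * \<bar>V - V'\<bar>) \<Longrightarrow>
      (\<And>t V. \<Psi> (t + 2 * pi) V = \<Psi> t V) \<Longrightarrow>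
      (\<And>v. continuous_on UNIV v \<Longrightarrow> (\<And>t. v t \<in> {a..b}) \<Longrightarrow> continuous_on UNIV (\<lambda>t. \<Psi> t (v t))) \<Longrightarrow>
      \<exists>v. (\<forall>t. v t \<in> {a..b} \<and> v (t + 2 * pi) = v t \<and>
         (v has_real_derivative e * (al t + be t * v t + \<Psi> t (v t))) (at t))"
proof -
  \<comment> \<open>\<open>Fm\<close> bounds the truncated right-hand side; \<open>e Lc\<close> is
    the Lipschitz constant of the operator, and \<open>e Rc\<close> bounds its distance from the
    averaged equilibrium \<open>V0\<close>.\<close>
  define Fm where "Fm = A + A * (\<bar>a\<bar> + \<bar>b\<bar>) + M"
  define Lc where "Lc = (M + A * (4 * pi * (A + M))) / \<bar>bb\<bar> + 4 * pi * (A + M)"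
  define Rc where "Rc = (M + A * (4 * pi * Fm)) / \<bar>bb\<bar> + 4 * pi * Fm"
  have A: "0 \<le> A" using al(3)[of 0] by linarith
  have nn: "0 \<le> Fm" "0 \<le> Lc" "0 \<le> Rc" using A M by (auto simp: Fm_def Lc_def Rc_def)
  define V0 where "V0 = - ab / bb"
  define g where "g = min (V0 - a) (b - V0)"
  have g: "0 < g" using V0 by (simp add: g_def V0_def)
  \<comment> \<open>\<open>e Lc <= 1/2\<close> gives the contraction, and \<open>e Rc < g\<close>
    keeps the fixed point in \<open>{a..b}\<close>, where the truncation is the identity.\<close>
  define e0 where "e0 = min 1 (min (1 / (2 * (Lc + 1))) (g / (Rc + 1)))"
  have e0: "0 < e0" "e0 \<le> 1" "e0 \<le> 1 / (2 * (Lc + 1))" "e0 \<le> g / (Rc + 1)"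
    using nn g by (auto simp: e0_def)
  have main: "\<exists>v. (\<forall>t. v t \<in> {a..b} \<and> v (t + 2 * pi) = v t \<and>
         (v has_real_derivative e * (al t + be t * v t + \<Psi> t (v t))) (at t))"
    if e: "0 < e" "e < e0" and P1: "\<And>t V. V \<in> {a..b} \<Longrightarrow> \<bar>\<Psi> t V\<bar> \<le> M * e"
      and P2: "\<And>t V V'. V \<in> {a..b} \<Longrightarrow> V' \<in> {a..b} \<Longrightarrow> \<bar>\<Psi> t V - \<Psi> t V'\<bar> \<le> M * e * \<bar>V - V'\<bar>"
      and P3: "\<And>t V. \<Psi> (t + 2 * pi) V = \<Psi> t V"
      and P4: "\<And>v. continuous_on UNIV v \<Longrightarrow> (\<And>t. v t \<in> {a..b}) \<Longrightarrow> continuous_on UNIV (\<lambda>t. \<Psi> t (v t))"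
    for e \<Psi>
  proof -
    have e1: "e \<le> 1" using e e0 by linarith
    have Me: "M * e \<le> M" using M e1 by (simp add: mult_left_le)
    define cl where "cl V = max a (min b V)" for V :: real
    have cl: "cl V \<in> {a..b}" "\<bar>cl V - cl V'\<bar> \<le> \<bar>V - V'\<bar>" "V \<in> {a..b} \<Longrightarrow> cl V = V" for V V'
      using V0 by (auto simp: cl_def)
    define F where "F v t = al t + be t * cl (v t) + \<Psi> t (cl (v t))" for v t
    have ccl: "continuous_on UNIV (\<lambda>t. cl (v t))" if "continuous_on UNIV v" for v
      unfolding cl_def by (intro continuous_intros that)
    have cP: "continuous_on UNIV (\<lambda>t. \<Psi> t (cl (v t)))" if "continuous_on UNIV v" for v
      by (intro P4 ccl that cl(1))
    have cF: "continuous_on UNIV (F v)" if "continuous_on UNIV v" for v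
      unfolding F_def by (intro continuous_intros al be ccl cP that)
    have perF: "F v (t + 2 * pi) = F v t" if "\<And>t. v (t + 2 * pi) = v t" for v t
      by (simp add: F_def that P3 al(2) be(2))
    have bcl: "\<bar>cl V\<bar> \<le> \<bar>a\<bar> + \<bar>b\<bar>" for V using cl(1)[of V] by auto
    have bF: "\<bar>F v t\<bar> \<le> Fm" for v t
    proof -
      have "\<bar>be t * cl (v t)\<bar> \<le> A * (\<bar>a\<bar> + \<bar>b\<bar>)"
        unfolding abs_mult using be(3)[of t] bcl[of "v t"] A by (intro mult_mono) auto
      then show ?thesis using al(3)[of t] P1[OF cl(1), of t "v t"] Me unfolding F_def Fm_def by linarith
    qed
    have lF: "\<bar>F v t - F u t\<bar> \<le> (A + M) * dd" if "\<And>t. \<bar>v t - u t\<bar> \<le> dd" for v u t dd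
    proof -
      have dd: "0 \<le> dd" using that[of 0] by linarith
      have c: "\<bar>cl (v t) - cl (u t)\<bar> \<le> dd" using cl(2) that order_trans by blast
      have "\<bar>be t * (cl (v t) - cl (u t))\<bar> \<le> A * dd"
        unfolding abs_mult using be(3)[of t] c A by (intro mult_mono) auto
      moreover have "\<bar>\<Psi> t (cl (v t)) - \<Psi> t (cl (u t))\<bar> \<le> M * dd"
        using P2[OF cl(1) cl(1), of t "v t" "u t"] mult_mono[OF Me c M] by simp
      moreover have "F v t - F u t = be t * (cl (v t) - cl (u t)) + (\<Psi> t (cl (v t)) - \<Psi> t (cl (u t)))"
        by (simp add: F_def algebra_simps)
      ultimately show ?thesis by (simp add: distrib_right)
    qed
    \<comment> \<open>If \<open>v = k + e osc (F v)\<close> stays in \<open>{a..b}\<close>, then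
      \<open>F v = al + be k + Q v\<close>; \<open>Q\<close> collects the terms of order
      \<open>e\<close>.\<close>
    define Q where "Q v s = \<Psi> s (cl (v s)) + be s * (e * osc (F v) s)" for v s
    have cQ: "continuous_on UNIV (Q v)" if "continuous_on UNIV v" for v
      unfolding Q_def by (intro continuous_intros be cP continuous_on_osc cF that)
    have bQ: "\<bar>Q v s\<bar> \<le> e * (M + A * (4 * pi * Fm))" if "continuous_on UNIV v" "\<And>t. v (t + 2 * pi) = v t" for v s
    proof -
      have pF: "F v (t + 2 * pi) = F v t" for t using that(2) by (rule perF)
      have "\<bar>be s * (e * osc (F v) s)\<bar> \<le> A * (e * (4 * pi * Fm))"
        unfolding abs_mult using be(3)[of s] A e osc_abs_le[OF cF[OF that(1)] pF bF]
        by (intro mult_mono) auto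
      then show ?thesis using P1[OF cl(1), of s "v s"] unfolding Q_def by (simp add: algebra_simps)
    qed
    have lO: "\<bar>osc (F v) s - osc (F u) s\<bar> \<le> 4 * pi * ((A + M) * dd)"
      if "continuous_on UNIV v" "\<And>t. v (t + 2 * pi) = v t" "continuous_on UNIV u" "\<And>t. u (t + 2 * pi) = u t"
        "\<And>t. \<bar>v t - u t\<bar> \<le> dd" for v u s dd
    proof -
      have pF: "F v (t + 2 * pi) = F v t" for t using that(2) by (rule perF)
      have pF': "F u (t + 2 * pi) = F u t" for t using that(4) by (rule perF)
      have "\<bar>F v t - F u t\<bar> \<le> (A + M) * dd" for t using that(5) by (rule lF)
      then show ?thesis
        unfolding osc_diff[OF cF[OF that(1)] cF[OF that(3)], symmetric]
        by (intro osc_abs_le continuous_on_diff cF that) (simp_all add: pF pF')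
    qed
    have lQ: "\<bar>Q v s - Q u s\<bar> \<le> e * (M + A * (4 * pi * (A + M))) * dd"
      if "continuous_on UNIV v" "\<And>t. v (t + 2 * pi) = v t" "continuous_on UNIV u" "\<And>t. u (t + 2 * pi) = u t"
        "\<And>t. \<bar>v t - u t\<bar> \<le> dd" for v u s dd
    proof -
      have dd: "0 \<le> dd" using that(5)[of 0] by linarith
      have c: "\<bar>cl (v s) - cl (u s)\<bar> \<le> dd" using cl(2) that(5) order_trans by blast
      have "\<bar>\<Psi> s (cl (v s)) - \<Psi> s (cl (u s))\<bar> \<le> M * e * dd"
        using P2[OF cl(1) cl(1), of s "v s" "u s"] mult_left_mono[OF c, of "M * e"] M e by simp
      moreover have "\<bar>be s * (e * (osc (F v) s - osc (F u) s))\<bar> \<le> A * (e * (4 * pi * ((A + M) * dd)))"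
        unfolding abs_mult using be(3)[of s] A e lO[OF that(1) that(2) that(3) that(4) that(5)] by (intro mult_mono) auto
      moreover have "Q v s - Q u s = (\<Psi> s (cl (v s)) - \<Psi> s (cl (u s))) + be s * (e * (osc (F v) s - osc (F u) s))"
        by (simp add: Q_def algebra_simps)
      ultimately show ?thesis by (simp add: algebra_simps)
    qed
    \<comment> \<open>Setting the mean of \<open>al + be k + Q v\<close> to zero gives this constant
      \<open>k\<close>: it is \<open>V0\<close> minus the mean of \<open>Q v\<close> over
      \<open>bb\<close>.\<close>
    define T where "T v t = V0 - antideriv (Q v) (2 * pi) / (2 * pi * bb) + e * osc (F v) t" for v t
    have cT: "continuous_on UNIV (T v)" if "continuous_on UNIV v" for v
      unfolding T_def by (intro continuous_intros continuous_on_osc cF that)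
    have perT: "T v (t + 2 * pi) = T v t" if "continuous_on UNIV v" "\<And>t. v (t + 2 * pi) = v t" for v t
    proof -
      have pF: "F v (t + 2 * pi) = F v t" for t using that(2) by (rule perF)
      show ?thesis unfolding T_def using osc_periodic[OF cF[OF that(1)] pF] by simp
    qed
    have bT: "\<bar>T v t - V0\<bar> \<le> e * Rc" if "continuous_on UNIV v" "\<And>t. v (t + 2 * pi) = v t" for v t
    proof -
      have pF: "F v (t + 2 * pi) = F v t" for t using that(2) by (rule perF)
      have "\<bar>Q v s\<bar> \<le> e * (M + A * (4 * pi * Fm))" for s using that by (rule bQ)
      from antideriv_abs_le[OF cQ[OF that(1)] _ this, of "2 * pi"]
      have "\<bar>antideriv (Q v) (2 * pi)\<bar> \<le> e * (M + A * (4 * pi * Fm)) * (2 * pi)"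
        by simp
      then have "\<bar>antideriv (Q v) (2 * pi) / (2 * pi * bb)\<bar> \<le> e * (M + A * (4 * pi * Fm)) * (2 * pi) / (2 * pi * \<bar>bb\<bar>)"
        by (simp only: abs_divide abs_mult abs_numeral abs_of_pos[OF pi_gt_zero]) (rule divide_right_mono, simp_all)
      also have "\<dots> = e * ((M + A * (4 * pi * Fm)) / \<bar>bb\<bar>)" by simp
      finally have 1: "\<bar>antideriv (Q v) (2 * pi) / (2 * pi * bb)\<bar> \<le> e * ((M + A * (4 * pi * Fm)) / \<bar>bb\<bar>)" .
      have "\<bar>e * osc (F v) t\<bar> \<le> e * (4 * pi * Fm)"
        unfolding abs_mult using e osc_abs_le[OF cF[OF that(1)] pF bF] by (intro mult_mono) auto
      with 1 show ?thesis unfolding T_def Rc_def by (simp only: distrib_left)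
    qed
    have lT: "\<bar>T v t - T u t\<bar> \<le> e * Lc * dd"
      if "continuous_on UNIV v" "\<And>t. v (t + 2 * pi) = v t" "continuous_on UNIV u" "\<And>t. u (t + 2 * pi) = u t"
        "\<And>t. \<bar>v t - u t\<bar> \<le> dd" for v u t dd
    proof -
      have dd: "0 \<le> dd" using that(5)[of 0] by linarith
      have "\<bar>antideriv (Q v) (2 * pi) - antideriv (Q u) (2 * pi)\<bar> \<le> e * (M + A * (4 * pi * (A + M))) * dd * (2 * pi)"
      proof -
        have "\<bar>Q v s - Q u s\<bar> \<le> e * (M + A * (4 * pi * (A + M))) * dd" for s using that by (rule lQ)
        from antideriv_abs_le[OF continuous_on_diff[OF cQ[OF that(1)] cQ[OF that(3)]] _ this, of "2 * pi"]
        show ?thesis unfolding antideriv_diff[OF cQ[OF that(1)] cQ[OF that(3)]] by simp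
      qed
      then have "\<bar>(antideriv (Q v) (2 * pi) - antideriv (Q u) (2 * pi)) / (2 * pi * bb)\<bar>
          \<le> e * (M + A * (4 * pi * (A + M))) * dd * (2 * pi) / (2 * pi * \<bar>bb\<bar>)"
        by (simp only: abs_divide abs_mult abs_numeral abs_of_pos[OF pi_gt_zero]) (rule divide_right_mono, simp_all)
      also have "\<dots> = e * ((M + A * (4 * pi * (A + M))) / \<bar>bb\<bar>) * dd" by simp
      finally have 1: "\<bar>(antideriv (Q v) (2 * pi) - antideriv (Q u) (2 * pi)) / (2 * pi * bb)\<bar>
        \<le> e * ((M + A * (4 * pi * (A + M))) / \<bar>bb\<bar>) * dd" .
      have 2: "\<bar>e * (osc (F v) t - osc (F u) t)\<bar> \<le> e * (4 * pi * ((A + M) * dd))"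
        unfolding abs_mult using e lO[OF that(1) that(2) that(3) that(4) that(5)] by (intro mult_mono) auto
      have "T v t - T u t = - ((antideriv (Q v) (2 * pi) - antideriv (Q u) (2 * pi)) / (2 * pi * bb)) + e * (osc (F v) t - osc (F u) t)"
        by (simp add: T_def diff_divide_distrib algebra_simps)
      moreover have "e * Lc * dd = e * ((M + A * (4 * pi * (A + M))) / \<bar>bb\<bar>) * dd + e * (4 * pi * ((A + M) * dd))"
        unfolding Lc_def by (simp only: distrib_left distrib_right mult.assoc)
      ultimately show ?thesis using 1 2 by linarith
    qed
    \<comment> \<open>Banach's theorem is applied on the \<open>2 pi\<close>-periodic functions, a
      closed subset of the complete space of bounded continuous functions.\<close>
    define S where "S = {v :: real \<Rightarrow>\<^sub>C real. \<forall>t. apply_bcontfun v (t + 2 * pi) = apply_bcontfun v t}"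
    have cont_ev: "continuous_on UNIV (\<lambda>v :: real \<Rightarrow>\<^sub>C real. apply_bcontfun v t)" for t
      unfolding continuous_on_iff by (meson dist_bounded le_less_trans)
    have "closed S" unfolding S_def
      by (intro closed_Collect_all closed_Collect_eq cont_ev)
    then have complete: "complete S" by (simp add: complete_eq_closed)
    have "(0 :: real \<Rightarrow>\<^sub>C real) \<in> S" by (simp add: S_def)
    then have ne: "S \<noteq> {}" by blast
    define \<T> where "\<T> v = Bcontfun (T (apply_bcontfun v))" for v
    have ap: "apply_bcontfun (\<T> v) = T (apply_bcontfun v)" if "v \<in> S" for v
    proof -
      have "\<bar>T (apply_bcontfun v) t\<bar> \<le> \<bar>V0\<bar> + e * Rc" for t
        using bT[of "apply_bcontfun v" t] that by (auto simp: S_def)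
      then have "T (apply_bcontfun v) \<in> bcontfun"
        by (intro bcontfun_normI cT) auto
      then show ?thesis by (simp add: \<T>_def Bcontfun_inverse)
    qed
    have TS: "\<T> ` S \<subseteq> S"
      using perT ap by (auto simp: S_def)
    have contr: "dist (\<T> v) (\<T> u) \<le> 1 / 2 * dist v u" if "v \<in> S" "u \<in> S" for v u
    proof (rule dist_bound)
      fix t
      have "\<bar>T (apply_bcontfun v) t - T (apply_bcontfun u) t\<bar> \<le> e * Lc * dist v u"
      proof (rule lT)
        show "\<bar>apply_bcontfun v t - apply_bcontfun u t\<bar> \<le> dist v u" for t
          using dist_bounded[of v t u] by (simp add: dist_real_def)
      qed (use that in \<open>auto simp: S_def\<close>)
      also have "\<dots> \<le> 1 / 2 * dist v u"
      proof (rule mult_right_mono)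
        have "e * Lc \<le> 1 / (2 * (Lc + 1)) * (Lc + 1)" using e e0 nn by (intro mult_mono) auto
        also have "\<dots> = 1 / 2" using nn by (simp add: field_simps)
        finally show "e * Lc \<le> 1 / 2" .
      qed simp
      finally show "dist (apply_bcontfun (\<T> v) t) (apply_bcontfun (\<T> u) t) \<le> 1 / 2 * dist v u"
        using that by (simp add: ap dist_real_def)
    qed
    have "\<exists>!w\<in>S. \<T> w = w"
      by (rule Banach_fix[OF complete ne _ _ TS contr]) auto
    then obtain w where w: "w \<in> S" "\<T> w = w" by blast
    define v where "v = apply_bcontfun w"
    have cv: "continuous_on UNIV v" by (simp add: v_def)
    have perv: "v (t + 2 * pi) = v t" for t using w(1) by (simp add: S_def v_def)
    have fixT: "v t = T v t" for t using ap[OF w(1)] w(2) by (simp add: v_def)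
    have "e * Rc < g"
    proof -
      have "e * Rc \<le> e * (Rc + 1)" using e by simp
      also have "\<dots> < g / (Rc + 1) * (Rc + 1)" using e e0 nn by (intro mult_strict_right_mono) auto
      finally show ?thesis using nn by simp
    qed
    then have "\<bar>v t - V0\<bar> < g" for t using bT[OF cv perv, of t] fixT[of t] by linarith
    then have "v t - V0 < g" "V0 - v t < g" for t by (simp_all add: abs_less_iff)
    then have vab: "v t \<in> {a..b}" for t
    proof -
      have "g \<le> V0 - a" "g \<le> b - V0" by (auto simp: g_def)
      then show ?thesis using \<open>\<And>t. v t - V0 < g\<close>[of t] \<open>\<And>t. V0 - v t < g\<close>[of t] by simp
    qed
    have Fv: "F v t = al t + be t * v t + \<Psi> t (v t)" for t by (simp add: F_def cl(3)[OF vab])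
    define k where "k = V0 - antideriv (Q v) (2 * pi) / (2 * pi * bb)"
    have vk: "v t = k + e * osc (F v) t" for t using fixT[of t] by (simp add: T_def k_def)
    have "F v t = al t + be t * k + Q v t" for t
    proof -
      have "be t * v t = be t * k + be t * (e * osc (F v) t)" by (subst vk) (rule distrib_left)
      then show ?thesis unfolding Fv Q_def cl(3)[OF vab] by simp
    qed
    then have "F v = (\<lambda>t. al t + be t * k + Q v t)" by blast
    then have "antideriv (F v) (2 * pi) = antideriv (\<lambda>t. al t + be t * k + Q v t) (2 * pi)" by simp
    also have "\<dots> = antideriv al (2 * pi) + antideriv be (2 * pi) * k + antideriv (Q v) (2 * pi)"
      by (simp add: antideriv_add antideriv_cmult al be cQ[OF cv] continuous_on_add continuous_on_mult)
    also have "\<dots> = 0" unfolding mean k_def V0_def using bb by (simp add: field_simps)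
    finally have zero: "antideriv (F v) (2 * pi) = 0" .
    \<comment> \<open>The mean of \<open>F v\<close> is zero, so the derivative of
      \<open>osc (F v)\<close> is \<open>F v\<close> itself.\<close>
    have "((\<lambda>t. k + e * osc (F v) t) has_real_derivative e * F v t) (at t)" for t
      by (rule derivative_eq_intros osc_has_derivative[OF cF[OF cv]] refl)+ (simp add: zero)
    moreover have "v = (\<lambda>t. k + e * osc (F v) t)" using vk by (rule ext)
    ultimately have "(v has_real_derivative e * F v t) (at t)" for t by metis
    then show ?thesis using vab perv Fv by auto
  qed
  show thesis
  proof (rule that[OF e0(1,2)], goal_cases)
    case (1 e \<Psi>)
    show ?case by (rule main[OF 1(1,2,3,4,5,6)])
  qed
qed

text \<open>The weight \<open>exp (- 2 e W)\<close>, with \<open>W\<close> the mean-free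
  antiderivative of \<open>be\<close>, replaces the oscillating coefficient \<open>be\<close> by its
  mean \<open>bb\<close>. Since \<open>M e < |bb|\<close>, the term \<open>bb D^2\<close> then
  dominates wherever \<open>D\<close> is nonzero, so the weighted square has no critical point
  there.\<close>

lemma averaging_unique:
  fixes v V \<theta> :: "real \<Rightarrow> real"
  assumes be: "continuous_on UNIV be" "\<And>t. be (t + 2 * pi) = be t" and mean: "antideriv be (2 * pi) = 2 * pi * bb"
    and e: "0 < e" "M * e < \<bar>bb\<bar>"
    and lip: "\<And>t V V'. V \<in> {a..b} \<Longrightarrow> V' \<in> {a..b} \<Longrightarrow> \<bar>\<Psi> t V - \<Psi> t V'\<bar> \<le> M * e * \<bar>V - V'\<bar>"
    and v: "\<And>t. v t \<in> {a..b}" "\<And>t. v (t + 2 * pi) = v t"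
      "\<And>t. (v has_real_derivative e * (al t + be t * v t + \<Psi> t (v t))) (at t)"
    and V: "\<And>t. V t \<in> {a..b}" "\<And>t. V (t + T) = V t" "0 < T"
      "\<And>t. (V has_real_derivative \<theta>' t * (e * (al (\<theta> t) + be (\<theta> t) * V t + \<Psi> (\<theta> t) (V t)))) (at t)"
    and \<theta>: "\<And>t. (\<theta> has_real_derivative \<theta>' t) (at t)" "\<And>t. 0 < \<theta>' t"
      "\<And>t. \<exists>k::int. \<theta> (t + T) = \<theta> t + of_int k * (2 * pi)"
  shows "V t = v (\<theta> t)"
proof -
  define W where "W = osc be"
  have W': "(W has_real_derivative be t - bb) (at t)" for t
    unfolding W_def using osc_has_derivative[OF be(1), of t] by (simp add: mean)
  have perW: "W (t + 2 * pi) = W t" for t unfolding W_def by (rule osc_periodic[OF be])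
  define D where "D t = V t - v (\<theta> t)" for t
  define m where "m t = (D t)\<^sup>2 * exp (- 2 * e * W (\<theta> t))" for t
  define d\<Psi> where "d\<Psi> t = \<Psi> (\<theta> t) (V t) - \<Psi> (\<theta> t) (v (\<theta> t))" for t
  define m' where "m' t = 2 * e * \<theta>' t * exp (- 2 * e * W (\<theta> t)) * (bb * (D t)\<^sup>2 + D t * d\<Psi> t)" for t
  have v\<theta>: "((\<lambda>t. v (\<theta> t)) has_real_derivative e * (al (\<theta> t) + be (\<theta> t) * v (\<theta> t) + \<Psi> (\<theta> t) (v (\<theta> t))) * \<theta>' t) (at t)" for t
    by (rule DERIV_chain2[OF v(3) \<theta>(1)])
  have D': "(D has_real_derivative e * \<theta>' t * (be (\<theta> t) * D t + d\<Psi> t)) (at t)" for t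
    unfolding D_def d\<Psi>_def
    by (rule derivative_eq_intros V(4) v\<theta> refl)+ (simp add: algebra_simps)
  have W\<theta>: "((\<lambda>t. W (\<theta> t)) has_real_derivative (be (\<theta> t) - bb) * \<theta>' t) (at t)" for t
    by (rule DERIV_chain2[OF W' \<theta>(1)])
  have m': "(m has_real_derivative m' t) (at t)" for t
    unfolding m_def
    by (rule derivative_eq_intros D' W\<theta> refl)+ (simp add: m'_def algebra_simps power2_eq_square)
  \<comment> \<open>Both \<open>v\<close> and the weight are periodic in the angle, so any whole
    number of turns during \<open>T\<close> closes up.\<close>
  have perm: "m (t + T) = m t" for t
  proof -
    obtain k :: int where "\<theta> (t + T) = \<theta> t + of_int k * (2 * pi)" using \<theta>(3) by blast
    then have "v (\<theta> (t + T)) = v (\<theta> t)" "W (\<theta> (t + T)) = W (\<theta> t)"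
      using periodic_shift_int[of v "2 * pi", OF v(2)] periodic_shift_int[of W "2 * pi", OF perW] by simp_all
    then show ?thesis by (simp add: m_def D_def V(2))
  qed
  obtain s where s: "m' s = 0" "\<And>t. m t \<le> m s"
    by (rule periodic_extrema[of m T m', OF perm V(3) m']) blast
  have "D s = 0"
  proof (rule ccontr)
    assume D: "D s \<noteq> 0"
    have "bb * (D s)\<^sup>2 + D s * d\<Psi> s = 0" using s(1) e \<theta>(2)[of s] by (simp add: m'_def)
    then have "\<bar>bb\<bar> * (D s)\<^sup>2 = \<bar>D s\<bar> * \<bar>d\<Psi> s\<bar>"
      by (metis abs_minus_cancel abs_mult abs_power2 add_eq_0_iff)
    also have "\<dots> \<le> \<bar>D s\<bar> * (M * e * \<bar>D s\<bar>)"
      unfolding d\<Psi>_def D_def by (intro mult_left_mono lip V v) auto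
    also have "\<dots> = M * e * (D s)\<^sup>2" by (simp add: power2_eq_square)
    finally show False using e(2) D by simp
  qed
  then have "m t \<le> 0" using s(2)[of t] by (simp add: m_def)
  then have "(D t)\<^sup>2 \<le> 0" unfolding m_def using exp_gt_zero by (simp add: mult_le_0_iff not_le[symmetric])
  then show ?thesis by (simp add: D_def)
qed

text \<open>A derivative bounded below by \<open>k > 0\<close> makes \<open>f\<close> a bijection
  with \<open>1 / k\<close>-Lipschitz inverse. It turns time as a function of the angle into the
  angle as a function of time, and shows that the angle along a closed orbit takes every
  value.\<close>

lemma increasing_inverse:
  fixes f :: "real \<Rightarrow> real"
  assumes f': "\<And>t. (f has_real_derivative f' t) (at t)" and k: "0 < k" "\<And>t. k \<le> f' t"
  obtains g where "\<And>t. f (g t) = t" "\<And>t. g (f t) = t" "\<And>t. (g has_real_derivative inverse (f' (g t))) (at t)"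
    "\<And>s t. s < t \<Longrightarrow> g s < g t"
proof -
  have mono: "k * (t - s) \<le> f t - f s" if "s \<le> t" for s t
  proof -
    have "((\<lambda>s. f s - k * s) has_real_derivative f' s - k) (at s)" for s
      by (rule derivative_eq_intros f' refl)+ simp
    from nondecreasing_if_deriv_nonneg[of "\<lambda>s. f s - k * s", OF this _ that] k(2)
    have "f s - k * s \<le> f t - k * t" by simp
    then show ?thesis by (simp add: algebra_simps)
  qed
  have strict: "f s < f t" if "s < t" for s t
    using mono[of s t] that k(1) mult_pos_pos[of k "t - s"] by linarith
  have cont: "continuous_on UNIV f" by (rule DERIV_continuous_on) (rule f')
  have surj: "\<exists>s. f s = t" for t
  proof -
    define R where "R = (\<bar>t\<bar> + \<bar>f 0\<bar>) / k"
    have R: "0 \<le> R" "k * R = \<bar>t\<bar> + \<bar>f 0\<bar>" using k by (auto simp: R_def)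
    have "f (- R) \<le> t" "t \<le> f R" using mono[of 0 R] mono[of "- R" 0] R by auto
    moreover have "continuous_on {- R..R} f" using cont by (rule continuous_on_subset) simp
    ultimately obtain s where "f s = t" using IVT'[of f "- R" t R] R(1) by auto
    then show ?thesis by blast
  qed
  define g where "g t = (SOME s. f s = t)" for t
  have fg: "f (g t) = t" for t unfolding g_def by (rule someI_ex[OF surj])
  have inj: "s = t" if "f s = f t" for s t using strict[of s t] strict[of t s] that by (cases s t rule: linorder_cases) auto
  have gf: "g (f t) = t" for t by (rule inj) (rule fg)
  have gs: "g s < g t" if "s < t" for s t
    using strict[of "g t" "g s"] that fg[of s] fg[of t] by (cases "g s" "g t" rule: linorder_cases) auto
  have gl: "\<bar>g s - g t\<bar> \<le> \<bar>s - t\<bar> / k" for s t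
  proof -
    have "k * \<bar>g s - g t\<bar> \<le> \<bar>s - t\<bar>"
      using mono[of "g s" "g t"] mono[of "g t" "g s"] fg by (cases "g s \<le> g t") auto
    then show ?thesis using k by (simp add: field_simps)
  qed
  have gc: "isCont g t" for t
  proof -
    have "(1 / k)-lipschitz_on UNIV g"
      using gl k by (intro lipschitz_onI) (auto simp: dist_real_def)
    from lipschitz_on_continuous_on[OF this] show ?thesis by (simp add: continuous_on_eq_continuous_at)
  qed
  have g': "(g has_real_derivative inverse (f' (g t))) (at t)" for t
  proof (rule DERIV_inverse_function[where a = "t - 1" and b = "t + 1", OF f'])
    show "f' (g t) \<noteq> 0" using k(1) k(2)[of "g t"] by simp
  qed (use fg gc in auto)
  show thesis by (rule that[OF fg gf g' gs])
qed

section \<open>The limit cycle of the planar system\<close>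

text \<open>One constant for the size and for the Lipschitz bound makes the class stable under sums,
  products and reciprocals of functions bounded away from 0, so the estimate of \<open>Psi\<close>
  is put together term by term.\<close>

definition bdd_lipschitz :: "real set \<Rightarrow> real \<Rightarrow> (real \<Rightarrow> real) \<Rightarrow> bool" where
  "bdd_lipschitz S B f \<longleftrightarrow> (\<forall>V\<in>S. \<bar>f V\<bar> \<le> B) \<and> (\<forall>V\<in>S. \<forall>V'\<in>S. \<bar>f V - f V'\<bar> \<le> B * \<bar>V - V'\<bar>)"

lemma bdd_lipschitz_mono: "bdd_lipschitz S B f \<Longrightarrow> B \<le> B' \<Longrightarrow> bdd_lipschitz S B' f"
  unfolding bdd_lipschitz_def by (meson abs_ge_zero mult_right_mono order_trans)

lemma bdd_lipschitz_const: "bdd_lipschitz S \<bar>k\<bar> (\<lambda>_. k)"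
  by (simp add: bdd_lipschitz_def)

lemma bdd_lipschitz_add: assumes "bdd_lipschitz S A f" "bdd_lipschitz S B g" shows "bdd_lipschitz S (A + B) (\<lambda>V. f V + g V)"
  unfolding bdd_lipschitz_def
proof (intro conjI ballI)
  fix V V' assume V: "V \<in> S" "V' \<in> S"
  have "\<bar>f V\<bar> \<le> A" "\<bar>g V\<bar> \<le> B" using assms V by (auto simp: bdd_lipschitz_def)
  then show "\<bar>f V + g V\<bar> \<le> A + B" by linarith
  have "\<bar>f V - f V'\<bar> \<le> A * \<bar>V - V'\<bar>" "\<bar>g V - g V'\<bar> \<le> B * \<bar>V - V'\<bar>"
    using assms V by (auto simp: bdd_lipschitz_def)
  then show "\<bar>f V + g V - (f V' + g V')\<bar> \<le> (A + B) * \<bar>V - V'\<bar>"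
    unfolding distrib_right by linarith
qed

lemma bdd_lipschitz_mult: assumes "bdd_lipschitz S A f" "bdd_lipschitz S B g" shows "bdd_lipschitz S (2 * A * B) (\<lambda>V. f V * g V)"
  unfolding bdd_lipschitz_def
proof (intro conjI ballI)
  fix V V' assume V: "V \<in> S" "V' \<in> S"
  have b: "\<bar>f V\<bar> \<le> A" "\<bar>g V\<bar> \<le> B" "\<bar>g V'\<bar> \<le> B" using assms V by (auto simp: bdd_lipschitz_def)
  then have nn: "0 \<le> A" "0 \<le> B" by linarith+
  have "\<bar>f V * g V\<bar> \<le> A * B" unfolding abs_mult using b nn by (intro mult_mono) auto
  moreover have "0 \<le> A * B" using nn by simp
  ultimately show "\<bar>f V * g V\<bar> \<le> 2 * A * B" by linarith
  have l: "\<bar>f V - f V'\<bar> \<le> A * \<bar>V - V'\<bar>" "\<bar>g V - g V'\<bar> \<le> B * \<bar>V - V'\<bar>"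
    using assms V by (auto simp: bdd_lipschitz_def)
  have "\<bar>f V * (g V - g V')\<bar> \<le> A * (B * \<bar>V - V'\<bar>)" "\<bar>(f V - f V') * g V'\<bar> \<le> (A * \<bar>V - V'\<bar>) * B"
    unfolding abs_mult using b l nn by (intro mult_mono; simp)+
  moreover have "f V * g V - f V' * g V' = f V * (g V - g V') + (f V - f V') * g V'"
    by (simp add: algebra_simps)
  ultimately have "\<bar>f V * g V - f V' * g V'\<bar> \<le> A * (B * \<bar>V - V'\<bar>) + (A * \<bar>V - V'\<bar>) * B" by linarith
  then show "\<bar>f V * g V - f V' * g V'\<bar> \<le> 2 * A * B * \<bar>V - V'\<bar>" by (simp add: algebra_simps)
qed

lemma bdd_lipschitz_cmult: assumes "bdd_lipschitz S B f" "\<bar>k\<bar> \<le> k'" shows "bdd_lipschitz S (k' * B) (\<lambda>V. k * f V)"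
  unfolding bdd_lipschitz_def
proof (intro conjI ballI)
  fix V V' assume V: "V \<in> S" "V' \<in> S"
  show "\<bar>k * f V\<bar> \<le> k' * B" unfolding abs_mult using assms V by (intro mult_mono) (auto simp: bdd_lipschitz_def)
  have "\<bar>k\<bar> * \<bar>f V - f V'\<bar> \<le> k' * (B * \<bar>V - V'\<bar>)" using assms V by (intro mult_mono) (auto simp: bdd_lipschitz_def)
  then show "\<bar>k * f V - k * f V'\<bar> \<le> k' * B * \<bar>V - V'\<bar>"
    by (simp add: right_diff_distrib[symmetric] abs_mult mult.assoc)
qed

lemma bdd_lipschitz_inverse: assumes "bdd_lipschitz S B f" "0 < \<delta>" "\<And>V. V \<in> S \<Longrightarrow> \<delta> \<le> f V"
  shows "bdd_lipschitz S (1 / \<delta> + B / \<delta>\<^sup>2) (\<lambda>V. 1 / f V)"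
  unfolding bdd_lipschitz_def
proof (intro conjI ballI)
  fix V V' assume V: "V \<in> S" "V' \<in> S"
  have f: "\<delta> \<le> f V" "\<delta> \<le> f V'" using assms(3) V by auto
  have B: "0 \<le> B" using assms(1) V unfolding bdd_lipschitz_def by (metis abs_ge_zero order_trans)
  have "\<bar>1 / f V\<bar> \<le> 1 / \<delta>" using f assms(2) by (simp add: frac_le)
  moreover have "0 \<le> B / \<delta>\<^sup>2" using B by simp
  ultimately show "\<bar>1 / f V\<bar> \<le> 1 / \<delta> + B / \<delta>\<^sup>2" by linarith
  have fp: "0 < f V" "0 < f V'" using f assms(2) by linarith+
  have "1 / f V - 1 / f V' = (f V' - f V) / (f V * f V')" using f assms(2) by (simp add: field_simps)
  then have "\<bar>1 / f V - 1 / f V'\<bar> = \<bar>f V - f V'\<bar> / (f V * f V')"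
    using f assms(2) by (simp add: abs_minus_commute)
  also have "\<dots> \<le> (B * \<bar>V - V'\<bar>) / \<delta>\<^sup>2"
    using assms V f fp B unfolding power2_eq_square by (intro frac_le mult_mono) (auto simp: bdd_lipschitz_def)
  also have "\<dots> \<le> (1 / \<delta> + B / \<delta>\<^sup>2) * \<bar>V - V'\<bar>"
    using assms(2) by (simp add: distrib_right)
  finally show "\<bar>1 / f V - 1 / f V'\<bar> \<le> (1 / \<delta> + B / \<delta>\<^sup>2) * \<bar>V - V'\<bar>" .
qed

text \<open>Explicit primitives. The first integral gives the mean of \<open>be\<close>, the other
  two that of \<open>al\<close>; the vanishing third one removes \<open>p\<close> from the
  average.\<close>

lemma antideriv_trig:
  "antideriv (\<lambda>t. (sin t)\<^sup>2) (2 * pi) = pi"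
  "antideriv (\<lambda>t. (sin t)\<^sup>2 * (cos t)\<^sup>2) (2 * pi) = pi / 4"
  "antideriv (\<lambda>t. sin t * cos t ^ 3) (2 * pi) = 0"
proof -
  have s: "(sin t)\<^sup>2 = 1 - (cos t)\<^sup>2" for t :: real by (simp add: sin_squared_eq)
  have "((\<lambda>t. t / 2 - sin t * cos t / 2) has_real_derivative (sin t)\<^sup>2) (at t)" for t :: real
    by (rule derivative_eq_intros refl | simp)+ (simp add: s power2_eq_square[symmetric] field_simps)
  from antideriv_eqI[OF this, of "2 * pi"] show "antideriv (\<lambda>t. (sin t)\<^sup>2) (2 * pi) = pi"
    by (simp add: continuous_intros)
  have "((\<lambda>t. t / 8 - sin t * cos t * (2 * (cos t)\<^sup>2 - 1) / 8) has_real_derivative (sin t)\<^sup>2 * (cos t)\<^sup>2) (at t)" for t :: real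
  proof -
    have "((\<lambda>t. t / 8 - sin t * cos t * (2 * (cos t)\<^sup>2 - 1) / 8) has_real_derivative
      1 / 8 - ((sin t * - sin t + cos t * cos t) * (2 * (cos t)\<^sup>2 - 1) + sin t * cos t * (4 * cos t * - sin t)) / 8) (at t)"
      by (rule derivative_eq_intros refl | simp)+
    moreover have "1 / 8 - ((sin t * - sin t + cos t * cos t) * (2 * (cos t)\<^sup>2 - 1) + sin t * cos t * (4 * cos t * - sin t)) / 8
      = (sin t)\<^sup>2 * (cos t)\<^sup>2"
    proof -
      have "(sin t * - sin t + cos t * cos t) * (2 * (cos t)\<^sup>2 - 1) + sin t * cos t * (4 * cos t * - sin t)
        = ((cos t)\<^sup>2 - (sin t)\<^sup>2) * (2 * (cos t)\<^sup>2 - 1) - 4 * ((sin t)\<^sup>2 * (cos t)\<^sup>2)"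
        by (simp add: power2_eq_square algebra_simps)
      also have "\<dots> = 1 - 8 * ((sin t)\<^sup>2 * (cos t)\<^sup>2)"
        unfolding s by (simp add: power2_eq_square algebra_simps)
      finally have h: "(sin t * - sin t + cos t * cos t) * (2 * (cos t)\<^sup>2 - 1) + sin t * cos t * (4 * cos t * - sin t)
        = 1 - 8 * ((sin t)\<^sup>2 * (cos t)\<^sup>2)" .
      show ?thesis unfolding h by (simp add: diff_divide_distrib)
    qed
    ultimately show ?thesis by simp
  qed
  from antideriv_eqI[OF this, of "2 * pi"] show "antideriv (\<lambda>t. (sin t)\<^sup>2 * (cos t)\<^sup>2) (2 * pi) = pi / 4"
    by (simp add: continuous_intros)
  have "((\<lambda>t. - (cos t ^ 4) / 4) has_real_derivative sin t * cos t ^ 3) (at t)" for t :: real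
    by (rule derivative_eq_intros refl | simp)+
  from antideriv_eqI[OF this, of "2 * pi"] show "antideriv (\<lambda>t. sin t * cos t ^ 3) (2 * pi) = 0"
    by (simp add: continuous_intros)
qed

section \<open>The equation for V in the polar angle\<close>

context planar_hopf
begin

text \<open>In the polar coordinates \<open>x = \<rho> cos \<theta>\<close>, \<open>y = \<rho> sin \<theta>\<close> with \<open>V = e / \<rho>\<^sup>2\<close>, \<open>e = \<bar>m\<bar>\<close> and
  \<open>s = sgn m\<close>, the nonlinear terms are \<open>\<rho> e yy / V\<close>; \<open>dn\<close> is the angular velocity.\<close>

definition yy :: "real \<Rightarrow> real \<Rightarrow> real \<Rightarrow> real \<Rightarrow> real" where
  "yy e s t V = - (p * (cos t)\<^sup>2 + V / e * r1 (e * (cos t)\<^sup>2 / V)) * cos t / \<omega>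
     + (c * (cos t)\<^sup>2 + V / e * r2 (e * (cos t)\<^sup>2 / V)) * sin t + s * V * sin t"

definition dn :: "real \<Rightarrow> real \<Rightarrow> real \<Rightarrow> real \<Rightarrow> real" where
  "dn e s t V = \<omega> + e * (cos t * (yy e s t V * (1 / V)))"

text \<open>\<open>dV / d\<theta>\<close> divided by \<open>e\<close>: along solutions
  \<open>V' = - 2 e yy sin \<theta>\<close> and \<open>\<theta>' = dn\<close>.\<close>

definition Phi :: "real \<Rightarrow> real \<Rightarrow> real \<Rightarrow> real \<Rightarrow> real" where
  "Phi e s t V = - 2 * sin t * (yy e s t V * (1 / dn e s t V))"

text \<open>The part independent of \<open>V\<close> in the limit of \<open>Phi\<close> as
  \<open>e\<close> tends to 0; \<open>be\<close> is the coefficient of \<open>V\<close> in that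
  limit.\<close>

definition al :: "real \<Rightarrow> real" where
  "al t = sin t * cos t ^ 3 * (2 * p / \<omega>\<^sup>2) - (sin t)\<^sup>2 * (cos t)\<^sup>2 * (2 * c / \<omega>)"

definition be :: "real \<Rightarrow> real \<Rightarrow> real" where
  "be s t = (sin t)\<^sup>2 * (- 2 * s / \<omega>)"

definition Psi :: "real \<Rightarrow> real \<Rightarrow> real \<Rightarrow> real \<Rightarrow> real" where
  "Psi e s t V = Phi e s t V - (al t + be s t * V)"

lemma nonlinear_polar:
  assumes "0 < e" "0 < V" "\<rho>\<^sup>2 = e / V"
  shows "n3 (\<rho> * cos t) (\<rho> * sin t) + n5 (\<rho> * cos t) (\<rho> * sin t) + s * e * (\<rho> * sin t) = \<rho> * e * yy e s t V / V"
proof -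
  have q: "(\<rho> * cos t)\<^sup>2 = e * (cos t)\<^sup>2 / V" by (simp add: power_mult_distrib assms(3))
  have A: "n3 (\<rho> * cos t) (\<rho> * sin t) = \<rho> * (- (p / \<omega>) * ((\<rho> * cos t)\<^sup>2 * cos t) + c * (\<rho> * cos t)\<^sup>2 * sin t)"
    by (simp add: n3_def power3_eq_cube power2_eq_square algebra_simps)
  have B: "n5 (\<rho> * cos t) (\<rho> * sin t) = \<rho> * (- (1 / \<omega>) * r1 ((\<rho> * cos t)\<^sup>2) * cos t + r2 ((\<rho> * cos t)\<^sup>2) * sin t)"
    by (simp add: n5_def algebra_simps)
  have C: "e * yy e s t V / V = - (p / \<omega>) * (e * (cos t)\<^sup>2 / V * cos t) + c * (e * (cos t)\<^sup>2 / V) * sin t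
     + (- (1 / \<omega>) * r1 (e * (cos t)\<^sup>2 / V) * cos t + r2 (e * (cos t)\<^sup>2 / V) * sin t) + s * e * sin t"
    using assms(1,2) \<omega>_pos by (simp add: yy_def field_simps)
  have "\<rho> * e * yy e s t V / V = \<rho> * (e * yy e s t V / V)" by simp
  then show ?thesis unfolding C A[unfolded q] B[unfolded q] by (simp add: algebra_simps)
qed

text \<open>The averaged equilibrium is \<open>|c| / 4\<close>, that is
  \<open>\<rho>^2 = 4 |m| / |c|\<close>; the window from \<open>Vl\<close> to \<open>Vu\<close>
  leaves a factor 2 on either side.\<close>

definition Vl :: real where "Vl = \<bar>c\<bar> / 8"
definition Vu :: real where "Vu = \<bar>c\<bar> / 2"

lemma Vl_pos: "0 < Vl" "Vl < Vu" using c_nz by (auto simp: Vl_def Vu_def)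

text \<open>\<open>r\<close> is quadratically small in its argument, which is proportional to
  \<open>e\<close>; after the division by \<open>e\<close> one factor \<open>e\<close>
  remains.\<close>

lemma bdd_lipschitz_remainder:
  obtains k where "0 \<le> k" "\<And>e t r. 0 < e \<Longrightarrow> e < Vl * d \<Longrightarrow> r = r1 \<or> r = r2 \<Longrightarrow>
     bdd_lipschitz {Vl..Vu} (e * k) (\<lambda>V. V / e * r (e * (cos t)\<^sup>2 / V))"
proof -
  \<comment> \<open>The first summand is for the size, the other two for the Lipschitz bound:
    variation of the prefactor \<open>V / e\<close>, and variation of the argument of
    \<open>r\<close>.\<close>
  define k where "k = K / Vl + (K / Vl\<^sup>2 + Vu * (K / Vl ^ 3))"
  have nn: "0 \<le> K / Vl" "0 \<le> K / Vl\<^sup>2" "0 \<le> Vu * (K / Vl ^ 3)" using K_nonneg Vl_pos by auto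
  have "bdd_lipschitz {Vl..Vu} (e * k) (\<lambda>V. V / e * r (e * (cos t)\<^sup>2 / V))"
    if e: "0 < e" "e < Vl * d" and r: "r = r1 \<or> r = r2" for e t r
  proof -
    have lip: "\<bar>r u - r v\<bar> \<le> K * max \<bar>u\<bar> \<bar>v\<bar> * \<bar>u - v\<bar>" if "\<bar>u\<bar> < d" "\<bar>v\<bar> < d" for u v
      using r r1_lip[OF that] r2_lip[OF that] by auto
    have bd: "\<bar>r u\<bar> \<le> K * u\<^sup>2" if "\<bar>u\<bar> < d" for u
      using r r1_bound[OF that] r2_bound[OF that] by auto
    have c2: "0 \<le> (cos t)\<^sup>2" "(cos t)\<^sup>2 \<le> 1" by (auto simp: abs_square_le_1)
    have u: "0 \<le> e * (cos t)\<^sup>2 / V" "e * (cos t)\<^sup>2 / V \<le> e / V" "e / V \<le> e / Vl" "e / Vl < d"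
      if "V \<in> {Vl..Vu}" for V
      using that e c2 Vl_pos by (auto simp: divide_right_mono mult_left_le frac_le pos_divide_less_eq mult.commute)
    have ud: "\<bar>e * (cos t)\<^sup>2 / V\<bar> < d" if "V \<in> {Vl..Vu}" for V using u[OF that] by linarith
    show ?thesis unfolding bdd_lipschitz_def
    proof (intro conjI ballI)
      fix V V' assume V: "V \<in> {Vl..Vu}" "V' \<in> {Vl..Vu}"
      have Vp: "0 < V" "0 < V'" "Vl \<le> V" "Vl \<le> V'" "V' \<le> Vu" using V Vl_pos by auto
      define U U' where "U = e * (cos t)\<^sup>2 / V" and "U' = e * (cos t)\<^sup>2 / V'"
      have U: "0 \<le> U" "U \<le> e / V" "U \<le> e / Vl" "0 \<le> U'" "U' \<le> e / Vl" "\<bar>U\<bar> < d" "\<bar>U'\<bar> < d"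
        using u[OF V(1)] u[OF V(2)] ud[OF V(1)] ud[OF V(2)] by (auto simp: U_def U'_def)
      have "\<bar>r U\<bar> \<le> K * (e / V)\<^sup>2"
        using bd[OF U(6)] power_mono[OF U(2,1), of 2] K_nonneg mult_left_mono order_trans by blast
      then have "V / e * \<bar>r U\<bar> \<le> V / e * (K * (e / V)\<^sup>2)" using Vp e by (intro mult_left_mono) auto
      also have "\<dots> = e * (K / V)" using Vp e by (simp add: power2_eq_square)
      also have "\<dots> \<le> e * k"
      proof (rule mult_left_mono)
        have "K / V \<le> K / Vl" using Vp Vl_pos K_nonneg by (intro frac_le) auto
        then show "K / V \<le> k" unfolding k_def using nn by linarith
      qed (use e in simp)
      finally show "\<bar>V / e * r (e * (cos t)\<^sup>2 / V)\<bar> \<le> e * k"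
        using Vp e by (simp add: abs_mult U_def)
      have rU: "\<bar>r U\<bar> \<le> K * (e / Vl)\<^sup>2"
        using bd[OF U(6)] power_mono[OF U(3,1), of 2] K_nonneg mult_left_mono order_trans by blast
      have "\<bar>(V - V') / e * r U\<bar> \<le> \<bar>V - V'\<bar> / e * (K * (e / Vl)\<^sup>2)"
        using rU e by (simp add: abs_mult divide_right_mono mult_left_mono)
      also have "\<dots> = e * (K / Vl\<^sup>2) * \<bar>V - V'\<bar>" using e by (simp add: power2_eq_square)
      finally have 1: "\<bar>(V - V') / e * r U\<bar> \<le> e * (K / Vl\<^sup>2) * \<bar>V - V'\<bar>" .
      have "U - U' = e * (cos t)\<^sup>2 * ((V' - V) / (V * V'))" using Vp by (simp add: U_def U'_def field_simps)
      then have "\<bar>U - U'\<bar> = e * (cos t)\<^sup>2 * (\<bar>V - V'\<bar> / (V * V'))"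
        using Vp e by (simp add: abs_mult abs_minus_commute)
      also have "\<dots> \<le> e * 1 * (\<bar>V - V'\<bar> / (Vl * Vl))"
        using Vp e c2 Vl_pos by (intro mult_mono frac_le) auto
      finally have dU: "\<bar>U - U'\<bar> \<le> e * \<bar>V - V'\<bar> / Vl\<^sup>2" by (simp add: power2_eq_square)
      have "\<bar>r U - r U'\<bar> \<le> K * (e / Vl) * (e * \<bar>V - V'\<bar> / Vl\<^sup>2)"
        using lip[OF U(6,7)] dU U K_nonneg e Vl_pos
        by (intro order_trans[OF lip[OF U(6,7)]] mult_mono) auto
      then have "V' / e * \<bar>r U - r U'\<bar> \<le> Vu / e * (K * (e / Vl) * (e * \<bar>V - V'\<bar> / Vl\<^sup>2))"
        using Vp e by (intro mult_mono divide_right_mono) auto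
      also have "\<dots> = e * (Vu * (K / Vl ^ 3)) * \<bar>V - V'\<bar>"
        using e Vl_pos by (simp add: power2_eq_square power3_eq_cube field_simps)
      finally have 2: "\<bar>V' / e * (r U - r U')\<bar> \<le> e * (Vu * (K / Vl ^ 3)) * \<bar>V - V'\<bar>"
        using Vp e by (simp add: abs_mult)
      have "V / e * r U - V' / e * r U' = (V - V') / e * r U + V' / e * (r U - r U')"
        by (simp add: algebra_simps diff_divide_distrib)
      then have "\<bar>V / e * r U - V' / e * r U'\<bar> \<le> (e * (K / Vl\<^sup>2) + e * (Vu * (K / Vl ^ 3))) * \<bar>V - V'\<bar>"
        unfolding distrib_right using 1 2 by linarith
      also have "\<dots> \<le> e * k * \<bar>V - V'\<bar>"
        using mult_nonneg_nonneg[OF less_imp_le[OF e(1)] nn(1)]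
        unfolding k_def distrib_left by (intro mult_right_mono) auto
      finally show "\<bar>V / e * r (e * (cos t)\<^sup>2 / V) - V' / e * r (e * (cos t)\<^sup>2 / V')\<bar> \<le> e * k * \<bar>V - V'\<bar>"
        by (simp add: U_def U'_def)
    qed
  qed
  then show thesis using nn by (intro that[of k]) (auto simp: k_def)
qed

lemma Psi_bounds:
  obtains e1 k M where "0 < e1" "e1 \<le> 1" "e1 \<le> Vl * d" "0 \<le> k" "0 \<le> M"
    "\<And>e s t V. 0 < e \<Longrightarrow> e < e1 \<Longrightarrow> \<bar>s\<bar> = 1 \<Longrightarrow> V \<in> {Vl..Vu} \<Longrightarrow> \<bar>dn e s t V - \<omega>\<bar> \<le> k * e"
    "\<And>e s t V. 0 < e \<Longrightarrow> e < e1 \<Longrightarrow> \<bar>s\<bar> = 1 \<Longrightarrow> V \<in> {Vl..Vu} \<Longrightarrow> \<omega> / 2 \<le> dn e s t V \<and> dn e s t V \<le> 2 * \<omega>"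
    "\<And>e s t. 0 < e \<Longrightarrow> e < e1 \<Longrightarrow> \<bar>s\<bar> = 1 \<Longrightarrow> bdd_lipschitz {Vl..Vu} (M * e) (Psi e s t)"
proof -
  let ?I = "{Vl..Vu}"
  obtain k where k: "0 \<le> k" "\<And>e t r. 0 < e \<Longrightarrow> e < Vl * d \<Longrightarrow> r = r1 \<or> r = r2 \<Longrightarrow>
     bdd_lipschitz ?I (e * k) (\<lambda>V. V / e * r (e * (cos t)\<^sup>2 / V))" by (rule bdd_lipschitz_remainder) blast
  have trig: "\<bar>sin t\<bar> \<le> 1" "\<bar>cos t\<bar> \<le> 1" "\<bar>cos t / \<omega>\<bar> \<le> 1 / \<omega>" for t
    using \<omega>_pos by (auto simp: divide_right_mono)
  have c2: "\<bar>(cos t)\<^sup>2\<bar> \<le> 1" for t :: real by (simp add: abs_square_le_1)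
  \<comment> \<open>One constant per building block: \<open>k'\<close> for \<open>dy / e\<close>,
    \<open>k0\<close> for \<open>y0\<close>, \<open>ki\<close> for \<open>1 / V\<close>,
    \<open>k1\<close> for \<open>(dn - \<omega>) / e\<close>, \<open>k2\<close> for
    \<open>1 / dn\<close>, and \<open>M\<close> for \<open>Psi / e\<close>.\<close>
  define k' where "k' = 1 / \<omega> * k + 1 * k"
  define k0 where "k0 = \<bar>p\<bar> / \<omega> + \<bar>c\<bar> + 1 * (Vu + 1)"
  define ki where "ki = 1 / Vl + (Vu + 1) / Vl\<^sup>2"
  define k1 where "k1 = 1 * (2 * (k0 + k') * ki)"
  define k2 where "k2 = 1 / (\<omega> / 2) + (\<omega> + k1) / (\<omega> / 2)\<^sup>2"
  define k3 where "k3 = 2 * k' * k2 + 1 / \<omega> * (2 * (2 * k0 * k1) * k2)"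
  define M where "M = 2 * k3"
  have nn: "0 \<le> k'" "0 \<le> k0" "0 \<le> ki" using k(1) \<omega>_pos Vl_pos by (auto simp: k'_def k0_def ki_def)
  have nn1: "0 \<le> k1" using nn by (auto simp: k1_def)
  have nn2: "0 \<le> k2" using nn1 \<omega>_pos by (auto simp: k2_def)
  have nn3: "0 \<le> M" using nn nn1 nn2 \<omega>_pos by (auto simp: k3_def M_def)
  \<comment> \<open>The last bound keeps the angular velocity within \<open>\<omega> / 2\<close> of
    \<omega>.\<close>
  define e1 where "e1 = min 1 (min (Vl * d) (\<omega> / (2 * (k1 + 1))))"
  have e1: "0 < e1" "e1 \<le> 1" "e1 \<le> Vl * d" "e1 \<le> \<omega> / (2 * (k1 + 1))"
    using Vl_pos d_pos \<omega>_pos nn1 by (auto simp: e1_def)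
  \<comment> \<open>\<open>y0\<close> is \<open>yy\<close> without the remainders \<open>r1\<close>
    and \<open>r2\<close>; \<open>dy\<close> collects these and is of order
    \<open>e\<close>.\<close>
  define y0 where "y0 s t V = (- p * (cos t)\<^sup>2 * (cos t / \<omega>) + c * (cos t)\<^sup>2 * sin t) + (s * sin t) * V" for s t V
  define dy where "dy e t V = (- (cos t / \<omega>)) * (V / e * r1 (e * (cos t)\<^sup>2 / V)) + sin t * (V / e * r2 (e * (cos t)\<^sup>2 / V))" for e t V
  \<comment> \<open>\<open>Vu + 1\<close> dominates both the size \<open>Vu\<close> and the
    Lipschitz constant 1.\<close>
  have BLid: "bdd_lipschitz ?I (Vu + 1) (\<lambda>V. V)"
  proof (unfold bdd_lipschitz_def, intro conjI ballI)
    fix V V' assume "V \<in> ?I"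
    then show "\<bar>V\<bar> \<le> Vu + 1" using Vl_pos by auto
    show "\<bar>V - V'\<bar> \<le> (Vu + 1) * \<bar>V - V'\<bar>" using Vl_pos by (simp add: distrib_right)
  qed
  have props: "V \<in> ?I \<Longrightarrow> \<bar>dn e s t V - \<omega>\<bar> \<le> k1 * e \<and> \<omega> / 2 \<le> dn e s t V \<and> dn e s t V \<le> 2 * \<omega>"
    and props2: "bdd_lipschitz ?I (M * e) (Psi e s t)"
    if e: "0 < e" "e < e1" and s: "\<bar>s\<bar> = 1" for e s t V
  proof -
    have ed: "e < Vl * d" "e \<le> 1" using e e1 by linarith+
    have y: "yy e s t V = y0 s t V + dy e t V" for V
      by (simp add: yy_def y0_def dy_def algebra_simps add_divide_distrib diff_divide_distrib)
    have bdy: "bdd_lipschitz ?I (e * k') (dy e t)"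
    proof -
      have "bdd_lipschitz ?I (1 / \<omega> * (e * k) + 1 * (e * k)) (dy e t)"
        unfolding dy_def using trig[of t]
        by (intro bdd_lipschitz_add bdd_lipschitz_cmult k(2)) (use e ed in auto)
      then show ?thesis by (simp add: k'_def distrib_left mult_ac)
    qed
    have by0: "bdd_lipschitz ?I k0 (y0 s t)"
    proof -
      have "\<bar>- p * (cos t)\<^sup>2 * (cos t / \<omega>) + c * (cos t)\<^sup>2 * sin t\<bar> \<le> \<bar>p\<bar> / \<omega> + \<bar>c\<bar>"
      proof -
        have "\<bar>- p * (cos t)\<^sup>2 * (cos t / \<omega>)\<bar> \<le> \<bar>p\<bar> * 1 * (1 / \<omega>)"
          unfolding abs_mult abs_minus_cancel using trig(3)[of t] c2[of t] \<omega>_pos by (intro mult_mono) auto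
        then have "\<bar>- p * (cos t)\<^sup>2 * (cos t / \<omega>)\<bar> \<le> \<bar>p\<bar> / \<omega>" by (simp only: mult_1_right times_divide_eq_right)
        moreover have "\<bar>c * (cos t)\<^sup>2 * sin t\<bar> \<le> \<bar>c\<bar> * 1 * 1"
          unfolding abs_mult using trig(1)[of t] c2[of t] by (intro mult_mono) auto
        ultimately show ?thesis
          using abs_triangle_ineq[of "- p * (cos t)\<^sup>2 * (cos t / \<omega>)" "c * (cos t)\<^sup>2 * sin t"] by linarith
      qed
      moreover have "\<bar>s * sin t\<bar> \<le> 1" using s trig(1)[of t] by (simp add: abs_mult)
      ultimately show ?thesis unfolding y0_def k0_def
        by (intro bdd_lipschitz_add bdd_lipschitz_cmult BLid bdd_lipschitz_mono[OF bdd_lipschitz_const])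
    qed
    have byy: "bdd_lipschitz ?I (k0 + k') (yy e s t)"
    proof -
      have "bdd_lipschitz ?I (k0 + e * k') (yy e s t)" unfolding y[abs_def] by (rule bdd_lipschitz_add[OF by0 bdy])
      then show ?thesis by (rule bdd_lipschitz_mono) (use nn ed in \<open>simp add: mult_left_le_one_le e less_imp_le\<close>)
    qed
    have biV: "bdd_lipschitz ?I ki (\<lambda>V. 1 / V)" unfolding ki_def by (rule bdd_lipschitz_inverse[OF BLid Vl_pos(1)]) auto
    have bE: "bdd_lipschitz ?I k1 (\<lambda>V. cos t * (yy e s t V * (1 / V)))"
      unfolding k1_def by (intro bdd_lipschitz_cmult bdd_lipschitz_mult byy biV trig)
    have bE': "\<bar>cos t * (yy e s t V * (1 / V))\<bar> \<le> k1" if "V \<in> ?I" for V using bE that by (auto simp: bdd_lipschitz_def)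
    have dn1: "\<bar>dn e s t V - \<omega>\<bar> \<le> k1 * e" if "V \<in> ?I" for V
      using mult_left_mono[OF bE'[OF that], of e] e by (simp add: dn_def abs_mult mult.commute)
    have ke: "k1 * e \<le> \<omega> / 2"
    proof -
      have "k1 * e \<le> (k1 + 1) * (\<omega> / (2 * (k1 + 1)))" using e e1 nn1 by (intro mult_mono) auto
      also have "\<dots> = \<omega> / 2" using nn1 by (simp add: field_simps)
      finally show ?thesis .
    qed
    have dn2: "\<omega> / 2 \<le> dn e s t V \<and> dn e s t V \<le> 2 * \<omega>" if "V \<in> ?I" for V
      using dn1[OF that] ke \<omega>_pos unfolding abs_le_iff by linarith
    show "\<bar>dn e s t V - \<omega>\<bar> \<le> k1 * e \<and> \<omega> / 2 \<le> dn e s t V \<and> dn e s t V \<le> 2 * \<omega>" if "V \<in> ?I"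
      using dn1[OF that] dn2[OF that] by blast
    have bdn: "bdd_lipschitz ?I (\<omega> + k1) (dn e s t)"
    proof -
      have "bdd_lipschitz ?I (\<bar>\<omega>\<bar> + 1 * k1) (dn e s t)" unfolding dn_def[abs_def]
        by (intro bdd_lipschitz_add bdd_lipschitz_const bdd_lipschitz_cmult bE) (use e ed in auto)
      then show ?thesis using \<omega>_pos by simp
    qed
    have bid: "bdd_lipschitz ?I k2 (\<lambda>V. 1 / dn e s t V)"
      unfolding k2_def using \<omega>_pos dn2 by (intro bdd_lipschitz_inverse[OF bdn]) auto
    \<comment> \<open>Replacing \<open>1 / dn\<close> by \<open>1 / \<omega>\<close> in the
      \<open>y0\<close> part costs a term with the explicit factor \<open>- e / \<omega>\<close>,
      and the other term has the factor \<open>dy\<close>: both are of order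
      \<open>e\<close>.\<close>
    have Psi_eq: "Psi e s t V = (- 2 * sin t) * (dy e t V * (1 / dn e s t V)
       + (- e / \<omega>) * ((y0 s t V * (cos t * (yy e s t V * (1 / V)))) * (1 / dn e s t V)))" if "V \<in> ?I" for V
    proof -
      have D: "dn e s t V \<noteq> 0" using dn2[OF that] \<omega>_pos by auto
      define E where "E = cos t * (yy e s t V * (1 / V))"
      have DE: "dn e s t V = \<omega> + e * E" by (simp add: dn_def E_def)
      have ab: "al t + be s t * V = - 2 * sin t * (y0 s t V / \<omega>)"
        using \<omega>_pos by (simp add: al_def be_def y0_def field_simps power2_eq_square power3_eq_cube)
      have "(y0 s t V + dy e t V) * (1 / dn e s t V) - y0 s t V / \<omega> = dy e t V * (1 / dn e s t V) + (- e / \<omega>) * ((y0 s t V * E) * (1 / dn e s t V))"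
      proof -
        have "1 / dn e s t V - 1 / \<omega> = (\<omega> - dn e s t V) / (dn e s t V * \<omega>)"
          using D \<omega>_pos by (simp add: field_simps)
        also have "\<dots> = (- e / \<omega>) * (E * (1 / dn e s t V))" by (simp add: DE)
        finally have h: "1 / dn e s t V - 1 / \<omega> = (- e / \<omega>) * (E * (1 / dn e s t V))" .
        have "y0 s t V * (1 / dn e s t V) - y0 s t V / \<omega> = y0 s t V * (1 / dn e s t V - 1 / \<omega>)"
          by (simp add: right_diff_distrib)
        then have "y0 s t V * (1 / dn e s t V) - y0 s t V / \<omega> = (- e / \<omega>) * ((y0 s t V * E) * (1 / dn e s t V))"
          unfolding h by simp
        then show ?thesis unfolding distrib_right by linarith
      qed
      then have "Psi e s t V = - 2 * sin t * (dy e t V * (1 / dn e s t V) + (- e / \<omega>) * ((y0 s t V * E) * (1 / dn e s t V)))"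
        unfolding Psi_def Phi_def ab y by (simp only: right_diff_distrib[symmetric])
      then show ?thesis by (simp add: E_def)
    qed
    have "bdd_lipschitz ?I (2 * (2 * (e * k') * k2 + e / \<omega> * (2 * (2 * k0 * k1) * k2)))
      (\<lambda>V. (- 2 * sin t) * (dy e t V * (1 / dn e s t V)
       + (- e / \<omega>) * ((y0 s t V * (cos t * (yy e s t V * (1 / V)))) * (1 / dn e s t V))))"
      by (intro bdd_lipschitz_cmult bdd_lipschitz_add bdd_lipschitz_mult bdy bid by0 bE) (use trig(1)[of t] e \<omega>_pos in \<open>auto simp: abs_mult\<close>)
    then have "bdd_lipschitz ?I (M * e) (\<lambda>V. (- 2 * sin t) * (dy e t V * (1 / dn e s t V)
       + (- e / \<omega>) * ((y0 s t V * (cos t * (yy e s t V * (1 / V)))) * (1 / dn e s t V))))"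
      by (simp add: M_def k3_def distrib_left distrib_right mult_ac)
    then show "bdd_lipschitz ?I (M * e) (Psi e s t)" unfolding bdd_lipschitz_def using Psi_eq by simp
  qed
  show thesis
  proof (rule that[OF e1(1-3) nn1 nn3])
    fix e s t :: real assume "0 < e" "e < e1" "\<bar>s\<bar> = 1"
    then show "bdd_lipschitz ?I (M * e) (Psi e s t)" by (rule props2)
  qed (use props in blast)+
qed

lemma continuous_on_remainder: "continuous_on {-d<..<d} r1" "continuous_on {-d<..<d} r2"
proof -
  have "(K * d)-lipschitz_on {-d<..<d} r"
    if lip: "\<And>u v. \<bar>u\<bar> < d \<Longrightarrow> \<bar>v\<bar> < d \<Longrightarrow> \<bar>r u - r v\<bar> \<le> K * max \<bar>u\<bar> \<bar>v\<bar> * \<bar>u - v\<bar>" for r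
  proof (rule lipschitz_onI)
    fix u v assume "u \<in> {-d<..<d}" "v \<in> {-d<..<d}"
    then have uv: "\<bar>u\<bar> < d" "\<bar>v\<bar> < d" by auto
    then have "K * max \<bar>u\<bar> \<bar>v\<bar> * \<bar>u - v\<bar> \<le> K * d * \<bar>u - v\<bar>"
      using K_nonneg by (intro mult_right_mono mult_left_mono) auto
    then show "dist (r u) (r v) \<le> K * d * dist u v" using lip[OF uv] by (simp add: dist_real_def)
  qed (use K_nonneg d_pos in auto)
  then show "continuous_on {-d<..<d} r1" "continuous_on {-d<..<d} r2"
    using r1_lip r2_lip lipschitz_on_continuous_on by blast+
qed

lemma continuous_on_yy:
  assumes e: "0 < e" "e < Vl * d" and v: "continuous_on UNIV v" "\<And>t. v t \<in> {Vl..Vu}"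
  shows "continuous_on UNIV (\<lambda>t. yy e s t (v t))"
proof -
  have vp: "0 < v t" "Vl \<le> v t" for t using v(2)[of t] Vl_pos by auto
  have vn: "v t \<noteq> 0" for t using vp(1)[of t] by simp
  have u: "continuous_on UNIV (\<lambda>t. e * (cos t)\<^sup>2 / v t)"
    by (intro continuous_intros v) (use vn in auto)
  have ud: "e * (cos t)\<^sup>2 / v t \<in> {-d<..<d}" for t
  proof -
    have "e * (cos t)\<^sup>2 / v t \<le> e * 1 / Vl"
      using e vp Vl_pos by (intro frac_le mult_left_mono) (auto simp: abs_square_le_1)
    also have "\<dots> < d" using e Vl_pos by (simp add: pos_divide_less_eq mult.commute)
    finally have "e * (cos t)\<^sup>2 / v t < d" .
    moreover have "0 \<le> e * (cos t)\<^sup>2 / v t" using e vp(1)[of t] by simp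
    ultimately show ?thesis using d_pos unfolding greaterThanLessThan_iff by linarith
  qed
  have r: "continuous_on UNIV (\<lambda>t. r1 (e * (cos t)\<^sup>2 / v t))" "continuous_on UNIV (\<lambda>t. r2 (e * (cos t)\<^sup>2 / v t))"
    by (rule continuous_on_compose2[OF continuous_on_remainder(1) u] continuous_on_compose2[OF continuous_on_remainder(2) u];
        use ud in blast)+
  show ?thesis unfolding yy_def
    by (intro continuous_intros r v) (use e \<omega>_pos in auto)
qed

text \<open>\<open>T\<close> is an arbitrary period, because uniqueness concerns the orbit as a set.
  The confined quotient is the variable \<open>V\<close>.\<close>

definition annular :: "real \<Rightarrow> (real \<Rightarrow> real) \<Rightarrow> (real \<Rightarrow> real) \<Rightarrow> real \<Rightarrow> bool" where
  "annular m x y T \<longleftrightarrow> sol m UNIV x y \<and> 0 < T \<and> (\<forall>t. x (t + T) = x t \<and> y (t + T) = y t) \<and>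
     (\<forall>t. Complex (x t) (y t) \<noteq> 0 \<and> \<bar>m\<bar> / (cmod (Complex (x t) (y t)))\<^sup>2 \<in> {Vl..Vu})"

text \<open>Minimal period, frequency and uniqueness are bundled, so that one choice of
  \<open>x\<close>, \<open>y\<close>, \<open>T\<close> per parameter carries all of them.\<close>

definition cycle :: "real \<Rightarrow> real \<Rightarrow> (real \<Rightarrow> real) \<Rightarrow> (real \<Rightarrow> real) \<Rightarrow> real \<Rightarrow> bool" where
  "cycle k m x y T \<longleftrightarrow> annular m x y T \<and> (\<forall>s. 0 < s \<and> s < T \<longrightarrow> (x s, y s) \<noteq> (x 0, y 0)) \<and>
     \<bar>2 * pi / T - \<omega>\<bar> \<le> k * \<bar>m\<bar> \<and>
     (\<forall>x' y' T'. annular m x' y' T' \<longrightarrow> range (\<lambda>t. (x' t, y' t)) = range (\<lambda>t. (x t, y t)))"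

lemma planar_limit_cycle:
  obtains e0 k where "0 < e0" "0 \<le> k"
    "\<And>m. \<bar>m\<bar> < e0 \<Longrightarrow> m * c < 0 \<Longrightarrow> \<exists>x y T. cycle k m x y T"
proof -
  obtain e1 k M where e1: "0 < e1" "e1 \<le> 1" "e1 \<le> Vl * d" and k: "0 \<le> k" and M: "0 \<le> M"
    and dn: "\<And>e s t V. 0 < e \<Longrightarrow> e < e1 \<Longrightarrow> \<bar>s\<bar> = 1 \<Longrightarrow> V \<in> {Vl..Vu} \<Longrightarrow> \<bar>dn e s t V - \<omega>\<bar> \<le> k * e"
    and dn2: "\<And>e s t V. 0 < e \<Longrightarrow> e < e1 \<Longrightarrow> \<bar>s\<bar> = 1 \<Longrightarrow> V \<in> {Vl..Vu} \<Longrightarrow> \<omega> / 2 \<le> dn e s t V \<and> dn e s t V \<le> 2 * \<omega>"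
    and PB: "\<And>e s t. 0 < e \<Longrightarrow> e < e1 \<Longrightarrow> \<bar>s\<bar> = 1 \<Longrightarrow> bdd_lipschitz {Vl..Vu} (M * e) (Psi e s t)"
    by (rule Psi_bounds) blast
  \<comment> \<open>The sign of \<open>m\<close> on the side \<open>m c < 0\<close>, so that
    \<open>m = s e\<close> there.\<close>
  define s where "s = - sgn c"
  have s: "\<bar>s\<bar> = 1" "s * s = 1" "c * s = - \<bar>c\<bar>" using c_nz by (auto simp: s_def sgn_if)
  define A where "A = \<bar>2 * p / \<omega>\<^sup>2\<bar> + \<bar>2 * c / \<omega>\<bar> + \<bar>- 2 * s / \<omega>\<bar>"
  have A: "0 \<le> A" by (simp add: A_def)
  have sc: "\<bar>sin t * cos t ^ 3\<bar> \<le> 1" "\<bar>(sin t)\<^sup>2 * (cos t)\<^sup>2\<bar> \<le> 1" "\<bar>(sin t)\<^sup>2\<bar> \<le> 1" for t :: real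
  proof -
    have "\<bar>sin t\<bar> * \<bar>cos t\<bar> ^ 3 \<le> 1 * 1 ^ 3" by (intro mult_mono power_mono) auto
    then show "\<bar>sin t * cos t ^ 3\<bar> \<le> 1" by (simp add: abs_mult power_abs)
    have "(sin t)\<^sup>2 * (cos t)\<^sup>2 \<le> 1 * 1" by (intro mult_mono) (auto simp: abs_square_le_1)
    then show "\<bar>(sin t)\<^sup>2 * (cos t)\<^sup>2\<bar> \<le> 1" by simp
    show "\<bar>(sin t)\<^sup>2\<bar> \<le> 1" by (simp add: abs_square_le_1)
  qed
  have al: "continuous_on UNIV al" "\<And>t. al (t + 2 * pi) = al t" "\<And>t. \<bar>al t\<bar> \<le> A"
  proof -
    show "continuous_on UNIV al" unfolding al_def[abs_def] by (intro continuous_intros)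
    show "al (t + 2 * pi) = al t" for t by (simp add: al_def)
    fix t
    have "\<bar>sin t * cos t ^ 3 * (2 * p / \<omega>\<^sup>2)\<bar> \<le> 1 * \<bar>2 * p / \<omega>\<^sup>2\<bar>"
      unfolding abs_mult[of "sin t * cos t ^ 3"] using sc(1) by (rule mult_right_mono) simp
    moreover have "\<bar>(sin t)\<^sup>2 * (cos t)\<^sup>2 * (2 * c / \<omega>)\<bar> \<le> 1 * \<bar>2 * c / \<omega>\<bar>"
      unfolding abs_mult[of "(sin t)\<^sup>2 * (cos t)\<^sup>2"] using sc(2) by (rule mult_right_mono) simp
    ultimately show "\<bar>al t\<bar> \<le> A" unfolding al_def A_def by linarith
  qed
  have be: "continuous_on UNIV (be s)" "\<And>t. be s (t + 2 * pi) = be s t" "\<And>t. \<bar>be s t\<bar> \<le> A"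
  proof -
    show "continuous_on UNIV (be s)" unfolding be_def[abs_def] by (intro continuous_intros)
    show "be s (t + 2 * pi) = be s t" for t by (simp add: be_def)
    fix t
    have "\<bar>(sin t)\<^sup>2 * (- 2 * s / \<omega>)\<bar> \<le> 1 * \<bar>- 2 * s / \<omega>\<bar>"
      unfolding abs_mult[of "(sin t)\<^sup>2"] using sc(3) by (rule mult_right_mono) simp
    then show "\<bar>be s t\<bar> \<le> A" unfolding be_def A_def by linarith
  qed
  have mean_al: "antideriv al (2 * pi) = 2 * pi * (- c / (4 * \<omega>))"
    unfolding al_def[abs_def] using \<omega>_pos
    by (subst antideriv_diff, (intro continuous_intros)+, (subst antideriv_cmult, (intro continuous_intros)+)+) (simp add: antideriv_trig)
  have mean_be: "antideriv (be s) (2 * pi) = 2 * pi * (- s / \<omega>)"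
    unfolding be_def[abs_def] using \<omega>_pos
    by (subst antideriv_cmult, (intro continuous_intros)+) (simp add: antideriv_trig)
  \<comment> \<open>The zero of the averaged right-hand side; it is positive because
    \<open>s\<close> and \<open>c\<close> have opposite signs.\<close>
  have V0: "- (- c / (4 * \<omega>)) / (- s / \<omega>) = \<bar>c\<bar> / 4"
  proof -
    have "s \<noteq> 0" using s by auto
    then have "- (- c / (4 * \<omega>)) / (- s / \<omega>) = - c / (4 * s)" using \<omega>_pos by (simp add: field_simps)
    also have "\<dots> = - (c * s) / (4 * (s * s))" using \<open>s \<noteq> 0\<close> by simp
    finally show ?thesis unfolding s by simp
  qed
  have bb: "- s / \<omega> \<noteq> 0" "\<bar>- s / \<omega>\<bar> = 1 / \<omega>" using s \<omega>_pos by (auto simp: abs_divide)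
  obtain e2 where e2: "0 < e2" "e2 \<le> 1" and ex: "\<And>e \<Psi>. 0 < e \<Longrightarrow> e < e2 \<Longrightarrow>
      (\<And>t V. V \<in> {Vl..Vu} \<Longrightarrow> \<bar>\<Psi> t V\<bar> \<le> M * e) \<Longrightarrow>
      (\<And>t V V'. V \<in> {Vl..Vu} \<Longrightarrow> V' \<in> {Vl..Vu} \<Longrightarrow> \<bar>\<Psi> t V - \<Psi> t V'\<bar> \<le> M * e * \<bar>V - V'\<bar>) \<Longrightarrow>
      (\<And>t V. \<Psi> (t + 2 * pi) V = \<Psi> t V) \<Longrightarrow>
      (\<And>v. continuous_on UNIV v \<Longrightarrow> (\<And>t. v t \<in> {Vl..Vu}) \<Longrightarrow> continuous_on UNIV (\<lambda>t. \<Psi> t (v t))) \<Longrightarrow>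
      \<exists>v. (\<forall>t. v t \<in> {Vl..Vu} \<and> v (t + 2 * pi) = v t \<and>
         (v has_real_derivative e * (al t + be s t * v t + \<Psi> t (v t))) (at t))"
    by (rule averaging_exists[OF al be mean_al mean_be bb(1) _ _ M, of Vl Vu, unfolded V0])
      (use c_nz in \<open>auto simp: Vl_def Vu_def\<close>)
  \<comment> \<open>The last two bounds give \<open>M e < 1 / \<omega> = |bb|\<close>, as uniqueness
    requires, and \<open>k e <= \<omega> / 2\<close>, which keeps the bounds for the period
    positive.\<close>
  define e0 where "e0 = min e1 (min e2 (min (1 / (\<omega> * (M + 1))) (\<omega> / (2 * (k + 1)))))"
  have e0: "0 < e0" "e0 \<le> e1" "e0 \<le> e2" "e0 \<le> 1 / (\<omega> * (M + 1))" "e0 \<le> \<omega> / (2 * (k + 1))"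
    using e1 e2 M k \<omega>_pos by (auto simp: e0_def)
  show thesis
  proof (rule that[OF e0(1) k])
    fix m assume m: "\<bar>m\<bar> < e0" "m * c < 0"
    define e where "e = \<bar>m\<bar>"
    have e: "0 < e" "e < e0" "e < e1" "e < e2" "e < Vl * d" using m e0 e1 by (auto simp: e_def)
    have se: "s * e = m" using m(2) by (auto simp: s_def e_def sgn_if mult_less_0_iff)
    note dn = dn[OF e(1,3) s(1)] and dn2 = dn2[OF e(1,3) s(1)] and PB = PB[OF e(1,3) s(1)]
    have P1: "\<bar>Psi e s t V\<bar> \<le> M * e" if "V \<in> {Vl..Vu}" for t V using PB that by (auto simp: bdd_lipschitz_def)
    have P2: "\<bar>Psi e s t V - Psi e s t V'\<bar> \<le> M * e * \<bar>V - V'\<bar>" if "V \<in> {Vl..Vu}" "V' \<in> {Vl..Vu}" for t V V'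
      using PB that by (auto simp: bdd_lipschitz_def)
    have cyy: "continuous_on UNIV (\<lambda>t. yy e s t (v t))" if "continuous_on UNIV v" "\<And>t. v t \<in> {Vl..Vu}" for v
      using e that by (intro continuous_on_yy)
    have nz: "v t \<noteq> 0" if "\<And>t. v t \<in> {Vl..Vu}" for v :: "real \<Rightarrow> real" and t using that[of t] Vl_pos by auto
    have dnz: "dn e s t (v t) \<noteq> 0" if "\<And>t. v t \<in> {Vl..Vu}" for v t using dn2[OF that, of t t] \<omega>_pos by auto
    have cdn: "continuous_on UNIV (\<lambda>t. dn e s t (v t))" if "continuous_on UNIV v" "\<And>t. v t \<in> {Vl..Vu}" for v
      unfolding dn_def using nz[of v] that by (intro continuous_intros cyy) auto
    have P4: "continuous_on UNIV (\<lambda>t. Psi e s t (v t))" if "continuous_on UNIV v" "\<And>t. v t \<in> {Vl..Vu}" for v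
      unfolding Psi_def Phi_def using dnz[of v] that by (intro continuous_intros cyy cdn al be) auto
    have "\<exists>v. (\<forall>t. v t \<in> {Vl..Vu} \<and> v (t + 2 * pi) = v t \<and>
         (v has_real_derivative e * (al t + be s t * v t + Psi e s t (v t))) (at t))"
      by (rule ex[OF e(1,4) P1 P2 _ P4]) (auto simp: Psi_def Phi_def dn_def yy_def al(2) be(2))
    then obtain v where v: "\<And>t. v t \<in> {Vl..Vu}" "\<And>t. v (t + 2 * pi) = v t"
      and v': "\<And>t. (v has_real_derivative e * (al t + be s t * v t + Psi e s t (v t))) (at t)" by blast
    have vp: "0 < v t" for t using v(1)[of t] Vl_pos by auto
    have cv: "continuous_on UNIV v" by (rule DERIV_continuous_on) (rule v')
    define D where "D t = dn e s t (v t)" for t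
    have cD: "continuous_on UNIV D" unfolding D_def by (rule cdn[OF cv v(1)])
    have D2: "\<omega> / 2 \<le> D t" "D t \<le> 2 * \<omega>" for t using dn2[OF v(1), of t t] by (auto simp: D_def)
    have Dp: "0 < D t" for t using D2(1)[of t] \<omega>_pos by linarith
    have perD: "D (t + 2 * pi) = D t" for t by (simp add: D_def dn_def yy_def v(2))
    have c1D: "continuous_on UNIV (\<lambda>t. 1 / D t)"
      by (intro continuous_intros cD) (use Dp in \<open>auto simp: less_le\<close>)
    \<comment> \<open>Time as a function of the angle; its increment over one turn is the
      period.\<close>
    define tm where "tm = antideriv (\<lambda>t. 1 / D t)"
    define T where "T = tm (2 * pi)"
    have tm': "(tm has_real_derivative 1 / D t) (at t)" for t unfolding tm_def by (rule antideriv_has_derivative[OF c1D])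
    have tml: "1 / (2 * \<omega>) \<le> 1 / D t" for t using D2(2) Dp by (intro frac_le) auto
    have tm_shift: "tm (t + 2 * pi) = tm t + T" for t
      unfolding tm_def T_def by (rule antideriv_shift[OF c1D]) (simp add: perD)
    obtain th where th: "\<And>t. tm (th t) = t" "\<And>t. th (tm t) = t"
      "\<And>t. (th has_real_derivative inverse (1 / D (th t))) (at t)" "\<And>a b. a < b \<Longrightarrow> th a < th b"
      by (rule increasing_inverse[OF tm' _ tml]) (use \<omega>_pos in auto)
    have th': "(th has_real_derivative D (th t)) (at t)" for t using th(3)[of t] by simp
    have th_shift: "th (t + T) = th t + 2 * pi" for t using tm_shift[of "th t"] th(1)[of t] th(2) by metis
    have th_0: "th 0 = 0" using th(2)[of 0] by (simp add: tm_def antideriv_0)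
    have ke: "k * e \<le> \<omega> / 2"
    proof -
      have "k * e \<le> (k + 1) * (\<omega> / (2 * (k + 1)))" using e e0 k by (intro mult_mono) auto
      also have "\<dots> = \<omega> / 2" using k by (simp add: field_simps)
      finally show ?thesis .
    qed
    have Dke: "\<omega> - k * e \<le> D t" "D t \<le> \<omega> + k * e" for t using dn[OF v(1), of t t] unfolding D_def abs_le_iff by linarith+
    have wke: "0 < \<omega> - k * e" "0 < \<omega> + k * e" using ke \<omega>_pos k e mult_nonneg_nonneg[of k e] by linarith+
    have Tb: "1 / (\<omega> + k * e) * (2 * pi) \<le> T" "T \<le> 1 / (\<omega> - k * e) * (2 * pi)"
    proof -
      have b: "1 / (\<omega> + k * e) \<le> 1 / D t" "1 / D t \<le> 1 / (\<omega> - k * e)" for t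
        using Dke[of t] Dp[of t] wke by (auto intro: frac_le)
      show "1 / (\<omega> + k * e) * (2 * pi) \<le> T" "T \<le> 1 / (\<omega> - k * e) * (2 * pi)"
        unfolding T_def tm_def using antideriv_bounds[OF c1D _ b] by simp_all
    qed
    have T: "0 < T"
      by (rule less_le_trans[OF _ Tb(1)]) (use wke in simp)
    have Tf: "\<bar>2 * pi / T - \<omega>\<bar> \<le> k * \<bar>m\<bar>"
    proof -
      have "2 * pi \<le> T * (\<omega> + k * e)" "T * (\<omega> - k * e) \<le> 2 * pi"
        using Tb wke by (simp_all add: pos_divide_le_eq pos_le_divide_eq)
      then have "2 * pi / T \<le> \<omega> + k * e" "\<omega> - k * e \<le> 2 * pi / T"
        using T by (simp_all add: pos_divide_le_eq pos_le_divide_eq mult.commute)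
      then show ?thesis unfolding e_def[symmetric] by (simp add: abs_le_iff)
    qed
    define \<rho> where "\<rho> a = sqrt (e / v a)" for a
    define P where "P a = (\<rho> a * cos a, \<rho> a * sin a)" for a
    have \<rho>p: "0 < \<rho> a" "(\<rho> a)\<^sup>2 = e / v a" for a using e vp[of a] by (auto simp: \<rho>_def)
    define x y where "x t = \<rho> (th t) * cos (th t)" and "y t = \<rho> (th t) * sin (th t)" for t
    have xyP: "(x t, y t) = P (th t)" for t by (simp add: x_def y_def P_def)
    \<comment> \<open>Multiplication by \<open>D\<close> turns the derivative in the angle into one
      in time, and \<open>al\<close>, \<open>be\<close> cancel against their subtraction in
      \<open>Psi\<close>.\<close>
    have v'D: "e * (al t + be s t * v t + Psi e s t (v t)) * D t = - 2 * sin t * e * yy e s t (v t)" for t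
      using Dp[of t] by (simp add: Psi_def Phi_def D_def)
    have \<rho>': "((\<lambda>t. \<rho> (th t)) has_real_derivative \<rho> (th t) * e * yy e s (th t) (v (th t)) / v (th t) * sin (th t)) (at t)" for t
    proof -
      let ?a = "th t"
      have vth: "((\<lambda>t. v (th t)) has_real_derivative - 2 * sin ?a * e * yy e s ?a (v ?a)) (at t)"
        using DERIV_chain2[OF v' th', of t] unfolding v'D .
      have "((\<lambda>t. e / v (th t)) has_real_derivative 2 * sin ?a * e * yy e s ?a (v ?a) * e / (v ?a * v ?a)) (at t)"
        using DERIV_divide[OF DERIV_const[of e] vth] vp[of ?a] by (simp add: mult_ac)
      from DERIV_chain2[OF DERIV_real_sqrt this] e vp[of ?a]
      have "((\<lambda>t. \<rho> (th t)) has_real_derivative inverse (\<rho> ?a) / 2 * (2 * sin ?a * e * yy e s ?a (v ?a) * e / (v ?a * v ?a))) (at t)"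
        by (simp add: \<rho>_def)
      moreover have "inverse (\<rho> ?a) / 2 * (2 * sin ?a * e * yy e s ?a (v ?a) * e / (v ?a * v ?a))
        = \<rho> ?a * e * yy e s ?a (v ?a) / v ?a * sin ?a"
      proof -
        have 1: "inverse (\<rho> ?a) * (e / v ?a) = \<rho> ?a"
          unfolding \<rho>p(2)[symmetric] using \<rho>p(1)[of ?a] by (simp add: power2_eq_square)
        have "inverse (\<rho> ?a) / 2 * (2 * sin ?a * e * yy e s ?a (v ?a) * e / (v ?a * v ?a))
          = inverse (\<rho> ?a) * (e / v ?a) * (e * yy e s ?a (v ?a) / v ?a * sin ?a)" by simp
        also have "\<dots> = \<rho> ?a * (e * yy e s ?a (v ?a) / v ?a * sin ?a)" unfolding 1 ..
        finally show ?thesis by simp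
      qed
      ultimately show ?thesis by metis
    qed
    have sol: "sol m UNIV x y"
      unfolding sol_def
    proof (intro ballI conjI)
      fix t :: real
      let ?a = "th t"
      \<comment> \<open>The nonlinear force, which acts on \<open>y\<close> only: its radial
        component is \<open>?N sin\<close>, and its component along the angle is
        \<open>?N cos\<close>.\<close>
      let ?N = "\<rho> ?a * e * yy e s ?a (v ?a) / v ?a"
      have N: "n3 (x t) (y t) + n5 (x t) (y t) + m * y t = ?N"
        using nonlinear_polar[OF e(1) vp \<rho>p(2), of ?a ?a s] by (simp add: x_def y_def se)
      have Dr: "\<rho> ?a * D ?a = \<omega> * \<rho> ?a + ?N * cos ?a" by (simp add: D_def dn_def algebra_simps)
      have c': "((\<lambda>t. cos (th t)) has_real_derivative - sin ?a * D ?a) (at t)"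
        and s': "((\<lambda>t. sin (th t)) has_real_derivative cos ?a * D ?a) (at t)"
        by (rule DERIV_chain2[OF DERIV_cos th'] DERIV_chain2[OF DERIV_sin th'])+
      have "(x has_real_derivative ?N * sin ?a * cos ?a + - sin ?a * D ?a * \<rho> ?a) (at t)"
        unfolding x_def by (rule DERIV_mult[OF \<rho>' c'])
      moreover have "?N * sin ?a * cos ?a + - sin ?a * D ?a * \<rho> ?a = ?N * sin ?a * cos ?a - sin ?a * (\<rho> ?a * D ?a)" by simp
      then have "?N * sin ?a * cos ?a + - sin ?a * D ?a * \<rho> ?a = - \<omega> * y t"
        unfolding Dr by (simp add: y_def algebra_simps)
      ultimately show "(x has_real_derivative - \<omega> * y t) (at t within UNIV)" by metis
      have "(y has_real_derivative ?N * sin ?a * sin ?a + cos ?a * D ?a * \<rho> ?a) (at t)"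
        unfolding y_def by (rule DERIV_mult[OF \<rho>' s'])
      moreover have "?N * sin ?a * sin ?a + cos ?a * D ?a * \<rho> ?a = ?N * sin ?a * sin ?a + cos ?a * (\<rho> ?a * D ?a)" by simp
      then have "?N * sin ?a * sin ?a + cos ?a * D ?a * \<rho> ?a = \<omega> * x t + ?N * ((sin ?a)\<^sup>2 + (cos ?a)\<^sup>2)"
        unfolding Dr x_def distrib_left by (simp only: power2_eq_square mult_ac add_ac)
      then have "?N * sin ?a * sin ?a + cos ?a * D ?a * \<rho> ?a = \<omega> * x t + n3 (x t) (y t) + n5 (x t) (y t) + m * y t"
        unfolding sin_cos_squared_add N[symmetric] by simp
      ultimately show "(y has_real_derivative \<omega> * x t + n3 (x t) (y t) + n5 (x t) (y t) + m * y t) (at t within UNIV)" by metis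
    qed
    have perP: "P (a + 2 * pi) = P a" for a by (simp add: P_def \<rho>_def v(2))
    have per: "x (t + T) = x t \<and> y (t + T) = y t" for t
    proof -
      have "(x (t + T), y (t + T)) = (x t, y t)" unfolding xyP th_shift perP ..
      then show ?thesis by simp
    qed
    \<comment> \<open>The orbit starts at angle 0 with positive radius; a return needs
      \<open>sin = 0\<close> and \<open>cos > 0\<close>, which does not happen strictly between 0
      and \<open>2 pi\<close>.\<close>
    have min: "(x u, y u) \<noteq> (x 0, y 0)" if u: "0 < u" "u < T" for u
    proof
      assume eq: "(x u, y u) = (x 0, y 0)"
      have a: "0 < th u" "th u < 2 * pi" using th(4)[OF u(1)] th(4)[OF u(2)] th_0 th_shift[of 0] by auto
      have s0: "sin (th u) = 0" and c0: "0 < cos (th u)"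
        using eq \<rho>p(1)[of "th u"] \<rho>p(1)[of 0] by (auto simp: x_def y_def th_0 zero_less_mult_iff dest: sym)
      have "cos (th u) = 1" using s0 c0 sin_cos_squared_add[of "th u"] by (simp add: power2_eq_1_iff)
      then obtain j :: int where "th u = of_int j * 2 * pi" using cos_one_2pi_int by blast
      with a have "0 < j" "j < 1" by (auto simp: zero_less_mult_iff)
      then show False by simp
    qed
    have ann: "Complex (x t) (y t) \<noteq> 0 \<and> \<bar>m\<bar> / (cmod (Complex (x t) (y t)))\<^sup>2 \<in> {Vl..Vu}" for t
    proof -
      have "(cmod (Complex (x t) (y t)))\<^sup>2 = (\<rho> (th t))\<^sup>2 * ((sin (th t))\<^sup>2 + (cos (th t))\<^sup>2)"
        unfolding distrib_left by (simp add: cmod_power2 x_def y_def power_mult_distrib)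
      then have q: "(cmod (Complex (x t) (y t)))\<^sup>2 = e / v (th t)" unfolding sin_cos_squared_add \<rho>p(2) by simp
      have "e / v (th t) \<noteq> 0" using e vp[of "th t"] by simp
      with q have "Complex (x t) (y t) \<noteq> 0" by (metis norm_zero zero_power2)
      moreover have "\<bar>m\<bar> / (cmod (Complex (x t) (y t)))\<^sup>2 = v (th t)" unfolding q using e by (simp add: e_def)
      ultimately show ?thesis using v(1) by simp
    qed
    have rangeP: "range (\<lambda>t. (x t, y t)) = range P"
    proof -
      have "P a \<in> range (\<lambda>t. (x t, y t))" for a
        by (rule range_eqI[of _ _ "tm a"]) (simp only: xyP th(2))
      moreover have "(x t, y t) \<in> range P" for t by (simp only: xyP rangeI)
      ultimately show ?thesis by blast
    qed
    have uniq: "range (\<lambda>t. (x' t, y' t)) = range (\<lambda>t. (x t, y t))"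
      if sol': "sol m UNIV x' y'" and T': "0 < T'" and per': "\<And>t. x' (t + T') = x' t \<and> y' (t + T') = y' t"
        and ann': "\<And>t. Complex (x' t) (y' t) \<noteq> 0 \<and> \<bar>m\<bar> / (cmod (Complex (x' t) (y' t)))\<^sup>2 \<in> {Vl..Vu}" for x' y' T'
    proof -
      define \<zeta> where "\<zeta> t = Complex (x' t) (y' t)" for t
      define \<zeta>' where "\<zeta>' t = Complex (- \<omega> * y' t) (\<omega> * x' t + n3 (x' t) (y' t) + n5 (x' t) (y' t) + m * y' t)" for t
      have \<zeta>d: "(\<zeta> has_vector_derivative \<zeta>' t) (at t)" for t
      proof -
        have "(x' has_real_derivative Re (\<zeta>' t)) (at t)" "(y' has_real_derivative Im (\<zeta>' t)) (at t)"
          using sol' by (auto simp: sol_def \<zeta>'_def)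
        then have "((\<lambda>t. of_real (x' t) + \<i> * of_real (y' t)) has_vector_derivative of_real (Re (\<zeta>' t)) + \<i> * of_real (Im (\<zeta>' t))) (at t)"
          by (intro has_vector_derivative_add has_vector_derivative_mult_right has_vector_derivative_of_real)
        then show ?thesis by (simp add: \<zeta>_def[abs_def] complex_eq[symmetric] Complex_eq)
      qed
      have "continuous_on UNIV \<zeta>"
        using \<zeta>d by (intro continuous_at_imp_continuous_on ballI has_vector_derivative_continuous)
      \<comment> \<open>A zero-free curve over the line has a continuous logarithm, whose imaginary
        part serves as a continuous angle.\<close>
      then obtain g where g: "continuous_on UNIV g" "\<And>t. \<zeta> t = exp (g t)"
        using continuous_logarithm_on_contractible[of UNIV \<zeta>] ann' by (auto simp: \<zeta>_def convex_imp_contractible)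
      define \<theta> where "\<theta> t = Im (g t)" for t
      define R where "R t = cmod (\<zeta> t)" for t
      have R: "0 < R t" for t using ann' by (simp add: R_def \<zeta>_def)
      have polar: "\<zeta> t = of_real (R t) * cis (\<theta> t)" for t
        using g(2)[of t] by (simp add: R_def \<theta>_def exp_eq_polar norm_mult)
      have c\<theta>: "continuous_on UNIV \<theta>" unfolding \<theta>_def by (intro continuous_intros g)
      define V where "V t = e / (R t)\<^sup>2" for t
      have V: "V t \<in> {Vl..Vu}" for t using ann'[of t] by (simp add: V_def e_def R_def \<zeta>_def)
      have Vp: "0 < V t" for t using V[of t] Vl_pos by auto
      have RV: "(R t)\<^sup>2 = e / V t" for t using e by (simp add: V_def)
      have xy': "x' t = R t * cos (\<theta> t)" "y' t = R t * sin (\<theta> t)" for t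
        using polar[of t] by (auto simp: \<zeta>_def complex_eq_iff)
      define q where "q t = e * yy e s (\<theta> t) (V t) / V t" for t
      have N: "n3 (x' t) (y' t) + n5 (x' t) (y' t) + m * y' t = R t * q t" for t
        using nonlinear_polar[OF e(1) Vp RV, of t "\<theta> t" s] by (simp add: xy' se q_def)
      \<comment> \<open>Rotation plus the vertical force; the quotient by \<zeta> separates
        logarithmic radial velocity and angular velocity.\<close>
      have quot: "\<zeta>' t / \<zeta> t = Complex (q t * sin (\<theta> t)) (\<omega> + q t * cos (\<theta> t))" for t
      proof -
        have "\<zeta>' t = \<i> * of_real \<omega> * \<zeta> t + \<i> * of_real (R t * q t)"
          unfolding N[symmetric] by (simp add: \<zeta>'_def \<zeta>_def complex_eq_iff)
        also have "\<dots> = (\<i> * of_real \<omega> + \<i> * of_real (q t) * cis (- \<theta> t)) * \<zeta> t"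
          unfolding polar by (simp add: algebra_simps cis_mult)
        finally have "\<zeta>' t / \<zeta> t = \<i> * of_real \<omega> + \<i> * of_real (q t) * cis (- \<theta> t)"
          using ann' by (simp add: \<zeta>_def)
        then show ?thesis by (simp add: complex_eq_iff)
      qed
      have pd: "(R has_real_derivative R t * (q t * sin (\<theta> t))) (at t)"
        "(\<theta> has_real_derivative dn e s (\<theta> t) (V t)) (at t)" for t
      proof -
        have pol: "0 < R u \<and> \<zeta> u = of_real (R u) * cis (\<theta> u)" for u using R polar by blast
        have "(R has_real_derivative R t * Re (\<zeta>' t / \<zeta> t)) (at t)"
          by (rule polar_derivative(1)[OF \<zeta>d UNIV_I pol c\<theta>])
        then show "(R has_real_derivative R t * (q t * sin (\<theta> t))) (at t)" unfolding quot by simp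
        have dq: "\<omega> + q t * cos (\<theta> t) = dn e s (\<theta> t) (V t)" by (simp add: q_def dn_def)
        have "(\<theta> has_real_derivative Im (\<zeta>' t / \<zeta> t)) (at t)"
          by (rule polar_derivative(2)[OF \<zeta>d UNIV_I pol c\<theta>])
        then show "(\<theta> has_real_derivative dn e s (\<theta> t) (V t)) (at t)" unfolding quot complex.sel dq .
      qed
      have dnp: "\<omega> / 2 \<le> dn e s (\<theta> t) (V t)" for t using dn2[OF V] by blast
      have V': "(V has_real_derivative dn e s (\<theta> t) (V t) * (e * (al (\<theta> t) + be s (\<theta> t) * V t + Psi e s (\<theta> t) (V t)))) (at t)" for t
      proof -
        have "((\<lambda>t. (R t)\<^sup>2) has_real_derivative 2 * R t * (R t * (q t * sin (\<theta> t)))) (at t)"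
          by (rule derivative_eq_intros pd(1) refl)+ simp
        from DERIV_divide[OF DERIV_const[of e] this] R[of t]
        have "(V has_real_derivative - (e * (2 * R t * (R t * (q t * sin (\<theta> t))))) / ((R t)\<^sup>2 * (R t)\<^sup>2)) (at t)"
          by (simp add: V_def[abs_def])
        moreover have "- (e * (2 * R t * (R t * (q t * sin (\<theta> t))))) / ((R t)\<^sup>2 * (R t)\<^sup>2) = - 2 * V t * q t * sin (\<theta> t)"
          using R[of t] by (simp add: V_def power2_eq_square)
        moreover have "V t * q t = e * yy e s (\<theta> t) (V t)" using Vp[of t] by (simp add: q_def)
        then have "- 2 * V t * q t * sin (\<theta> t) = - 2 * (e * yy e s (\<theta> t) (V t)) * sin (\<theta> t)" by simp
        moreover have "dn e s (\<theta> t) (V t) * (e * (al (\<theta> t) + be s (\<theta> t) * V t + Psi e s (\<theta> t) (V t)))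
          = - 2 * (e * yy e s (\<theta> t) (V t)) * sin (\<theta> t)"
          using dnp[of t] \<omega>_pos by (simp add: Psi_def Phi_def)
        ultimately show ?thesis by metis
      qed
      have th2: "\<exists>j::int. \<theta> (t + T') = \<theta> t + of_int j * (2 * pi)" for t
      proof -
        have z: "\<zeta> (t + T') = \<zeta> t" by (simp add: \<zeta>_def per')
        then have "R (t + T') = R t" by (simp only: R_def)
        with z polar[of t] polar[of "t + T'"]
        have "of_real (R t) * cis (\<theta> (t + T')) = of_real (R t) * cis (\<theta> t)" by metis
        then have "cis (\<theta> (t + T')) = cis (\<theta> t)" using R[of t] by simp
        then have "sin (\<theta> (t + T')) = sin (\<theta> t) \<and> cos (\<theta> (t + T')) = cos (\<theta> t)" by (simp add: complex_eq_iff)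
        then show ?thesis unfolding sin_cos_eq_iff by (auto simp: mult_ac)
      qed
      have Me: "M * e < \<bar>- s / \<omega>\<bar>"
      proof -
        have "M * e \<le> (M + 1) * e" using e by (simp add: distrib_right)
        also have "\<dots> < (M + 1) * (1 / (\<omega> * (M + 1)))" using e e0 M by (intro mult_strict_left_mono) auto
        also have "\<dots> = 1 / \<omega>" using M by simp
        finally show ?thesis unfolding bb(2) .
      qed
      have perV: "V (t + T') = V t" for t by (simp add: V_def R_def \<zeta>_def per')
      have dnp': "0 < dn e s (\<theta> t) (V t)" for t using dnp[of t] \<omega>_pos by linarith
      have Vv: "V t = v (\<theta> t)" for t
        by (rule averaging_unique[OF be(1,2) mean_be e(1) Me P2 v v' V perV T' V' pd(2) dnp' th2])
      have xyP': "(x' t, y' t) = P (\<theta> t)" for t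
      proof -
        have "R t = \<rho> (\<theta> t)" using RV[of t] R[of t] unfolding Vv \<rho>_def
          by (metis less_imp_le real_sqrt_unique)
        then show ?thesis by (simp add: P_def xy')
      qed
      \<comment> \<open>The angular velocity is at least \<open>\<omega> / 2\<close>, so the angle
        takes every value and the orbit covers the whole curve \<open>P\<close>.\<close>
      obtain h where h: "\<And>a. \<theta> (h a) = a"
        by (rule increasing_inverse[OF pd(2) _ dnp]) (use \<omega>_pos in auto)
      have "P a \<in> range (\<lambda>t. (x' t, y' t))" for a
        by (rule range_eqI[of _ _ "h a"]) (simp only: xyP' h)
      moreover have "(x' t, y' t) \<in> range P" for t by (simp only: xyP' rangeI)
      ultimately have "range (\<lambda>t. (x' t, y' t)) = range P" by blast
      then show ?thesis using rangeP by simp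
    qed
    have "cycle k m x y T"
      unfolding cycle_def annular_def
    proof (intro conjI allI impI)
      show "sol m UNIV x y" "0 < T" "\<bar>2 * pi / T - \<omega>\<bar> \<le> k * \<bar>m\<bar>" by fact+
      show "x (t + T) = x t" "y (t + T) = y t" for t using per by auto
      show "(x u, y u) \<noteq> (x 0, y 0)" if "0 < u \<and> u < T" for u using min that by blast
      show "Complex (x t) (y t) \<noteq> 0" "\<bar>m\<bar> / (cmod (Complex (x t) (y t)))\<^sup>2 \<in> {Vl..Vu}" for t
        using ann by blast+
      fix x' y' T'
      assume h: "sol m UNIV x' y' \<and> 0 < T' \<and> (\<forall>t. x' (t + T') = x' t \<and> y' (t + T') = y' t) \<and>
          (\<forall>t. Complex (x' t) (y' t) \<noteq> 0 \<and> \<bar>m\<bar> / (cmod (Complex (x' t) (y' t)))\<^sup>2 \<in> {Vl..Vu})"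
      show "range (\<lambda>t. (x' t, y' t)) = range (\<lambda>t. (x t, y t))"
        by (rule uniq[of x' y' T']; use h in blast)
    qed
    then show "\<exists>x y T. cycle k m x y T" by blast
  qed
qed

end

section \<open>The reduced system\<close>

lemma has_vector_derivative_Pair_iff:
  "((\<lambda>t. (x t, y t)) has_vector_derivative (a, b)) (at u within S) \<longleftrightarrow>
     (x has_vector_derivative a) (at u within S) \<and> (y has_vector_derivative b) (at u within S)"
proof
  assume h: "((\<lambda>t. (x t, y t)) has_vector_derivative (a, b)) (at u within S)"
  show "(x has_vector_derivative a) (at u within S) \<and> (y has_vector_derivative b) (at u within S)"
    using bounded_linear.has_vector_derivative[OF bounded_linear_fst h]
      bounded_linear.has_vector_derivative[OF bounded_linear_snd h] by simp
qed (auto intro: has_vector_derivative_Pair)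

lemma is_solution_reduced_iff:
  "is_solution (reduced_field f1 f2 \<alpha>1 \<alpha>2) (planar_domain U) I (\<lambda>t. (x t, y t)) \<longleftrightarrow>
     (\<forall>t\<in>I. ((x t)\<^sup>2, 0) \<in> U \<and> (x has_real_derivative y t) (at t within I) \<and>
       (y has_real_derivative (\<alpha>1 + f1 ((x t)\<^sup>2, 0)) * x t + (\<alpha>2 + f2 ((x t)\<^sup>2, 0)) * y t) (at t within I))"
  unfolding is_solution_def reduced_field_def planar_domain_def
  by (simp add: has_vector_derivative_Pair_iff has_real_derivative_iff_has_vector_derivative)

lemma is_solution_planar_iff:
  "is_solution (planar_field f1 f2 \<omega> \<alpha>2) (planar_domain U) I (\<lambda>t. (x t, y t)) \<longleftrightarrow>
     (\<forall>t\<in>I. ((x t)\<^sup>2, 0) \<in> U \<and> (x has_real_derivative - \<omega> * y t) (at t within I) \<and>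
       (y has_real_derivative \<omega> * x t + (- (1 / \<omega>) * f1 ((x t)\<^sup>2, 0) * x t + f2 ((x t)\<^sup>2, 0) * y t) + \<alpha>2 * y t)
         (at t within I))"
  unfolding is_solution_def planar_field_def planar_domain_def
  by (simp add: has_vector_derivative_Pair_iff has_real_derivative_iff_has_vector_derivative)

text \<open>The Taylor data fix value and slope of \<open>f (u, 0)\<close> at 0. As the second
  derivative is bounded by \<open>K\<close>, the remainder has slope at most \<open>K |u|\<close>,
  and the mean value theorem gives the Lipschitz bound.\<close>

lemma realizes_remainder:
  assumes U: "open U" "(0, 0) \<in> U" and f: "realizes U f \<phi>" and \<phi>0: "coeff2 \<phi> 0 0 = 0"
  obtains K d where "0 \<le> K" "0 < d" "\<And>u. \<bar>u\<bar> < d \<Longrightarrow> (u, 0) \<in> U"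
    "\<And>u v. \<bar>u\<bar> < d \<Longrightarrow> \<bar>v\<bar> < d \<Longrightarrow>
       \<bar>(f (u, 0) - coeff2 \<phi> 1 0 * u) - (f (v, 0) - coeff2 \<phi> 1 0 * v)\<bar> \<le> K * max \<bar>u\<bar> \<bar>v\<bar> * \<bar>u - v\<bar>"
    "f (0, 0) = 0"
proof -
  let ?e = "(1, 0) :: real \<times> real"
  have e: "?e \<in> Basis" by (simp add: Basis_prod_def)
  define q where "q = coeff2 \<phi> 1 0"
  define g where "g = dir_deriv ?e f"
  define h where "h = dir_deriv ?e g"
  have taylor: "(dir_deriv (1, 0) ^^ i) ((dir_deriv (0, 1) ^^ j) f) (0, 0) = fact i * fact j * coeff2 \<phi> i j" for i j
    using f by (simp add: realizes_def)
  have f0: "f (0, 0) = 0" using taylor[of 0 0] \<phi>0 by simp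
  have g0: "g (0, 0) = q" using taylor[of 1 0] by (simp add: g_def q_def)
  have C2: "Ck_on (Suc (Suc 0)) U f" using f unfolding realizes_def smooth_on_def by blast
  then have C1: "Ck_on (Suc 0) U g" using e unfolding g_def dir_deriv_def by (metis Ck_on.simps(2))
  then have C0: "continuous_on U h" using e unfolding h_def dir_deriv_def by (metis Ck_on.simps)
  have f': "(f has_derivative frechet_derivative f (at x)) (at x)" if "x \<in> U" for x by (rule Ck_on_SucD[OF C2 that])
  have g': "(g has_derivative frechet_derivative g (at x)) (at x)" if "x \<in> U" for x by (rule Ck_on_SucD[OF C1 that])
  have line: "((\<lambda>u. F (u, 0)) has_real_derivative dir_deriv ?e F (u, 0)) (at u)"
    if F: "(F has_derivative frechet_derivative F (at (u, 0))) (at (u, 0))" for F :: "real \<times> real \<Rightarrow> real" and u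
  proof -
    interpret D: bounded_linear "frechet_derivative F (at (u, 0))" using F by (rule has_derivative_bounded_linear)
    have "((\<lambda>u :: real. (u, 0 :: real)) has_derivative (\<lambda>u. (u, 0))) (at u)"
      by (intro has_derivative_Pair has_derivative_ident has_derivative_const)
    from has_derivative_compose[OF this F]
    have "((\<lambda>u. F (u, 0)) has_derivative (\<lambda>t. frechet_derivative F (at (u, 0)) (t, 0))) (at u)" .
    moreover have "frechet_derivative F (at (u, 0)) (t, 0) = dir_deriv ?e F (u, 0) * t" for t
      using D.scaleR[of t ?e] by (simp add: dir_deriv_def)
    ultimately show ?thesis by (simp add: has_field_derivative_def)
  qed
  obtain d1 where d1: "0 < d1" "ball (0, 0) d1 \<subseteq> U" using U open_contains_ball by blast
  have "isCont h (0, 0)" using C0 U by (simp add: continuous_on_eq_continuous_at)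
  then obtain d2 where d2: "0 < d2" "\<And>x. dist x (0, 0) < d2 \<Longrightarrow> dist (h x) (h (0, 0)) < 1"
    unfolding continuous_at_eps_delta by (metis zero_less_one)
  define d where "d = min d1 d2"
  \<comment> \<open>The 1 is the variation of the second derivative \<open>h\<close> that the radius
    \<open>d2\<close> admits.\<close>
  define K where "K = \<bar>h (0, 0)\<bar> + 1"
  have d: "0 < d" using d1 d2 by (simp add: d_def)
  have dist0: "dist (u, 0) ((0, 0) :: real \<times> real) = \<bar>u\<bar>" for u :: real by (simp add: dist_Pair_Pair dist_real_def)
  have inU: "(u, 0) \<in> U" if "\<bar>u\<bar> < d" for u
    using d1(2) that dist0[of u] by (auto simp: d_def dist_commute)
  have hK: "\<bar>h (u, 0)\<bar> \<le> K" if "\<bar>u\<bar> < d" for u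
    using d2(2)[of "(u, 0)"] that dist0[of u] by (auto simp: d_def K_def dist_real_def)
  have mvt: "\<bar>F u - F v\<bar> \<le> B * \<bar>u - v\<bar>"
    if F: "\<And>w. \<bar>w\<bar> < d \<Longrightarrow> (F has_real_derivative F' w) (at w)" and B: "\<And>w. \<bar>w\<bar> \<le> max \<bar>u\<bar> \<bar>v\<bar> \<Longrightarrow> \<bar>F' w\<bar> \<le> B"
      and uv: "\<bar>u\<bar> < d" "\<bar>v\<bar> < d" for F F' :: "real \<Rightarrow> real" and u v B
  proof -
    have "norm (F u - F v) \<le> B * norm (u - v)"
    proof (rule field_differentiable_bound[of "closed_segment u v"])
      fix w assume "w \<in> closed_segment u v"
      then have w: "\<bar>w\<bar> \<le> max \<bar>u\<bar> \<bar>v\<bar>" by (auto simp: closed_segment_eq_real_ivl split: if_splits)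
      then show "norm (F' w) \<le> B" using B by simp
      have "\<bar>w\<bar> < d" using w uv by (simp add: max_def split: if_splits)
      then show "(F has_field_derivative F' w) (at w within closed_segment u v)"
        by (rule has_field_derivative_at_within[OF F])
    qed auto
    then show ?thesis by simp
  qed
  have g_lip: "\<bar>g (u, 0) - q\<bar> \<le> K * \<bar>u\<bar>" if "\<bar>u\<bar> < d" for u
  proof -
    have "\<bar>g (u, 0) - g (0, 0)\<bar> \<le> K * \<bar>u - 0\<bar>"
    proof (rule mvt[of "\<lambda>u. g (u, 0)" "\<lambda>u. h (u, 0)"])
      show "((\<lambda>u. g (u, 0)) has_real_derivative h (w, 0)) (at w)" if "\<bar>w\<bar> < d" for w
        unfolding h_def by (rule line[OF g'[OF inU[OF that]]])
      show "\<bar>h (w, 0)\<bar> \<le> K" if "\<bar>w\<bar> \<le> max \<bar>u\<bar> \<bar>0\<bar>" for w using that \<open>\<bar>u\<bar> < d\<close> by (intro hK) auto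
    qed (use that d in auto)
    then show ?thesis by (simp add: g0)
  qed
  have r_lip: "\<bar>(f (u, 0) - q * u) - (f (v, 0) - q * v)\<bar> \<le> K * max \<bar>u\<bar> \<bar>v\<bar> * \<bar>u - v\<bar>"
    if "\<bar>u\<bar> < d" "\<bar>v\<bar> < d" for u v
  proof (rule mvt[of "\<lambda>u. f (u, 0) - q * u" "\<lambda>u. g (u, 0) - q", OF _ _ that])
    show "((\<lambda>u. f (u, 0) - q * u) has_real_derivative g (w, 0) - q) (at w)" if "\<bar>w\<bar> < d" for w
      using DERIV_diff[OF line[OF f'[OF inU[OF that]]] DERIV_cmult_Id[of q]] by (simp add: g_def)
    fix w assume w: "\<bar>w\<bar> \<le> max \<bar>u\<bar> \<bar>v\<bar>"
    then have "\<bar>w\<bar> < d" using that by (simp add: max_def split: if_splits)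
    from g_lip[OF this] show "\<bar>g (w, 0) - q\<bar> \<le> K * max \<bar>u\<bar> \<bar>v\<bar>"
      using mult_left_mono[OF w, of K] by (simp add: K_def)
  qed
  show thesis
    by (rule that[of K d]) (use d inU r_lip f0 in \<open>auto simp: K_def q_def\<close>)
qed

text \<open>The substitution is linear and invertible, and \<open>\<alpha>1 = - \<omega>^2\<close>
  turns \<open>\<alpha>1 y1\<close> into the rotation term \<open>\<omega> x\<close>.\<close>

lemma reduced_iff_planar:
  assumes "\<alpha>1 < 0" "0 < \<omega>" "\<omega>\<^sup>2 = - \<alpha>1"
  shows "is_solution (reduced_field f1 f2 \<alpha>1 \<alpha>2) (planar_domain U) I (\<lambda>t. (y1 t, y2 t)) \<longleftrightarrow>
         is_solution (planar_field f1 f2 \<omega> \<alpha>2) (planar_domain U) I (\<lambda>t. (y1 t, - y2 t / \<omega>))"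
proof -
  have key: "((y1 has_real_derivative y2 t) (at t within J) \<and> (y2 has_real_derivative (\<alpha>1 + a) * y1 t + (\<alpha>2 + b) * y2 t) (at t within J)) \<longleftrightarrow>
    ((y1 has_real_derivative - \<omega> * (- y2 t / \<omega>)) (at t within J) \<and>
     ((\<lambda>t. - y2 t / \<omega>) has_real_derivative \<omega> * y1 t + (- (1 / \<omega>) * a * y1 t + b * (- y2 t / \<omega>)) + \<alpha>2 * (- y2 t / \<omega>)) (at t within J))"
    for t J a b
  proof -
    have e: "\<omega> * y1 t + (- (1 / \<omega>) * a * y1 t + b * (- y2 t / \<omega>)) + \<alpha>2 * (- y2 t / \<omega>)
      = - ((\<alpha>1 + a) * y1 t + (\<alpha>2 + b) * y2 t) / \<omega>"
    proof -
      have "\<alpha>1 = - (\<omega> * \<omega>)" using assms(3) by (simp add: power2_eq_square)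
      then show ?thesis using assms(2) by (simp add: field_simps)
    qed
    have iff: "((\<lambda>t. - y2 t / \<omega>) has_real_derivative - D / \<omega>) (at t within J) \<longleftrightarrow> (y2 has_real_derivative D) (at t within J)" for D
    proof
      assume "((\<lambda>t. - y2 t / \<omega>) has_real_derivative - D / \<omega>) (at t within J)"
      from DERIV_cmult[OF this, of "- \<omega>"] show "(y2 has_real_derivative D) (at t within J)" using assms(2) by simp
    next
      assume "(y2 has_real_derivative D) (at t within J)"
      from DERIV_cmult[OF this, of "- 1 / \<omega>"] show "((\<lambda>t. - y2 t / \<omega>) has_real_derivative - D / \<omega>) (at t within J)" by simp
    qed
    have w: "- \<omega> * (- y2 t / \<omega>) = y2 t" using assms(2) by simp
    show ?thesis unfolding e w iff ..
  qed
  show ?thesis unfolding is_solution_reduced_iff is_solution_planar_iff key ..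
qed

text \<open>The instant \<open>T / 2\<close> lies strictly inside the period, so \<open>x\<close>
  takes at least two values.\<close>

lemma closed_orbit_nonconstant:
  fixes T :: real
  assumes "0 < T" "\<forall>s. 0 < s \<and> s < T \<longrightarrow> x s \<noteq> x 0"
  shows "\<exists>t. x t \<noteq> p"
  using assms(2)[rule_format, of "T / 2"] assms(1) by (metis half_gt_zero field_sum_of_halves less_add_same_cancel1)

text \<open>The planar results apply with the Taylor slopes \<open>p\<close> and \<open>c\<close>
  and the remainders of \<open>f1\<close> and \<open>f2\<close> on the first axis. Localization
  makes every small closed orbit annular, and among annular orbits the cycle is unique.\<close>

lemma reduced_bifurcation:
  assumes U: "open U" "(0, 0) \<in> U" and f1: "realizes U f1 \<phi>1" and f2: "realizes U f2 \<phi>2"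
    and \<phi>: "coeff2 \<phi>1 0 0 = 0" "coeff2 \<phi>2 0 0 = 0" "coeff2 \<phi>2 1 0 \<noteq> 0" and \<alpha>1: "\<alpha>1 < 0"
  defines "c \<equiv> coeff2 \<phi>2 1 0"
  shows "\<exists>\<Gamma> T. limit_cycle_branch (reduced_field f1 f2 \<alpha>1) (planar_domain U) 0 0 (- sgn c) \<Gamma> T \<and>
    ((\<lambda>\<alpha>2. 2 * pi / T \<alpha>2) \<longlongrightarrow> sqrt (- \<alpha>1)) (at 0 within {\<alpha>2. 0 < - 4 * \<alpha>2 / c}) \<and>
    (\<exists>H b C. polar_normal_form (planar_field f1 f2 (sqrt (- \<alpha>1))) (planar_domain U) H
        (\<lambda>\<alpha>2. \<alpha>2 / 2) (\<lambda>\<alpha>2. sqrt (- \<alpha>1 - (\<alpha>2 / 2)\<^sup>2)) (1 / 8 * c) b \<and>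
      (\<forall>\<^sub>F \<alpha>2 in at 0 within {\<alpha>2. 0 < - 4 * \<alpha>2 / c}. \<forall>(y1, y2) \<in> \<Gamma> \<alpha>2.
         let \<zeta> = Complex y1 (- y2 / sqrt (- \<alpha>1)) in
           \<bar>cmod (H \<alpha>2 \<zeta>) - sqrt (- 4 * \<alpha>2 / c)\<bar> \<le> C * \<bar>\<alpha>2\<bar> powr (3 / 2) \<and>
           \<bar>cmod \<zeta> - sqrt (- 4 * \<alpha>2 / c)\<bar> \<le> C * \<bar>\<alpha>2\<bar> powr (3 / 2)))"
proof -
  define \<omega> where "\<omega> = sqrt (- \<alpha>1)"
  have \<omega>: "0 < \<omega>" "\<omega>\<^sup>2 = - \<alpha>1" using \<alpha>1 by (auto simp: \<omega>_def)
  define p where "p = coeff2 \<phi>1 1 0"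
  define r1 r2 where "r1 u = f1 (u, 0) - p * u" and "r2 u = f2 (u, 0) - c * u" for u
  obtain K1 d1 where K1: "0 \<le> K1" "0 < d1" "\<And>u. \<bar>u\<bar> < d1 \<Longrightarrow> (u, 0) \<in> U" "f1 (0, 0) = 0"
    and l1: "\<And>u v. \<bar>u\<bar> < d1 \<Longrightarrow> \<bar>v\<bar> < d1 \<Longrightarrow> \<bar>r1 u - r1 v\<bar> \<le> K1 * max \<bar>u\<bar> \<bar>v\<bar> * \<bar>u - v\<bar>"
    using realizes_remainder[OF U f1 \<phi>(1)] unfolding r1_def p_def by metis
  obtain K2 d2 where K2: "0 \<le> K2" "0 < d2" "f2 (0, 0) = 0"
    and l2: "\<And>u v. \<bar>u\<bar> < d2 \<Longrightarrow> \<bar>v\<bar> < d2 \<Longrightarrow> \<bar>r2 u - r2 v\<bar> \<le> K2 * max \<bar>u\<bar> \<bar>v\<bar> * \<bar>u - v\<bar>"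
    using realizes_remainder[OF U f2 \<phi>(2)] unfolding r2_def c_def by metis
  define d where "d = min d1 d2"
  interpret planar_hopf \<omega> p c r1 r2 "K1 + K2" d
  proof
    show "0 < \<omega>" "c \<noteq> 0" "0 \<le> K1 + K2" "0 < d" "r1 0 = 0" "r2 0 = 0"
      using \<omega> \<phi> K1 K2 by (auto simp: c_def d_def r1_def r2_def)
    fix u v :: real assume uv: "\<bar>u\<bar> < d" "\<bar>v\<bar> < d"
    then have d12: "\<bar>u\<bar> < d1" "\<bar>v\<bar> < d1" "\<bar>u\<bar> < d2" "\<bar>v\<bar> < d2" by (simp_all add: d_def)
    have k: "K1 * max \<bar>u\<bar> \<bar>v\<bar> * \<bar>u - v\<bar> \<le> (K1 + K2) * max \<bar>u\<bar> \<bar>v\<bar> * \<bar>u - v\<bar>"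
      "K2 * max \<bar>u\<bar> \<bar>v\<bar> * \<bar>u - v\<bar> \<le> (K1 + K2) * max \<bar>u\<bar> \<bar>v\<bar> * \<bar>u - v\<bar>"
      using K1(1) K2(1) by (intro mult_right_mono; simp)+
    show "\<bar>r1 u - r1 v\<bar> \<le> (K1 + K2) * max \<bar>u\<bar> \<bar>v\<bar> * \<bar>u - v\<bar>"
      by (rule order_trans[OF l1[OF d12(1,2)] k(1)])
    show "\<bar>r2 u - r2 v\<bar> \<le> (K1 + K2) * max \<bar>u\<bar> \<bar>v\<bar> * \<bar>u - v\<bar>"
      by (rule order_trans[OF l2[OF d12(3,4)] k(2)])
  qed
  let ?G = "reduced_field f1 f2 \<alpha>1" and ?P = "planar_domain U"
  have inP: "(x, y) \<in> ?P" if "x\<^sup>2 < d" for x y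
    using K1(3)[of "x\<^sup>2"] that by (simp add: planar_domain_def d_def)
  have planar: "is_solution (planar_field f1 f2 \<omega> m) ?P I (\<lambda>t. (x t, y t)) \<longleftrightarrow>
      (\<forall>t\<in>I. (x t, y t) \<in> ?P) \<and> sol m I x y" for m I x y
  proof -
    have e: "\<omega> * x t + (- (1 / \<omega>) * f1 ((x t)\<^sup>2, 0) * x t + f2 ((x t)\<^sup>2, 0) * y t) + m * y t
      = \<omega> * x t + n3 (x t) (y t) + n5 (x t) (y t) + m * y t" for t
      by (simp add: n3_def n5_def r1_def r2_def algebra_simps power3_eq_cube power2_eq_square)
    show ?thesis
      unfolding is_solution_planar_iff sol_def e by (auto simp: planar_domain_def)
  qed
  \<comment> \<open>Closed orbits of the reduced and of the planar system correspond through
    \<open>y2 = - \<omega> y\<close>.\<close>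
  have orbit: "closed_orbit (?G m) ?P \<Gamma> T \<longleftrightarrow> (\<exists>x y. (\<forall>t. (x t, y t) \<in> ?P) \<and> sol m UNIV x y \<and> 0 < T \<and>
      (\<forall>t. x (t + T) = x t \<and> y (t + T) = y t) \<and> (\<forall>s. 0 < s \<and> s < T \<longrightarrow> (x s, y s) \<noteq> (x 0, y 0)) \<and>
      \<Gamma> = range (\<lambda>t. (x t, - \<omega> * y t)))" for m \<Gamma> T
  proof
    assume "closed_orbit (?G m) ?P \<Gamma> T"
    then obtain X where X: "is_solution (?G m) ?P UNIV X" "0 < T" "\<forall>t. X (t + T) = X t"
      "\<forall>s. 0 < s \<and> s < T \<longrightarrow> X s \<noteq> X 0" "\<Gamma> = range X" unfolding closed_orbit_def by blast
    define x y where "x t = fst (X t)" and "y t = - snd (X t) / \<omega>" for t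
    have "is_solution (?G m) ?P UNIV (\<lambda>t. (fst (X t), snd (X t)))" using X(1) by simp
    then have "(\<forall>t\<in>UNIV. (x t, y t) \<in> ?P) \<and> sol m UNIV x y"
      unfolding reduced_iff_planar[OF \<alpha>1 \<omega>] planar x_def y_def .
    moreover have XX: "X t = (x t, - \<omega> * y t)" for t using \<omega> by (simp add: x_def y_def)
    have "(x s, y s) \<noteq> (x 0, y 0)" if "0 < s \<and> s < T" for s
      using X(4)[rule_format, OF that] unfolding XX by auto
    moreover have "x (t + T) = x t \<and> y (t + T) = y t" for t using X(3) by (simp add: x_def y_def)
    moreover have "\<Gamma> = range (\<lambda>t. (x t, - \<omega> * y t))" unfolding X(5) XX[symmetric] ..
    ultimately show "\<exists>x y. (\<forall>t. (x t, y t) \<in> ?P) \<and> sol m UNIV x y \<and> 0 < T \<and>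
      (\<forall>t. x (t + T) = x t \<and> y (t + T) = y t) \<and> (\<forall>s. 0 < s \<and> s < T \<longrightarrow> (x s, y s) \<noteq> (x 0, y 0)) \<and>
      \<Gamma> = range (\<lambda>t. (x t, - \<omega> * y t))" using X(2) by blast
  next
    assume "\<exists>x y. (\<forall>t. (x t, y t) \<in> ?P) \<and> sol m UNIV x y \<and> 0 < T \<and>
      (\<forall>t. x (t + T) = x t \<and> y (t + T) = y t) \<and> (\<forall>s. 0 < s \<and> s < T \<longrightarrow> (x s, y s) \<noteq> (x 0, y 0)) \<and>
      \<Gamma> = range (\<lambda>t. (x t, - \<omega> * y t))"
    then obtain x y where xy: "\<forall>t. (x t, y t) \<in> ?P" "sol m UNIV x y" "0 < T"
      "\<forall>t. x (t + T) = x t \<and> y (t + T) = y t" "\<forall>s. 0 < s \<and> s < T \<longrightarrow> (x s, y s) \<noteq> (x 0, y 0)"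
      "\<Gamma> = range (\<lambda>t. (x t, - \<omega> * y t))" by blast
    have "is_solution (planar_field f1 f2 \<omega> m) ?P UNIV (\<lambda>t. (x t, - (- \<omega> * y t) / \<omega>))"
      using xy(1,2) \<omega> unfolding planar by simp
    then have "is_solution (?G m) ?P UNIV (\<lambda>t. (x t, - \<omega> * y t))"
      unfolding reduced_iff_planar[OF \<alpha>1 \<omega>] .
    then show "closed_orbit (?G m) ?P \<Gamma> T"
      unfolding closed_orbit_def using xy(3-6) \<omega>(1) by (intro exI[of _ "\<lambda>t. (x t, - \<omega> * y t)"]) auto
  qed
  obtain C el rl where loc0: "0 \<le> C" "0 < el" "0 < rl" "rl\<^sup>2 \<le> d" and loc:
    "\<And>m x y T t. \<bar>m\<bar> < el \<Longrightarrow> sol m UNIV x y \<Longrightarrow> 0 < T \<Longrightarrow> (\<And>t. x (t + T) = x t \<and> y (t + T) = y t) \<Longrightarrow>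
      (\<And>t. cmod (Complex (x t) (y t)) < rl) \<Longrightarrow> (\<exists>t. Complex (x t) (y t) \<noteq> 0) \<Longrightarrow>
      m * c < 0 \<and> Complex (x t) (y t) \<noteq> 0 \<and>
      \<bar>cmod (nf m (Complex (x t) (y t))) - sqrt (- 4 * m / c)\<bar> \<le> C * \<bar>m\<bar> * sqrt (- 4 * m / c) \<and>
      \<bar>cmod (Complex (x t) (y t)) - sqrt (- 4 * m / c)\<bar> \<le> C * \<bar>m\<bar> * sqrt (- 4 * m / c)"
    by (rule localization) blast
  obtain e0 k where e0: "0 < e0" "0 \<le> k" and cyc: "\<And>m. \<bar>m\<bar> < e0 \<Longrightarrow> m * c < 0 \<Longrightarrow> \<exists>x y T. cycle k m x y T"
    by (rule planar_limit_cycle) blast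
  have "\<exists>x y T. \<bar>m\<bar> < e0 \<longrightarrow> m * c < 0 \<longrightarrow> cycle k m x y T" for m
    using cyc[of m] by blast
  then obtain X Y T where cycle: "\<And>m. \<bar>m\<bar> < e0 \<Longrightarrow> m * c < 0 \<Longrightarrow> cycle k m (X m) (Y m) (T m)"
    by metis
  have XYT: "sol m UNIV (X m) (Y m)" "0 < T m" "X m (t + T m) = X m t \<and> Y m (t + T m) = Y m t"
       "\<forall>s. 0 < s \<and> s < T m \<longrightarrow> (X m s, Y m s) \<noteq> (X m 0, Y m 0)"
       "\<bar>2 * pi / T m - \<omega>\<bar> \<le> k * \<bar>m\<bar>"
       "Complex (X m t) (Y m t) \<noteq> 0" "Vl \<le> \<bar>m\<bar> / (cmod (Complex (X m t) (Y m t)))\<^sup>2"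
    if "\<bar>m\<bar> < e0" "m * c < 0" for m t
    using cycle[OF that] by (simp_all add: cycle_def annular_def)
  have XYT_unique: "range (\<lambda>t. (x' t, y' t)) = range (\<lambda>t. (X m t, Y m t))"
    if "\<bar>m\<bar> < e0" "m * c < 0" "annular m x' y' T'" for m x' y' T'
    using cycle[OF that(1,2)] that(3) unfolding cycle_def by meson
  define Z where "Z m t = Complex (X m t) (Y m t)" for m t
  define \<Gamma> where "\<Gamma> m = range (\<lambda>t. (X m t, - \<omega> * Y m t))" for m
  have c0: "0 < \<bar>c\<bar>" using c_nz by simp
  \<comment> \<open>\<open>C |m| <= 1/4\<close> puts \<open>|\<zeta>|\<close> between 3/4 and 5/4 of
    the predicted amplitude; \<open>|m| < rl^2 Vl\<close> puts the cycle inside the radius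
    \<open>rl\<close> that \<open>localization\<close> asks for.\<close>
  define eps where "eps = min (min el e0) (min (1 / (4 * (C + 1))) (rl\<^sup>2 * Vl))"
  have eps: "0 < eps" "eps \<le> el" "eps \<le> e0" "eps \<le> 1 / (4 * (C + 1))" "eps \<le> rl\<^sup>2 * Vl"
    using loc0 e0 Vl_pos by (auto simp: eps_def)
  have Zsq: "(cmod (Z m t))\<^sup>2 \<le> \<bar>m\<bar> / Vl" "Z m t \<noteq> 0" if "\<bar>m\<bar> < e0" "m * c < 0" for m t
  proof -
    have h: "Z m t \<noteq> 0" "Vl \<le> \<bar>m\<bar> / (cmod (Z m t))\<^sup>2" unfolding Z_def by (rule XYT[OF that])+
    then have "Vl * (cmod (Z m t))\<^sup>2 \<le> \<bar>m\<bar>" by (simp add: pos_le_divide_eq)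
    then show "(cmod (Z m t))\<^sup>2 \<le> \<bar>m\<bar> / Vl" using Vl_pos by (simp add: pos_le_divide_eq mult.commute)
    show "Z m t \<noteq> 0" by (fact h(1))
  qed
  have Zr: "cmod (Z m t) < rl" if "\<bar>m\<bar> < eps" "m * c < 0" for m t
  proof -
    have "(cmod (Z m t))\<^sup>2 \<le> \<bar>m\<bar> / Vl" using that eps by (intro Zsq) auto
    also have "\<dots> < rl\<^sup>2" using that eps Vl_pos by (simp add: pos_divide_less_eq)
    finally show ?thesis using loc0(3) by (simp add: power_less_imp_less_base)
  qed
  have amp: "\<bar>cmod (nf m (Z m t)) - sqrt (- 4 * m / c)\<bar> \<le> C * \<bar>m\<bar> * sqrt (- 4 * m / c) \<and>
      \<bar>cmod (Z m t) - sqrt (- 4 * m / c)\<bar> \<le> C * \<bar>m\<bar> * sqrt (- 4 * m / c)" if m: "\<bar>m\<bar> < eps" "m * c < 0" for m t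
  proof -
    have me: "\<bar>m\<bar> < el" "\<bar>m\<bar> < e0" using m eps by auto
    have "\<exists>t. Complex (X m t) (Y m t) \<noteq> 0" using Zsq(2)[OF me(2) m(2)] by (auto simp: Z_def)
    from loc[OF me(1) XYT(1,2,3)[OF me(2) m(2)] Zr[OF m, unfolded Z_def] this, of t] show ?thesis by (simp add: Z_def)
  qed
  \<comment> \<open>For any closed orbit in the neighbourhood, \<open>localization\<close> settles
    the side of the bifurcation and the annulus, and \<open>cycle\<close> then identifies the
    orbit.\<close>
  have unique: "m * c < 0 \<and> \<Gamma>' = \<Gamma> m"
    if m: "\<bar>m\<bar> < eps" and orb: "closed_orbit (?G m) ?P \<Gamma>' T'"
      and V: "\<Gamma>' \<subseteq> {q. cmod (Complex (fst q) (- snd q / \<omega>)) < rl}" for m \<Gamma>' T'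
  proof -
    have me: "\<bar>m\<bar> < el" "\<bar>m\<bar> < e0" using m eps by auto
    obtain x y where xy: "sol m UNIV x y" "0 < T'" "\<And>t. x (t + T') = x t \<and> y (t + T') = y t"
      "\<forall>s. 0 < s \<and> s < T' \<longrightarrow> (x s, y s) \<noteq> (x 0, y 0)" "\<Gamma>' = range (\<lambda>t. (x t, - \<omega> * y t))"
      using orb unfolding orbit by blast
    have small: "cmod (Complex (x t) (y t)) < rl" for t
    proof -
      have "(x t, - \<omega> * y t) \<in> {q. cmod (Complex (fst q) (- snd q / \<omega>)) < rl}" using V unfolding xy(5) by blast
      then show ?thesis using \<omega> by simp
    qed
    obtain t0 where "(x t0, y t0) \<noteq> (0, 0)"
      using closed_orbit_nonconstant[OF xy(2), of "\<lambda>t. (x t, y t)" "(0, 0)"] xy(4) by auto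
    then have nz: "\<exists>t. Complex (x t) (y t) \<noteq> 0" by (auto simp: complex_eq_iff)
    note l = loc[OF me(1) xy(1,2,3) small nz]
    have mc: "m * c < 0" using l by blast
    define s0 where "s0 = sqrt (- 4 * m / c)"
    have s0: "s0\<^sup>2 = 4 * \<bar>m\<bar> / \<bar>c\<bar>" "0 < s0"
    proof -
      have "- 4 * m / c = 4 * \<bar>m\<bar> / \<bar>c\<bar>" using mc by (auto simp: mult_less_0_iff abs_if)
      moreover have "0 < \<bar>m\<bar>" using mc by auto
      ultimately show "s0\<^sup>2 = 4 * \<bar>m\<bar> / \<bar>c\<bar>" "0 < s0" using c0 by (auto simp: s0_def)
    qed
    have Cm: "C * \<bar>m\<bar> \<le> 1 / 4"
    proof -
      have "C * \<bar>m\<bar> \<le> (C + 1) * (1 / (4 * (C + 1)))" using m eps loc0 by (intro mult_mono) auto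
      also have "\<dots> = 1 / 4" using loc0(1) by (simp add: field_simps)
      finally show ?thesis .
    qed
    \<comment> \<open>The quotient lies between \<open>4/25 |c|\<close> and \<open>4/9 |c|\<close>,
      hence in the window from \<open>|c| / 8\<close> to \<open>|c| / 2\<close>.\<close>
    have "\<bar>m\<bar> / (cmod (Complex (x t) (y t)))\<^sup>2 \<in> {Vl..Vu}" for t
    proof -
      define z where "z = cmod (Complex (x t) (y t))"
      have "\<bar>z - s0\<bar> \<le> C * \<bar>m\<bar> * s0" using l by (simp add: z_def s0_def)
      also have "\<dots> \<le> 1 / 4 * s0" using Cm s0(2) by (intro mult_right_mono) auto
      finally have z: "3 / 4 * s0 \<le> z" "z \<le> 5 / 4 * s0" by linarith+
      then have z0: "0 < z" using s0(2) by linarith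
      have "(3 / 4 * s0)\<^sup>2 \<le> z\<^sup>2" "z\<^sup>2 \<le> (5 / 4 * s0)\<^sup>2" using z z0 s0 by (intro power_mono; simp)+
      then have zz: "9 / 16 * s0\<^sup>2 \<le> z\<^sup>2" "z\<^sup>2 \<le> 25 / 16 * s0\<^sup>2" by (simp_all add: power2_eq_square)
      have ms: "\<bar>m\<bar> = \<bar>c\<bar> * s0\<^sup>2 / 4" using s0(1) c0 by simp
      have "\<bar>c\<bar> * (9 / 16 * s0\<^sup>2) \<le> \<bar>c\<bar> * z\<^sup>2" "\<bar>c\<bar> * z\<^sup>2 \<le> \<bar>c\<bar> * (25 / 16 * s0\<^sup>2)"
        using zz c0 by (intro mult_left_mono; simp)+
      then have "\<bar>c\<bar> / 8 * z\<^sup>2 \<le> \<bar>m\<bar>" "\<bar>m\<bar> \<le> \<bar>c\<bar> / 2 * z\<^sup>2" unfolding ms using c0 s0 mult_pos_pos[OF c0, of "s0\<^sup>2"] by simp_all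
      then show ?thesis using z0 by (simp add: z_def[symmetric] Vl_def Vu_def pos_le_divide_eq pos_divide_le_eq)
    qed
    then have "annular m x y T'" unfolding annular_def using xy(1,2,3) l by blast
    then have "range (\<lambda>t. (x t, y t)) = range (\<lambda>t. (X m t, Y m t))" by (rule XYT_unique[OF me(2) mc])
    then have "(\<lambda>q. (fst q, - \<omega> * snd q)) ` range (\<lambda>t. (x t, y t)) = (\<lambda>q. (fst q, - \<omega> * snd q)) ` range (\<lambda>t. (X m t, Y m t))"
      by simp
    then have "\<Gamma>' = \<Gamma> m" unfolding xy(5) \<Gamma>_def by (simp add: image_image)
    with mc show ?thesis by blast
  qed
  \<comment> \<open>The disk of radius \<open>rl\<close> of the planar system, written in the
    coordinates \<open>(y1, y2)\<close>.\<close>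
  define V where "V = {q. cmod (Complex (fst q) (- snd q / \<omega>)) < rl}"
  have "open V"
  proof -
    have "continuous_on UNIV (\<lambda>q::real \<times> real. cmod (of_real (fst q) + \<i> * of_real (- snd q / \<omega>)))"
      by (intro continuous_intros) (use \<omega> in auto)
    then show ?thesis unfolding V_def Complex_eq by (intro open_Collect_less) (auto intro: continuous_intros)
  qed
  have V0: "0 \<in> V" using loc0 by (simp add: V_def zero_prod_def flip: zero_complex.code)
  have \<Gamma>V: "\<Gamma> m \<subseteq> V" if "\<bar>m\<bar> < eps" "m * c < 0" for m
    using Zr[OF that] \<omega> by (auto simp: \<Gamma>_def V_def Z_def)
  have \<Gamma>orb: "closed_orbit (?G m) ?P (\<Gamma> m) (T m)" if m: "\<bar>m\<bar> < eps" "m * c < 0" for m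
  proof -
    have me: "\<bar>m\<bar> < e0" using m eps by auto
    have "(X m t, Y m t) \<in> ?P" for t
    proof (rule inP)
      have "(X m t)\<^sup>2 \<le> (cmod (Z m t))\<^sup>2" by (simp add: Z_def cmod_power2)
      also have "\<dots> < rl\<^sup>2" using Zr[OF m, of t] by (intro power_strict_mono) auto
      finally show "(X m t)\<^sup>2 < d" using loc0(4) by linarith
    qed
    then show ?thesis unfolding orbit \<Gamma>_def
      using XYT(1-4)[OF me m(2)] by (intro exI[of _ "X m"] exI[of _ "Y m"] conjI allI; simp)
  qed
  have sgnc: "0 < - sgn c * m \<longleftrightarrow> m * c < 0" "\<bar>- sgn c * m\<bar> = \<bar>m\<bar>" for m
    using c_nz by (auto simp: sgn_if mult_less_0_iff zero_less_mult_iff)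
  have side: "0 < - 4 * m / c \<longleftrightarrow> m * c < 0" for m
    using c_nz by (simp add: zero_less_divide_iff divide_less_0_iff mult_less_0_iff)
  have ev: "\<forall>\<^sub>F m in at 0 within {m. m * c < 0}. \<bar>m\<bar> < h \<and> m * c < 0" if "0 < h" for h
    unfolding eventually_at using that by (intro exI[of _ h]) (auto simp: dist_real_def)
  have branch: "limit_cycle_branch ?G ?P 0 0 (- sgn c) \<Gamma> T"
    unfolding limit_cycle_branch_def diff_zero
  proof (intro conjI exI[of _ eps] exI[of _ V] allI impI)
    fix m assume "0 < - sgn c * m \<and> - sgn c * m < eps"
    then have m: "\<bar>m\<bar> < eps" "m * c < 0" using sgnc by (metis abs_of_pos)+
    show "\<Gamma> m \<subseteq> V" by (rule \<Gamma>V[OF m])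
    show "limit_cycle (?G m) ?P (\<Gamma> m) (T m)"
      unfolding limit_cycle_def
      using \<Gamma>orb[OF m] \<Gamma>V[OF m] \<open>open V\<close> unique[OF m(1)] unfolding V_def by blast
    show "\<Gamma>' = \<Gamma> m" if "closed_orbit (?G m) ?P \<Gamma>' T' \<and> \<Gamma>' \<subseteq> V" for \<Gamma>' T'
      using unique[OF m(1)] that unfolding V_def by blast
  next
    fix m assume h: "- eps < - sgn c * m \<and> - sgn c * m \<le> 0"
    then have m: "\<bar>m\<bar> < eps" using sgnc(2)[of m] by linarith
    have "\<not> m * c < 0" using h sgnc(1)[of m] by linarith
    then show "\<not> (\<exists>\<Gamma>' T'. closed_orbit (?G m) ?P \<Gamma>' T' \<and> \<Gamma>' \<subseteq> V)"
      using unique[OF m] unfolding V_def by blast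
  next
    fix r :: real assume r: "0 < r"
    \<comment> \<open>From \<open>norm (y1, y2) <= (1 + \<omega>) |\<zeta>|\<close> and
      \<open>|\<zeta>|^2 <= |m| / Vl\<close> on the cycle.\<close>
    define h where "h = min eps (Vl * (r / (1 + \<omega>))\<^sup>2)"
    have h: "0 < h" using eps Vl_pos r \<omega> by (simp add: h_def)
    have sub: "\<Gamma> m \<subseteq> ball 0 r" if m: "\<bar>m\<bar> < h" "m * c < 0" for m
    proof -
      have "norm (X m t, - \<omega> * Y m t) < r" for t
      proof -
        have "(cmod (Z m t))\<^sup>2 \<le> \<bar>m\<bar> / Vl" using m eps by (intro Zsq) (auto simp: h_def)
        also have "\<dots> < (r / (1 + \<omega>))\<^sup>2" using m(1) Vl_pos by (simp add: h_def pos_divide_less_eq mult.commute)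
        finally have "cmod (Z m t) < r / (1 + \<omega>)"
          by (rule power_less_imp_less_base) (use r \<omega> in simp)
        then have z: "(1 + \<omega>) * cmod (Z m t) < r" using \<omega> by (simp add: pos_less_divide_eq mult.commute)
        have "norm (X m t, - \<omega> * Y m t) \<le> \<bar>X m t\<bar> + \<omega> * \<bar>Y m t\<bar>"
          using norm_Pair_le[of "X m t" "- \<omega> * Y m t"] \<omega> by (simp add: abs_mult)
        also have "\<dots> \<le> cmod (Z m t) + \<omega> * cmod (Z m t)"
          using abs_Re_le_cmod[of "Z m t"] abs_Im_le_cmod[of "Z m t"] \<omega>
          by (intro add_mono mult_left_mono) (auto simp: Z_def)
        finally show ?thesis using z by (simp add: distrib_right)
      qed
      then show ?thesis by (auto simp: \<Gamma>_def)
    qed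
    show "\<forall>\<^sub>F m in at 0 within {m. 0 < - sgn c * m}. \<Gamma> m \<subseteq> ball 0 r"
      unfolding sgnc(1) by (rule eventually_mono[OF ev[OF h]]) (use sub in blast)
  qed (use eps V0 \<open>open V\<close> in auto)
  have freq: "((\<lambda>m. 2 * pi / T m) \<longlongrightarrow> \<omega>) (at 0 within {m. m * c < 0})"
  proof (rule LIM_zero_cancel, rule Lim_null_comparison)
    show "((\<lambda>m. k * \<bar>m\<bar>) \<longlongrightarrow> 0) (at 0 within {m. m * c < 0})"
      by (auto intro!: tendsto_eq_intros)
    show "\<forall>\<^sub>F m in at 0 within {m. m * c < 0}. norm (2 * pi / T m - \<omega>) \<le> k * \<bar>m\<bar>"
      using ev[OF e0(1)]
    proof (rule eventually_mono)
      fix m assume "\<bar>m\<bar> < e0 \<and> m * c < 0"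
      then show "norm (2 * pi / T m - \<omega>) \<le> k * \<bar>m\<bar>" using XYT(5)[of m] by simp
    qed
  qed
  have pnf: "polar_normal_form (planar_field f1 f2 \<omega>) ?P nf (\<lambda>m. m / 2) om (1 / 8 * c) (Im (N21 0))"
  proof -
    obtain \<epsilon> r C A B R Q where pn: "0 < \<epsilon>" "0 < r" "near_identity_change \<epsilon> r nf"
      "\<And>\<mu>. \<bar>\<mu>\<bar> < \<epsilon> \<Longrightarrow> \<bar>A \<mu> - c / 8\<bar> \<le> C * \<bar>\<mu>\<bar> \<and> \<bar>B \<mu> - Im (N21 0)\<bar> \<le> C * \<bar>\<mu>\<bar>"
      "\<And>\<mu> \<rho> \<theta>. \<bar>\<mu>\<bar> < \<epsilon> \<Longrightarrow> 0 < \<rho> \<Longrightarrow> \<bar>R \<mu> \<rho> \<theta>\<bar> \<le> C * \<rho> ^ 4 \<and> \<bar>Q \<mu> \<rho> \<theta>\<bar> \<le> C * \<rho> ^ 4"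
      "\<And>\<mu> I x y \<rho> \<theta> t. \<bar>\<mu>\<bar> < \<epsilon> \<Longrightarrow> sol \<mu> I x y \<Longrightarrow>
         (\<forall>t\<in>I. Complex (x t) (y t) \<in> ball 0 r \<and> 0 < \<rho> t \<and>
            nf \<mu> (Complex (x t) (y t)) = of_real (\<rho> t) * cis (\<theta> t)) \<Longrightarrow> continuous_on I \<theta> \<Longrightarrow> t \<in> I \<Longrightarrow>
         (\<rho> has_real_derivative \<rho> t * (\<mu> / 2 + A \<mu> * (\<rho> t)\<^sup>2 + R \<mu> (\<rho> t) (\<theta> t))) (at t within I) \<and>
         (\<theta> has_real_derivative om \<mu> + B \<mu> * (\<rho> t)\<^sup>2 + Q \<mu> (\<rho> t) (\<theta> t)) (at t within I)"
      by (rule polar_normal_form_exists) blast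
    show ?thesis
      unfolding polar_normal_form_def
    proof (rule exI[of _ \<epsilon>], rule conjI[OF pn(1)], rule exI[of _ r], rule conjI[OF pn(2)],
          rule exI[of _ C], rule exI[of _ A], rule exI[of _ B], rule exI[of _ R], rule exI[of _ Q],
          intro conjI allI impI ballI)
      show "near_identity_change \<epsilon> r nf" by fact
      show "\<bar>A \<mu> - 1 / 8 * c\<bar> \<le> C * \<bar>\<mu>\<bar>" "\<bar>B \<mu> - Im (N21 0)\<bar> \<le> C * \<bar>\<mu>\<bar>" if "\<bar>\<mu>\<bar> < \<epsilon>" for \<mu>
        using pn(4)[OF that] by simp_all
      show "\<bar>R \<mu> \<rho> \<theta>\<bar> \<le> C * \<rho> ^ 4" "\<bar>Q \<mu> \<rho> \<theta>\<bar> \<le> C * \<rho> ^ 4" if "\<bar>\<mu>\<bar> < \<epsilon> \<and> 0 < \<rho>" for \<mu> \<rho> \<theta>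
        using pn(5)[of \<mu> \<rho> \<theta>] that by simp_all
      fix \<mu> I x y \<rho> \<theta> t
      assume h: "\<bar>\<mu>\<bar> < \<epsilon> \<and> is_interval I \<and> is_solution (planar_field f1 f2 \<omega> \<mu>) ?P I (\<lambda>t. (x t, y t)) \<and>
          (\<forall>t\<in>I. Complex (x t) (y t) \<in> ball 0 r \<and> 0 < \<rho> t \<and>
             nf \<mu> (Complex (x t) (y t)) = of_real (\<rho> t) * cis (\<theta> t)) \<and> continuous_on I \<theta>" and t: "t \<in> I"
      then have "\<bar>\<mu>\<bar> < \<epsilon>" "sol \<mu> I x y" "\<forall>t\<in>I. Complex (x t) (y t) \<in> ball 0 r \<and> 0 < \<rho> t \<and>
             nf \<mu> (Complex (x t) (y t)) = of_real (\<rho> t) * cis (\<theta> t)" "continuous_on I \<theta>"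
        unfolding planar by blast+
      from pn(6)[OF this t]
      show "(\<rho> has_real_derivative \<rho> t * (\<mu> / 2 + A \<mu> * (\<rho> t)\<^sup>2 + R \<mu> (\<rho> t) (\<theta> t))) (at t within I)"
        "(\<theta> has_real_derivative om \<mu> + B \<mu> * (\<rho> t)\<^sup>2 + Q \<mu> (\<rho> t) (\<theta> t)) (at t within I)"
        by blast+
    qed
  qed
  have om: "om = (\<lambda>m. sqrt (- \<alpha>1 - (m / 2)\<^sup>2))" by (simp add: om_def[abs_def] \<omega>(2))
  \<comment> \<open>The predicted amplitude is \<open>2 sqrt |m| / sqrt |c|\<close>, so a relative
    error \<open>C |m|\<close> is an absolute error of order 3/2.\<close>
  define C' where "C' = C * (2 / sqrt \<bar>c\<bar>)"
  have ampl: "\<forall>\<^sub>F m in at 0 within {m. m * c < 0}. \<forall>(y1, y2) \<in> \<Gamma> m.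
         let \<zeta> = Complex y1 (- y2 / \<omega>) in
           \<bar>cmod (nf m \<zeta>) - sqrt (- 4 * m / c)\<bar> \<le> C' * \<bar>m\<bar> powr (3 / 2) \<and>
           \<bar>cmod \<zeta> - sqrt (- 4 * m / c)\<bar> \<le> C' * \<bar>m\<bar> powr (3 / 2)"
    using ev[OF eps(1)]
  proof (rule eventually_mono)
    fix m assume m: "\<bar>m\<bar> < eps \<and> m * c < 0"
    have "- 4 * m / c = 4 * \<bar>m\<bar> / \<bar>c\<bar>" using m by (auto simp: mult_less_0_iff abs_if)
    then have s0: "sqrt (- 4 * m / c) = 2 * sqrt \<bar>m\<bar> / sqrt \<bar>c\<bar>"
      by (simp add: real_sqrt_divide real_sqrt_mult)
    have "0 < \<bar>m\<bar>" using m by auto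
    then have "\<bar>m\<bar> * sqrt \<bar>m\<bar> = \<bar>m\<bar> powr (3 / 2)"
      using powr_add[of "\<bar>m\<bar>" 1 "1 / 2"] by (simp add: powr_half_sqrt)
    then have eq: "C * \<bar>m\<bar> * sqrt (- 4 * m / c) = C' * \<bar>m\<bar> powr (3 / 2)"
      unfolding s0 C'_def by (metis (no_types, opaque_lifting) mult.assoc mult.commute times_divide_eq_left times_divide_eq_right)
    have z: "Complex (X m t) (- (- \<omega> * Y m t) / \<omega>) = Z m t" for t using \<omega> by (simp add: Z_def)
    show "\<forall>(y1, y2) \<in> \<Gamma> m. let \<zeta> = Complex y1 (- y2 / \<omega>) in
           \<bar>cmod (nf m \<zeta>) - sqrt (- 4 * m / c)\<bar> \<le> C' * \<bar>m\<bar> powr (3 / 2) \<and>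
           \<bar>cmod \<zeta> - sqrt (- 4 * m / c)\<bar> \<le> C' * \<bar>m\<bar> powr (3 / 2)"
    proof
      fix q assume "q \<in> \<Gamma> m"
      then obtain t where q: "q = (X m t, - \<omega> * Y m t)" by (auto simp: \<Gamma>_def)
      show "case q of (y1, y2) \<Rightarrow> let \<zeta> = Complex y1 (- y2 / \<omega>) in
           \<bar>cmod (nf m \<zeta>) - sqrt (- 4 * m / c)\<bar> \<le> C' * \<bar>m\<bar> powr (3 / 2) \<and>
           \<bar>cmod \<zeta> - sqrt (- 4 * m / c)\<bar> \<le> C' * \<bar>m\<bar> powr (3 / 2)"
        using amp[of m t] m unfolding q prod.case Let_def z eq by blast
    qed
  qed
  have sets: "{\<alpha>2. 0 < - 4 * \<alpha>2 / c} = {m. m * c < 0}" using side by blast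
  show ?thesis
    unfolding sets \<omega>_def[symmetric]
    using branch freq pnf[unfolded om] ampl by blast
qed

section \<open>The full system\<close>

lemma is_solution_full_iff:
  "is_solution (full_field f1 f2 f3 f4 \<alpha>1 \<alpha>2 \<alpha>3) (full_domain U) I (\<lambda>t. (y1 t, y2 t, z t)) \<longleftrightarrow>
     (\<forall>t\<in>I. ((y1 t)\<^sup>2, (cmod (z t))\<^sup>2) \<in> U \<and> (y1 has_real_derivative y2 t) (at t within I) \<and>
       (y2 has_real_derivative (\<alpha>1 + f1 ((y1 t)\<^sup>2, (cmod (z t))\<^sup>2)) * y1 t
          + (\<alpha>2 + f2 ((y1 t)\<^sup>2, (cmod (z t))\<^sup>2)) * y2 t) (at t within I) \<and>
       (z has_vector_derivative (\<i> + of_real \<alpha>3 + of_real (f3 ((y1 t)\<^sup>2, (cmod (z t))\<^sup>2))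
          + \<i> * of_real (f4 ((y1 t)\<^sup>2, (cmod (z t))\<^sup>2))) * z t) (at t within I))"
  unfolding is_solution_def full_field_def full_domain_def Let_def
  by (simp add: has_vector_derivative_Pair_iff has_real_derivative_iff_has_vector_derivative)

lemma full_plane_iff:
  "is_solution (full_field f1 f2 f3 f4 \<alpha>1 \<alpha>2 \<alpha>3) (full_domain U) I (\<lambda>t. (y1 t, y2 t, 0)) \<longleftrightarrow>
   is_solution (reduced_field f1 f2 \<alpha>1 \<alpha>2) (planar_domain U) I (\<lambda>t. (y1 t, y2 t))"
  unfolding is_solution_full_iff is_solution_reduced_iff by simp

lemma cmod_squared_deriv_linear:
  assumes "(z has_vector_derivative (\<i> + of_real a + of_real b + \<i> * of_real e) * z t) (at t within I)"
  shows "((\<lambda>t. (cmod (z t))\<^sup>2) has_real_derivative 2 * (a + b) * (cmod (z t))\<^sup>2) (at t within I)"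
proof -
  have Re: "Re (cnj w * (k * w)) = Re k * (cmod w)\<^sup>2" for w k
    unfolding cmod_power2 by (simp add: power2_eq_square algebra_simps)
  show ?thesis
    using cmod_power2_deriv[OF assms] unfolding Re by (simp add: algebra_simps)
qed

text \<open>\<open>|z|^2\<close> solves a linear homogeneous equation with coefficient
  \<open>2 (\<alpha>3 + f3)\<close>, which is bounded on the compact interval between
  \<open>t0\<close> and \<open>t\<close>; zeros then propagate in either direction of time.\<close>

lemma plane_invariant:
  assumes f3: "continuous_on U f3" and I: "is_interval I"
    and sol: "is_solution (full_field f1 f2 f3 f4 \<alpha>1 \<alpha>2 \<alpha>3) (full_domain U) I (\<lambda>t. (y1 t, y2 t, z t))"
    and t0: "t0 \<in> I" "z t0 = 0" and t: "t \<in> I"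
  shows "z t = 0"
proof -
  define a b where "a = min t0 t" and "b = max t0 t"
  have "a \<in> I" "b \<in> I" using t0(1) t by (simp_all add: a_def b_def min_def max_def)
  then have "{a..b} \<subseteq> I" using I unfolding is_interval_1 by (meson atLeastAtMost_iff subsetI)
  moreover have "a \<le> b" by (simp add: a_def b_def)
  ultimately have ab: "a \<le> b" "{a..b} \<subseteq> I" by blast+
  note s = sol[unfolded is_solution_full_iff]
  define q where "q t = ((y1 t)\<^sup>2, (cmod (z t))\<^sup>2)" for t
  define u' where "u' t = 2 * (\<alpha>3 + f3 (q t)) * (cmod (z t))\<^sup>2" for t
  have "continuous_on I y1" using s by (intro DERIV_continuous_on) blast
  moreover have "continuous_on I z"
    unfolding continuous_on_eq_continuous_within
    using s has_vector_derivative_continuous by blast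
  ultimately have "continuous_on I q" unfolding q_def by (intro continuous_intros)
  then have "continuous_on {a..b} (\<lambda>t. f3 (q t))"
    using s ab(2) by (intro continuous_on_compose2[OF f3 continuous_on_subset]) (auto simp: q_def)
  then have "bounded ((\<lambda>t. f3 (q t)) ` {a..b})"
    by (intro compact_imp_bounded compact_continuous_image) auto
  then obtain M where M: "\<forall>t\<in>{a..b}. \<bar>f3 (q t)\<bar> \<le> M" unfolding bounded_iff by auto
  have "(cmod (z a))\<^sup>2 = 0 \<longleftrightarrow> (cmod (z b))\<^sup>2 = 0"
  proof (rule zero_propagates[OF ab(1), of "\<lambda>t. (cmod (z t))\<^sup>2" u' "2 * (\<bar>\<alpha>3\<bar> + M)"])
    fix t assume t: "t \<in> {a..b}"
    then have "t \<in> I" using ab by blast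
    with s have "((\<lambda>t. (cmod (z t))\<^sup>2) has_real_derivative u' t) (at t within I)"
      unfolding u'_def q_def by (intro cmod_squared_deriv_linear) blast
    then show "((\<lambda>t. (cmod (z t))\<^sup>2) has_real_derivative u' t) (at t within {a..b})"
      by (rule has_field_derivative_subset[OF _ ab(2)])
    have "\<bar>2 * (\<alpha>3 + f3 (q t))\<bar> \<le> 2 * (\<bar>\<alpha>3\<bar> + M)" using bspec[OF M t] abs_triangle_ineq[of \<alpha>3 "f3 (q t)"] unfolding abs_mult by simp
    then show "\<bar>u' t\<bar> \<le> 2 * (\<bar>\<alpha>3\<bar> + M) * (cmod (z t))\<^sup>2"
      unfolding u'_def abs_mult[of "2 * (\<alpha>3 + f3 (q t))"] by (simp add: mult_right_mono)
  qed auto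
  then show ?thesis using t0(2) unfolding a_def b_def by (auto simp: min_def max_def split: if_splits)
qed

abbreviation (input) emb :: "real \<times> real \<Rightarrow> real \<times> real \<times> complex" where
  "emb \<equiv> (\<lambda>(y1, y2). (y1, y2, 0))"

lemma closed_orbit_emb:
  assumes "closed_orbit (reduced_field f1 f2 \<alpha>1 \<alpha>2) (planar_domain U) \<Gamma> T"
  shows "closed_orbit (full_field f1 f2 f3 f4 \<alpha>1 \<alpha>2 \<alpha>3) (full_domain U) (emb ` \<Gamma>) T"
proof -
  obtain X where X: "is_solution (reduced_field f1 f2 \<alpha>1 \<alpha>2) (planar_domain U) UNIV X" "0 < T" "\<forall>t. X (t + T) = X t"
      "\<forall>s. 0 < s \<and> s < T \<longrightarrow> X s \<noteq> X 0" "\<Gamma> = range X" using assms unfolding closed_orbit_def by blast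
  have "is_solution (reduced_field f1 f2 \<alpha>1 \<alpha>2) (planar_domain U) UNIV (\<lambda>t. (fst (X t), snd (X t)))"
    using X(1) by simp
  from this[folded full_plane_iff[of f1 f2 f3 f4 \<alpha>1 \<alpha>2 \<alpha>3]]
  have "is_solution (full_field f1 f2 f3 f4 \<alpha>1 \<alpha>2 \<alpha>3) (full_domain U) UNIV (\<lambda>t. emb (X t))"
    by (simp add: case_prod_unfold)
  moreover have "emb (X s) \<noteq> emb (X 0)" if "0 < s \<and> s < T" for s
    using X(4)[rule_format, OF that] by (auto simp: case_prod_unfold prod_eq_iff)
  ultimately show ?thesis
    unfolding closed_orbit_def using X(2,3,5) by (intro exI[of _ "\<lambda>t. emb (X t)"]) (auto simp: image_image)
qed

text \<open>At the maximum of \<open>|z|^2\<close> its derivative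
  \<open>2 (\<alpha>3 + f3) |z|^2\<close> vanishes although the first factor does not, so the
  maximum is 0.\<close>

lemma closed_orbit_full_in_plane:
  assumes orb: "closed_orbit (full_field f1 f2 f3 f4 \<alpha>1 \<alpha>2 \<alpha>3) (full_domain U) \<Gamma>' T"
    and small: "\<And>y1 y2 z. (y1, y2, z) \<in> \<Gamma>' \<Longrightarrow> \<alpha>3 + f3 (y1\<^sup>2, (cmod z)\<^sup>2) \<noteq> 0"
  obtains \<Gamma> where "closed_orbit (reduced_field f1 f2 \<alpha>1 \<alpha>2) (planar_domain U) \<Gamma> T" "\<Gamma>' = emb ` \<Gamma>"
proof -
  obtain X where X: "is_solution (full_field f1 f2 f3 f4 \<alpha>1 \<alpha>2 \<alpha>3) (full_domain U) UNIV X" "0 < T" "\<forall>t. X (t + T) = X t"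
      "\<forall>s. 0 < s \<and> s < T \<longrightarrow> X s \<noteq> X 0" "\<Gamma>' = range X" using orb unfolding closed_orbit_def by blast
  define y1 y2 z where "y1 t = fst (X t)" and "y2 t = fst (snd (X t))" and "z t = snd (snd (X t))" for t
  have Xe: "X t = (y1 t, y2 t, z t)" for t by (simp add: y1_def y2_def z_def)
  have sol: "is_solution (full_field f1 f2 f3 f4 \<alpha>1 \<alpha>2 \<alpha>3) (full_domain U) UNIV (\<lambda>t. (y1 t, y2 t, z t))"
    using X(1) by (simp add: Xe[symmetric])
  define u where "u t = (cmod (z t))\<^sup>2" for t
  define u' where "u' t = 2 * (\<alpha>3 + f3 ((y1 t)\<^sup>2, (cmod (z t))\<^sup>2)) * (cmod (z t))\<^sup>2" for t
  have u': "(u has_real_derivative u' t) (at t)" for t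
    unfolding u_def u'_def using sol[unfolded is_solution_full_iff] by (intro cmod_squared_deriv_linear) blast
  have per: "u (t + T) = u t" for t using X(3) by (simp add: u_def z_def)
  obtain s where s: "u' s = 0" "\<And>t. u t \<le> u s"
    by (rule periodic_extrema[of u T u', OF per X(2) u']) blast
  have "(y1 s, y2 s, z s) \<in> \<Gamma>'" unfolding X(5) Xe[symmetric] by (rule rangeI)
  from small[OF this] s(1) have "u s = 0" by (simp add: u'_def u_def)
  then have "u t \<le> 0" for t using s(2)[of t] by simp
  then have z0: "z t = 0" for t by (simp add: u_def)
  have "is_solution (reduced_field f1 f2 \<alpha>1 \<alpha>2) (planar_domain U) UNIV (\<lambda>t. (y1 t, y2 t))"
    using sol unfolding z0 full_plane_iff .
  then have "closed_orbit (reduced_field f1 f2 \<alpha>1 \<alpha>2) (planar_domain U) (range (\<lambda>t. (y1 t, y2 t))) T"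
    unfolding closed_orbit_def using X(2-4) unfolding Xe z0
    by (intro exI[of _ "\<lambda>t. (y1 t, y2 t)"]) simp
  moreover have "\<Gamma>' = emb ` range (\<lambda>t. (y1 t, y2 t))"
    unfolding X(5) Xe z0 by (simp add: image_image)
  ultimately show thesis by (rule that)
qed

text \<open>The neighbourhood is narrowed in \<open>y1\<close> and \<open>z\<close> until
  \<open>|f3| < |\<alpha>3|\<close>. The cycles have to stay inside it as well, so the parameter
  range shrinks by a second constant \<open>h\<close>, obtained from their contraction to the
  origin.\<close>

lemma full_branch:
  assumes U: "open U" "(0, 0) \<in> U" and f3: "continuous_on U f3" "f3 (0, 0) = 0" and \<alpha>3: "\<alpha>3 \<noteq> 0"
    and s: "\<bar>s\<bar> = 1"
    and br: "limit_cycle_branch (reduced_field f1 f2 \<alpha>1) (planar_domain U) 0 0 s \<Gamma> T"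
  shows "limit_cycle_branch (\<lambda>\<alpha>2. full_field f1 f2 f3 f4 \<alpha>1 \<alpha>2 \<alpha>3) (full_domain U) 0 0 s
    (\<lambda>\<alpha>2. emb ` \<Gamma> \<alpha>2) T"
proof -
  let ?G = "reduced_field f1 f2 \<alpha>1" and ?P = "planar_domain U"
  let ?F = "\<lambda>\<alpha>2. full_field f1 f2 f3 f4 \<alpha>1 \<alpha>2 \<alpha>3" and ?S = "full_domain U"
  note br' = br[unfolded limit_cycle_branch_def diff_zero]
  obtain \<epsilon> V where \<epsilon>: "0 < \<epsilon>" and V: "open V" "0 \<in> V"
    and on: "\<forall>\<mu>. 0 < s * \<mu> \<and> s * \<mu> < \<epsilon> \<longrightarrow> limit_cycle (?G \<mu>) ?P (\<Gamma> \<mu>) (T \<mu>) \<and> \<Gamma> \<mu> \<subseteq> V \<and>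
            (\<forall>\<Gamma>' T'. closed_orbit (?G \<mu>) ?P \<Gamma>' T' \<and> \<Gamma>' \<subseteq> V \<longrightarrow> \<Gamma>' = \<Gamma> \<mu>)"
    and off: "\<forall>\<mu>. - \<epsilon> < s * \<mu> \<and> s * \<mu> \<le> 0 \<longrightarrow> \<not> (\<exists>\<Gamma>' T'. closed_orbit (?G \<mu>) ?P \<Gamma>' T' \<and> \<Gamma>' \<subseteq> V)"
    using conjunct1[OF br'] by (elim exE conjE) (rule that; assumption)
  note shrink = conjunct2[OF br', rule_format]
  have "isCont f3 (0, 0)" using f3(1) U by (simp add: continuous_on_eq_continuous_at)
  then obtain d where d: "0 < d" "\<And>q. dist q (0, 0) < d \<Longrightarrow> \<bar>f3 q\<bar> < \<bar>\<alpha>3\<bar>"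
    unfolding continuous_at_eps_delta using \<alpha>3 f3(2) by (metis dist_real_def diff_zero zero_less_abs_iff)
  \<comment> \<open>Half of \<open>d\<close>, because the distance to the origin is estimated by the
    sum of two coordinates below \<delta>.\<close>
  define \<delta> where "\<delta> = d / 2"
  have \<delta>: "0 < \<delta>" using d by (simp add: \<delta>_def)
  have nz: "\<alpha>3 + f3 (a\<^sup>2, b\<^sup>2) \<noteq> 0" if "a\<^sup>2 < \<delta>" "b\<^sup>2 < \<delta>" for a b :: real
  proof -
    have "dist (a\<^sup>2, b\<^sup>2) (0, 0) \<le> a\<^sup>2 + b\<^sup>2"
      using norm_Pair_le[of "a\<^sup>2" "b\<^sup>2"] by (simp add: dist_norm)
    then have "\<bar>f3 (a\<^sup>2, b\<^sup>2)\<bar> < \<bar>\<alpha>3\<bar>" using that by (intro d(2)) (simp add: \<delta>_def)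
    then show ?thesis by linarith
  qed
  define V' where "V' = {q :: real \<times> real \<times> complex. (fst q, fst (snd q)) \<in> V} \<inter>
    {q. (fst q)\<^sup>2 < \<delta>} \<inter> {q. (cmod (snd (snd q)))\<^sup>2 < \<delta>}"
  have "open V'"
  proof -
    have "open ((\<lambda>q :: real \<times> real \<times> complex. (fst q, fst (snd q))) -` V)"
      by (intro open_vimage V continuous_intros)
    then show ?thesis unfolding V'_def vimage_def by (intro open_Int open_Collect_less continuous_intros)
  qed
  have V'0: "0 \<in> V'" using V(2) \<delta> by (simp add: V'_def zero_prod_def)
  have inV: "\<Gamma> \<subseteq> V" if "emb ` \<Gamma> \<subseteq> V'" for \<Gamma> using that by (auto simp: V'_def)
  have embI: "emb ` \<Gamma> \<subseteq> V'" if "\<Gamma> \<subseteq> V" "\<Gamma> \<subseteq> ball 0 (sqrt \<delta>)" for \<Gamma>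
  proof
    fix q assume "q \<in> emb ` \<Gamma>"
    then obtain a b where q: "q = (a, b, 0)" "(a, b) \<in> \<Gamma>" by auto
    have "norm (a, b) < sqrt \<delta>" using q(2) that(2) by auto
    moreover have "\<bar>a\<bar> \<le> norm (a, b)" using norm_fst_le[of a b] by simp
    ultimately have "\<bar>a\<bar> < sqrt \<delta>" by linarith
    then have "a\<^sup>2 < \<delta>" using \<delta> real_sqrt_less_iff[of "a\<^sup>2" \<delta>] by simp
    then show "q \<in> V'" using q that(1) \<delta> by (auto simp: V'_def)
  qed
  have plane: "\<exists>\<Gamma>. closed_orbit (?G \<mu>) ?P \<Gamma> T' \<and> \<Gamma> \<subseteq> V \<and> \<Gamma>' = emb ` \<Gamma>"
    if orb: "closed_orbit (?F \<mu>) ?S \<Gamma>' T'" and sub: "\<Gamma>' \<subseteq> V'" for \<mu> \<Gamma>' T'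
  proof (rule closed_orbit_full_in_plane[OF orb])
    fix y1 y2 z assume "(y1, y2, z) \<in> \<Gamma>'"
    then have "(y1, y2, z) \<in> V'" using sub by (rule rev_subsetD)
    then show "\<alpha>3 + f3 (y1\<^sup>2, (cmod z)\<^sup>2) \<noteq> 0" by (intro nz) (simp_all add: V'_def)
  next
    fix \<Gamma> assume h: "closed_orbit (?G \<mu>) ?P \<Gamma> T'" "\<Gamma>' = emb ` \<Gamma>"
    have "\<Gamma> \<subseteq> V" using sub unfolding h(2) by (rule inV)
    with h show "\<exists>\<Gamma>. closed_orbit (?G \<mu>) ?P \<Gamma> T' \<and> \<Gamma> \<subseteq> V \<and> \<Gamma>' = emb ` \<Gamma>" by (intro exI[of _ \<Gamma>] conjI)
  qed
  obtain h where h: "0 < h" "\<And>\<mu>. 0 < s * \<mu> \<Longrightarrow> \<bar>\<mu>\<bar> < h \<Longrightarrow> \<Gamma> \<mu> \<subseteq> ball 0 (sqrt \<delta>)"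
  proof -
    have "\<forall>\<^sub>F \<mu> in at 0 within {\<mu>. 0 < s * \<mu>}. \<Gamma> \<mu> \<subseteq> ball 0 (sqrt \<delta>)" using \<delta> by (intro shrink) simp
    then obtain h where "0 < h" "\<forall>\<mu>\<in>{\<mu>. 0 < s * \<mu>}. \<mu> \<noteq> 0 \<and> dist \<mu> 0 < h \<longrightarrow> \<Gamma> \<mu> \<subseteq> ball 0 (sqrt \<delta>)"
      unfolding eventually_at by blast
    then show thesis by (intro that[of h]) (auto simp: dist_real_def)
  qed
  show ?thesis
    unfolding limit_cycle_branch_def diff_zero
  proof (intro conjI exI[of _ "min \<epsilon> h"] exI[of _ V'] allI impI)
    fix \<mu> assume \<mu>: "0 < s * \<mu> \<and> s * \<mu> < min \<epsilon> h"
    then have "\<bar>\<mu>\<bar> < h" using s by (metis abs_mult abs_of_pos min_less_iff_conj mult_1)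
    then have ball: "\<Gamma> \<mu> \<subseteq> ball 0 (sqrt \<delta>)" using \<mu> h by blast
    have \<mu>\<epsilon>: "0 < s * \<mu>" "s * \<mu> < \<epsilon>" using \<mu> by auto
    note on = on[rule_format, OF conjI[OF \<mu>\<epsilon>]]
    show sub: "emb ` \<Gamma> \<mu> \<subseteq> V'" using on ball by (intro embI) auto
    show uniq: "\<Gamma>' = emb ` \<Gamma> \<mu>" if "closed_orbit (?F \<mu>) ?S \<Gamma>' T' \<and> \<Gamma>' \<subseteq> V'" for \<Gamma>' T'
      using plane[of \<mu> \<Gamma>' T'] that on by blast
    show "limit_cycle (?F \<mu>) ?S (emb ` \<Gamma> \<mu>) (T \<mu>)"
      unfolding limit_cycle_def
    proof (intro conjI exI[of _ V'] allI impI \<open>open V'\<close> sub)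
      show "closed_orbit (?F \<mu>) ?S (emb ` \<Gamma> \<mu>) (T \<mu>)"
        by (rule closed_orbit_emb) (use on in \<open>simp add: limit_cycle_def\<close>)
    qed (rule uniq)
  next
    fix \<mu> assume \<mu>: "- min \<epsilon> h < s * \<mu> \<and> s * \<mu> \<le> 0"
    then have "- \<epsilon> < s * \<mu> \<and> s * \<mu> \<le> 0" by auto
    from off[rule_format, OF this] plane show "\<not> (\<exists>\<Gamma>' T'. closed_orbit (?F \<mu>) ?S \<Gamma>' T' \<and> \<Gamma>' \<subseteq> V')" by blast
  next
    fix r :: real assume "0 < r"
    have embr: "emb ` \<Gamma> \<mu> \<subseteq> ball 0 r" if "\<Gamma> \<mu> \<subseteq> ball 0 r" for \<mu>
      using that by (auto simp: norm_Pair)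
    show "\<forall>\<^sub>F \<mu> in at 0 within {\<mu>. 0 < s * \<mu>}. emb ` \<Gamma> \<mu> \<subseteq> ball 0 r"
      by (rule eventually_mono[OF shrink[OF \<open>0 < r\<close>]]) (rule embr)
  qed (use \<epsilon> h \<open>open V'\<close> V'0 in auto)
qed

section \<open>Eigenvalue crossing of the linearizations\<close>

lemma generalized_kernel_eq_kernel:
  assumes "\<And>w. N (N w) = 0 \<Longrightarrow> N w = 0" "N 0 = 0"
  shows "{w. \<exists>n. (N ^^ n) w = 0} = {w. N w = 0}"
proof -
  \<comment> \<open>A kernel that does not grow from \<open>N\<close> to its square does not grow at
    any later power.\<close>
  have "N w = 0" if "(N ^^ n) w = 0" for n w
    using that
  proof (induction n arbitrary: w)
    case (Suc n)
    then have "(N ^^ n) (N w) = 0" by (simp add: funpow_swap1)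
    from Suc.IH[OF this] show ?case by (rule assms(1))
  qed (simp add: assms(2))
  then show ?thesis by (auto intro: exI[of _ 1])
qed

text \<open>Turns a parametrization of the kernel by two real numbers into the real dimension 2 that
  simplicity of an eigenvalue demands.\<close>

lemma dim_range_plane:
  fixes f :: "real \<times> real \<Rightarrow> 'a::euclidean_space"
  assumes "linear f" "inj f"
  shows "dim (range f) = 2"
  using dim_image_eq[OF assms(1), of UNIV] assms(2) by simp

text \<open>Reduced and full field share the crossing pair with real part \<open>\<mu> / 2\<close>.
  The square root is stationary at 0, so the eigenvalue moves with velocity 1/2, purely in the real
  direction.\<close>

lemma hopf_crossingI:
  fixes F :: "real \<Rightarrow> 'a::euclidean_space \<Rightarrow> 'a"
  assumes \<omega>: "0 < \<omega>" and F0: "\<And>\<mu>. F \<mu> p = 0" and F': "\<And>\<mu>. (F \<mu> has_derivative L \<mu>) (at p)"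
    and ev: "\<And>\<mu>. \<bar>\<mu>\<bar> < \<omega> \<Longrightarrow> is_eigenvalue (L \<mu>) (Complex (\<mu> / 2) (sqrt (\<omega>\<^sup>2 - (\<mu> / 2)\<^sup>2)))"
    and simple: "is_simple_eigenvalue (L 0) (\<i> * of_real \<omega>)"
    and others: "\<And>s. is_eigenvalue (L 0) (\<i> * of_real s) \<Longrightarrow> s\<^sup>2 = \<omega>\<^sup>2"
  shows "hopf_eigenvalue_crossing F p 0"
proof -
  have fd: "frechet_derivative (F \<mu>) (at p) = L \<mu>" for \<mu> using frechet_derivative_at[OF F'] by simp
  define \<kappa> where "\<kappa> \<mu> = Complex (\<mu> / 2) (sqrt (\<omega>\<^sup>2 - (\<mu> / 2)\<^sup>2))" for \<mu>
  have \<kappa>0: "\<kappa> 0 = \<i> * of_real \<omega>" using \<omega> by (simp add: \<kappa>_def complex_eq_iff)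
  have "((\<lambda>\<mu>. \<omega>\<^sup>2 - (\<mu> / 2)\<^sup>2) has_real_derivative 0) (at 0)"
    using DERIV_diff[OF DERIV_const[of "\<omega>\<^sup>2"]
        DERIV_power[OF DERIV_cdivide[OF DERIV_ident[of "at (0 :: real)"], where c = 2], where n = 2]] by simp
  from DERIV_chain2[OF DERIV_real_sqrt this]
  have "((\<lambda>\<mu>. sqrt (\<omega>\<^sup>2 - (\<mu> / 2)\<^sup>2)) has_real_derivative 0) (at 0)" using \<omega> by simp
  then have "((\<lambda>\<mu>. of_real (\<mu> / 2) + \<i> * of_real (sqrt (\<omega>\<^sup>2 - (\<mu> / 2)\<^sup>2))) has_vector_derivative of_real (1 / 2) + \<i> * of_real 0) (at 0)"
    by (intro has_vector_derivative_add has_vector_derivative_mult_right has_vector_derivative_of_real DERIV_cdivide DERIV_ident)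
  then have \<kappa>': "(\<kappa> has_vector_derivative of_real (1 / 2)) (at 0)"
    by (simp add: \<kappa>_def[abs_def] Complex_eq)
  have oth: "\<nu> = \<kappa> 0 \<or> \<nu> = cnj (\<kappa> 0)" if "is_eigenvalue (L 0) \<nu>" "Re \<nu> = 0" for \<nu>
  proof -
    have \<nu>: "\<nu> = \<i> * of_real (Im \<nu>)" using that(2) by (simp add: complex_eq_iff)
    have "is_eigenvalue (L 0) (\<i> * of_real (Im \<nu>))" using that(1) \<nu> by metis
    then have "(Im \<nu>)\<^sup>2 = \<omega>\<^sup>2" by (rule others)
    then have "Im \<nu> = \<omega> \<or> Im \<nu> = - \<omega>" by (simp add: power2_eq_iff)
    then show ?thesis using that(2) unfolding \<kappa>0 by (auto simp: complex_eq_iff)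
  qed
  show ?thesis
    unfolding hopf_eigenvalue_crossing_def fd
  proof (rule exI[of _ \<omega>], intro conjI exI[of _ \<kappa>] exI[of _ "of_real (1 / 2)"] allI impI)
    show "is_eigenvalue (L \<mu>) (\<kappa> \<mu>)" if "\<bar>\<mu> - 0\<bar> < \<omega>" for \<mu> using ev that by (simp add: \<kappa>_def)
    show "F \<mu> differentiable at p" for \<mu> using F' by (auto simp: differentiable_def)
    show "is_simple_eigenvalue (L 0) (\<kappa> 0)" unfolding \<kappa>0 by (rule simple)
    show "\<nu> = \<kappa> 0 \<or> \<nu> = cnj (\<kappa> 0)" if "is_eigenvalue (L 0) \<nu> \<and> Re \<nu> = 0" for \<nu> using oth that by blast
  qed (use \<omega> F0 \<kappa>' in \<open>auto simp: \<kappa>0\<close>)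
qed

text \<open>\<open>f1\<close> and \<open>f2\<close> are evaluated at \<open>y1^2\<close> and vanish
  at the origin, so they leave no trace in the linearization: it is the companion matrix of
  \<open>k^2 - \<mu> k - \<alpha>1\<close>.\<close>

lemma hopf_crossing_reduced:
  assumes \<alpha>1: "\<alpha>1 < 0" and f1: "f1 differentiable (at (0, 0))" "f1 (0, 0) = 0"
    and f2: "f2 differentiable (at (0, 0))" "f2 (0, 0) = 0"
  shows "hopf_eigenvalue_crossing (reduced_field f1 f2 \<alpha>1) 0 0"
proof -
  define \<omega> where "\<omega> = sqrt (- \<alpha>1)"
  have \<omega>: "0 < \<omega>" "\<alpha>1 = - (\<omega> * \<omega>)" using \<alpha>1 by (auto simp: \<omega>_def)
  define L where "L \<mu> = (\<lambda>h :: real \<times> real. (snd h, \<alpha>1 * fst h + \<mu> * snd h))" for \<mu>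
  obtain D1 where D1: "(f1 has_derivative D1) (at (0, 0))" using f1 by (auto simp: differentiable_def)
  obtain D2 where D2: "(f2 has_derivative D2) (at (0, 0))" using f2 by (auto simp: differentiable_def)
  have q: "((\<lambda>h :: real \<times> real. ((fst h)\<^sup>2, 0 :: real)) has_derivative (\<lambda>h. (0, 0))) (at 0)"
    by (rule derivative_eq_intros refl)+ (simp add: fun_eq_iff)
  have D: "((\<lambda>h :: real \<times> real. f ((fst h)\<^sup>2, 0 :: real)) has_derivative (\<lambda>h. 0)) (at 0)"
    if "(f has_derivative D) (at (0, 0))" for f :: "real \<times> real \<Rightarrow> real" and D
  proof -
    have "(f has_derivative D) (at ((fst (0 :: real \<times> real))\<^sup>2, 0))" using that by simp
    from has_derivative_compose[OF q this] linear_0[OF has_derivative_linear[OF that]]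
    show ?thesis by (simp add: zero_prod_def)
  qed
  show ?thesis
  proof (rule hopf_crossingI[OF \<omega>(1), of _ _ L])
    show "reduced_field f1 f2 \<alpha>1 \<mu> 0 = 0" for \<mu> by (simp add: reduced_field_def zero_prod_def)
    show "(reduced_field f1 f2 \<alpha>1 \<mu> has_derivative L \<mu>) (at 0)" for \<mu>
      unfolding reduced_field_def L_def case_prod_unfold
      by (rule derivative_eq_intros D[OF D1] D[OF D2] refl)+ (simp add: fun_eq_iff f1 f2)
    show "is_eigenvalue (L \<mu>) (Complex (\<mu> / 2) (sqrt (\<omega>\<^sup>2 - (\<mu> / 2)\<^sup>2)))" if \<mu>: "\<bar>\<mu>\<bar> < \<omega>" for \<mu>
    proof -
      have "(\<mu> / 2)\<^sup>2 \<le> \<omega>\<^sup>2" using \<mu> \<omega> by (intro power2_le_iff_abs_le[THEN iffD2]) auto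
      then have "sqrt (\<omega>\<^sup>2 - (\<mu> / 2)\<^sup>2) * sqrt (\<omega>\<^sup>2 - (\<mu> / 2)\<^sup>2) = \<omega> * \<omega> - \<mu> * \<mu> / 4"
        by (simp add: power2_eq_square)
      \<comment> \<open>A companion matrix has the eigenvector \<open>(1, k)\<close> for the
        eigenvalue \<open>k\<close>; the witness lists its real and imaginary parts.\<close>
      then show ?thesis unfolding is_eigenvalue_def
        by (intro exI[of _ "((1, \<mu> / 2), (0, sqrt (\<omega>\<^sup>2 - (\<mu> / 2)\<^sup>2)))"])
          (simp add: complexified_shift_def L_def zero_prod_def \<omega>(2) field_simps)
    qed
    have N: "complexified_shift (L 0) (\<i> * of_real s) = (\<lambda>((a, b), (e, f)).
      ((b + s * e, s * f - \<omega> * \<omega> * a), (f - s * a, - \<omega> * \<omega> * e - s * b)))" for s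
      by (auto simp: complexified_shift_def L_def \<omega>(2) fun_eq_iff)
    show "s\<^sup>2 = \<omega>\<^sup>2" if "is_eigenvalue (L 0) (\<i> * of_real s)" for s
    proof (rule ccontr)
      assume ne: "s\<^sup>2 \<noteq> \<omega>\<^sup>2"
      obtain w0 where w0: "w0 \<noteq> 0" "complexified_shift (L 0) (\<i> * of_real s) w0 = 0"
        using \<open>is_eigenvalue (L 0) (\<i> * of_real s)\<close> unfolding is_eigenvalue_def by blast
      obtain a b e f where "w0 = ((a, b), (e, f))" by (metis surj_pair)
      with w0 have w: "((a, b), (e, f)) \<noteq> 0"
        and "((b + s * e, s * f - \<omega> * \<omega> * a), (f - s * a, - \<omega> * \<omega> * e - s * b)) = 0"
        unfolding N by simp_all
      then have w: "((a, b), (e, f)) \<noteq> 0" "b + s * e = 0" "s * f - \<omega> * \<omega> * a = 0" "f - s * a = 0" "- \<omega> * \<omega> * e - s * b = 0"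
        unfolding zero_prod_def prod.inject by blast+
      have f: "f = s * a" and b: "b = - s * e" using w by auto
      have "(s\<^sup>2 - \<omega>\<^sup>2) * a = 0" "(s\<^sup>2 - \<omega>\<^sup>2) * e = 0" using w(3,5) unfolding f b by (auto simp: algebra_simps power2_eq_square)
      then have "a = 0" "e = 0" using ne by auto
      then show False using w(1) f b by (simp add: zero_prod_def)
    qed
    show "is_simple_eigenvalue (L 0) (\<i> * of_real \<omega>)"
    proof -
      let ?N = "complexified_shift (L 0) (\<i> * of_real \<omega>)"
      have kerN: "?N ((a, b), (e, f)) = 0 \<longleftrightarrow> b = - \<omega> * e \<and> f = \<omega> * a" for a b e f
      proof
        assume "?N ((a, b), (e, f)) = 0"
        then have "b + \<omega> * e = 0" "f - \<omega> * a = 0" unfolding N by (simp_all add: zero_prod_def)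
        then show "b = - \<omega> * e \<and> f = \<omega> * a" by auto
      qed (simp add: N zero_prod_def)
      have "{w. \<exists>n. (?N ^^ n) w = 0} = {w. ?N w = 0}"
      proof (rule generalized_kernel_eq_kernel)
        fix w :: "(real \<times> real) \<times> (real \<times> real)"
        obtain a b e f where w: "w = ((a, b), (e, f))" by (metis surj_pair)
        have Nw: "?N w = ((b + \<omega> * e, \<omega> * f - \<omega> * \<omega> * a), (f - \<omega> * a, - \<omega> * \<omega> * e - \<omega> * b))"
          by (simp add: w N)
        assume "?N (?N w) = 0"
        \<comment> \<open>Membership of \<open>?N w\<close> in the kernel equates each of the two
          kernel conditions for \<open>w\<close> with its own negative.\<close>
        then have k: "\<omega> * f - \<omega> * \<omega> * a = - \<omega> * (f - \<omega> * a)" "- \<omega> * \<omega> * e - \<omega> * b = \<omega> * (b + \<omega> * e)"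
          unfolding Nw kerN by auto
        have "\<omega> * (f - \<omega> * a) = 0" "\<omega> * (b + \<omega> * e) = 0" using k by (simp_all add: algebra_simps)
        then have "f = \<omega> * a" "b = - \<omega> * e" using \<omega>(1) by auto
        then show "?N w = 0" unfolding w kerN by simp
      qed (simp add: N zero_prod_def)
      also have "\<dots> = range (\<lambda>(a, e). ((a, - \<omega> * e), (e, \<omega> * a)))"
      proof (rule set_eqI)
        fix w :: "(real \<times> real) \<times> (real \<times> real)"
        obtain a b e f where w: "w = ((a, b), (e, f))" by (metis surj_pair)
        show "w \<in> {w. ?N w = 0} \<longleftrightarrow> w \<in> range (\<lambda>(a, e). ((a, - \<omega> * e), (e, \<omega> * a)))"
          unfolding w mem_Collect_eq kerN by (auto simp: image_iff)
      qed
      finally have ker: "{w. \<exists>n. (?N ^^ n) w = 0} = range (\<lambda>(a, e). ((a, - \<omega> * e), (e, \<omega> * a)))" .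
      have "linear (\<lambda>(a, e). ((a, - \<omega> * e), (e, \<omega> * a)))"
        by (rule linearI) (auto simp: algebra_simps)
      then have "dim {w. \<exists>n. (?N ^^ n) w = 0} = 2"
        unfolding ker by (rule dim_range_plane) (auto simp: inj_def)
      moreover have "is_eigenvalue (L 0) (\<i> * of_real \<omega>)"
        unfolding is_eigenvalue_def N by (intro exI[of _ "((1, 0), (0, \<omega>))"]) (simp add: zero_prod_def)
      ultimately show ?thesis by (simp add: is_simple_eigenvalue_def)
    qed
  qed
qed

text \<open>The linearization is block diagonal. The \<open>z\<close> block has the eigenvalues
  \<open>\<alpha>3 + \<i>\<close> and its conjugate, off the imaginary axis because \<alpha>3 is
  nonzero; the crossing pair and its simplicity come from the \<open>(y1, y2)\<close> block.\<close>

lemma hopf_crossing_full: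
  assumes \<alpha>1: "\<alpha>1 < 0" and \<alpha>3: "\<alpha>3 \<noteq> 0" and f1: "f1 differentiable (at (0, 0))" "f1 (0, 0) = 0"
    and f2: "f2 differentiable (at (0, 0))" "f2 (0, 0) = 0"
    and f3: "f3 differentiable (at (0, 0))" "f3 (0, 0) = 0"
    and f4: "f4 differentiable (at (0, 0))" "f4 (0, 0) = 0"
  shows "hopf_eigenvalue_crossing (\<lambda>\<alpha>2. full_field f1 f2 f3 f4 \<alpha>1 \<alpha>2 \<alpha>3) 0 0"
proof -
  define \<omega> where "\<omega> = sqrt (- \<alpha>1)"
  have \<omega>: "0 < \<omega>" "\<alpha>1 = - (\<omega> * \<omega>)" using \<alpha>1 by (auto simp: \<omega>_def)
  define A where "A = \<i> + complex_of_real \<alpha>3"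
  define L where "L \<mu> = (\<lambda>h :: real \<times> real \<times> complex. (fst (snd h), \<alpha>1 * fst h + \<mu> * fst (snd h), A * snd (snd h)))" for \<mu>
  have q: "((\<lambda>h :: real \<times> real \<times> complex. ((fst h)\<^sup>2, (cmod (snd (snd h)))\<^sup>2)) has_derivative (\<lambda>h. (0, 0))) (at 0)"
    unfolding cmod_power2
    by (rule derivative_eq_intros bounded_linear.has_derivative[OF bounded_linear_Re] bounded_linear.has_derivative[OF bounded_linear_Im] refl)+
      (simp add: fun_eq_iff)
  have D: "((\<lambda>h :: real \<times> real \<times> complex. f ((fst h)\<^sup>2, (cmod (snd (snd h)))\<^sup>2)) has_derivative (\<lambda>h. 0)) (at 0)"
    if f: "f differentiable (at (0, 0))" for f :: "real \<times> real \<Rightarrow> real"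
  proof -
    obtain D where D: "(f has_derivative D) (at (0, 0))" using f by (auto simp: differentiable_def)
    then have "(f has_derivative D) (at ((fst (0 :: real \<times> real \<times> complex))\<^sup>2, (cmod (snd (snd (0 :: real \<times> real \<times> complex))))\<^sup>2))" by simp
    from has_derivative_compose[OF q this] linear_0[OF has_derivative_linear[OF D]]
    show ?thesis by (simp add: zero_prod_def)
  qed
  have A2: "A * A = of_real (\<alpha>3 * \<alpha>3 - 1) + \<i> * of_real (2 * \<alpha>3)" by (simp add: A_def complex_eq_iff)
  \<comment> \<open>Injectivity of the shifted \<open>z\<close> block: \<open>A^2 + s^2\<close> is
    its determinant, with imaginary part \<open>2 \<alpha>3\<close>.\<close>
  have inj: "z1 = 0 \<and> z2 = 0" if "A * z1 + of_real s * z2 = 0" "A * z2 - of_real s * z1 = 0" for s z1 z2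
  proof -
    have "A * A + of_real (s * s) \<noteq> 0" using \<alpha>3 unfolding A2 by (auto simp: complex_eq_iff)
    moreover have "A * (A * z1 + of_real s * z2) - of_real s * (A * z2 - of_real s * z1) = (A * A + of_real (s * s)) * z1"
      "A * (A * z2 - of_real s * z1) + of_real s * (A * z1 + of_real s * z2) = (A * A + of_real (s * s)) * z2"
      by (simp_all add: algebra_simps)
    ultimately show ?thesis using that by auto
  qed
  show ?thesis
  proof (rule hopf_crossingI[OF \<omega>(1), of _ _ L])
    show "full_field f1 f2 f3 f4 \<alpha>1 \<mu> \<alpha>3 0 = 0" for \<mu> by (simp add: full_field_def zero_prod_def Let_def)
    show "(full_field f1 f2 f3 f4 \<alpha>1 \<mu> \<alpha>3 has_derivative L \<mu>) (at 0)" for \<mu>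
      unfolding full_field_def L_def case_prod_unfold Let_def A_def
      by (rule derivative_eq_intros D[OF f1(1)] D[OF f2(1)] D[OF f3(1)] D[OF f4(1)] refl)+
        (simp add: fun_eq_iff f1 f2 f3 f4)
    show "is_eigenvalue (L \<mu>) (Complex (\<mu> / 2) (sqrt (\<omega>\<^sup>2 - (\<mu> / 2)\<^sup>2)))" if \<mu>: "\<bar>\<mu>\<bar> < \<omega>" for \<mu>
    proof -
      have "(\<mu> / 2)\<^sup>2 \<le> \<omega>\<^sup>2" using \<mu> \<omega> by (intro power2_le_iff_abs_le[THEN iffD2]) auto
      then have "sqrt (\<omega>\<^sup>2 - (\<mu> / 2)\<^sup>2) * sqrt (\<omega>\<^sup>2 - (\<mu> / 2)\<^sup>2) = \<omega> * \<omega> - \<mu> * \<mu> / 4"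
        by (simp add: power2_eq_square)
      then show ?thesis unfolding is_eigenvalue_def
        by (intro exI[of _ "((1, \<mu> / 2, 0), (0, sqrt (\<omega>\<^sup>2 - (\<mu> / 2)\<^sup>2), 0))"])
          (simp add: complexified_shift_def L_def zero_prod_def \<omega>(2) field_simps)
    qed
    have N: "complexified_shift (L 0) (\<i> * of_real s) = (\<lambda>((a, b, z1), (e, f, z2)).
      ((b + s * e, s * f - \<omega> * \<omega> * a, A * z1 + of_real s * z2), (f - s * a, - \<omega> * \<omega> * e - s * b, A * z2 - of_real s * z1)))" for s
      by (auto simp: complexified_shift_def L_def \<omega>(2) fun_eq_iff scaleR_conv_of_real)
    show "s\<^sup>2 = \<omega>\<^sup>2" if "is_eigenvalue (L 0) (\<i> * of_real s)" for s
    proof (rule ccontr)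
      assume ne: "s\<^sup>2 \<noteq> \<omega>\<^sup>2"
      obtain w0 where w0: "w0 \<noteq> 0" "complexified_shift (L 0) (\<i> * of_real s) w0 = 0"
        using \<open>is_eigenvalue (L 0) (\<i> * of_real s)\<close> unfolding is_eigenvalue_def by blast
      obtain a b z1 e f z2 where "w0 = ((a, b, z1), (e, f, z2))" by (metis surj_pair)
      with w0 have w: "((a, b, z1), (e, f, z2)) \<noteq> 0"
        and "((b + s * e, s * f - \<omega> * \<omega> * a, A * z1 + of_real s * z2), (f - s * a, - \<omega> * \<omega> * e - s * b, A * z2 - of_real s * z1)) = 0"
        unfolding N by simp_all
      then have w: "((a, b, z1), (e, f, z2)) \<noteq> 0" "b + s * e = 0" "s * f - \<omega> * \<omega> * a = 0" "f - s * a = 0" "- \<omega> * \<omega> * e - s * b = 0"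
        and z: "A * z1 + of_real s * z2 = 0" "A * z2 - of_real s * z1 = 0"
        unfolding zero_prod_def prod.inject by blast+
      have f: "f = s * a" and b: "b = - s * e" using w by auto
      have "(s\<^sup>2 - \<omega>\<^sup>2) * a = 0" "(s\<^sup>2 - \<omega>\<^sup>2) * e = 0" using w(3,5) unfolding f b by (auto simp: algebra_simps power2_eq_square)
      then have "a = 0" "e = 0" using ne by auto
      then show False using w(1) f b inj[OF z] by (simp add: zero_prod_def)
    qed
    show "is_simple_eigenvalue (L 0) (\<i> * of_real \<omega>)"
    proof -
      let ?N = "complexified_shift (L 0) (\<i> * of_real \<omega>)"
      have kerN: "?N ((a, b, z1), (e, f, z2)) = 0 \<longleftrightarrow> b = - \<omega> * e \<and> f = \<omega> * a \<and> z1 = 0 \<and> z2 = 0" for a b z1 e f z2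
      proof
        assume "?N ((a, b, z1), (e, f, z2)) = 0"
        then have "b + \<omega> * e = 0" "f - \<omega> * a = 0" "A * z1 + of_real \<omega> * z2 = 0" "A * z2 - of_real \<omega> * z1 = 0"
          unfolding N by (simp_all add: zero_prod_def)
        with inj[of z1 \<omega> z2] show "b = - \<omega> * e \<and> f = \<omega> * a \<and> z1 = 0 \<and> z2 = 0" by auto
      qed (simp add: N zero_prod_def)
      have "{w. \<exists>n. (?N ^^ n) w = 0} = {w. ?N w = 0}"
      proof (rule generalized_kernel_eq_kernel)
        fix w :: "(real \<times> real \<times> complex) \<times> (real \<times> real \<times> complex)"
        obtain a b z1 e f z2 where w: "w = ((a, b, z1), (e, f, z2))" by (metis surj_pair)
        have Nw: "?N w = ((b + \<omega> * e, \<omega> * f - \<omega> * \<omega> * a, A * z1 + of_real \<omega> * z2), (f - \<omega> * a, - \<omega> * \<omega> * e - \<omega> * b, A * z2 - of_real \<omega> * z1))"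
          by (simp add: w N)
        assume "?N (?N w) = 0"
        then have k: "\<omega> * f - \<omega> * \<omega> * a = - \<omega> * (f - \<omega> * a)" "- \<omega> * \<omega> * e - \<omega> * b = \<omega> * (b + \<omega> * e)"
          "A * z1 + of_real \<omega> * z2 = 0" "A * z2 - of_real \<omega> * z1 = 0"
          unfolding Nw kerN by auto
        have "\<omega> * (f - \<omega> * a) = 0" "\<omega> * (b + \<omega> * e) = 0" using k(1,2) by (simp_all add: algebra_simps)
        then have "f = \<omega> * a" "b = - \<omega> * e" using \<omega>(1) by auto
        then show "?N w = 0" unfolding w kerN using inj[OF k(3,4)] by simp
      qed (simp add: N zero_prod_def)
      also have "\<dots> = range (\<lambda>(a, e). ((a, - \<omega> * e, 0), (e, \<omega> * a, 0)))"
      proof (rule set_eqI)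
        fix w :: "(real \<times> real \<times> complex) \<times> (real \<times> real \<times> complex)"
        obtain a b z1 e f z2 where w: "w = ((a, b, z1), (e, f, z2))" by (metis surj_pair)
        show "w \<in> {w. ?N w = 0} \<longleftrightarrow> w \<in> range (\<lambda>(a, e). ((a, - \<omega> * e, 0), (e, \<omega> * a, 0)))"
          unfolding w mem_Collect_eq kerN by (auto simp: image_iff)
      qed
      finally have ker: "{w. \<exists>n. (?N ^^ n) w = 0} = range (\<lambda>(a, e). ((a, - \<omega> * e, 0), (e, \<omega> * a, 0)))" .
      have "linear (\<lambda>(a, e). ((a, - \<omega> * e, 0 :: complex), (e, \<omega> * a, 0 :: complex)))"
        by (rule linearI) (auto simp: algebra_simps)
      then have "dim {w. \<exists>n. (?N ^^ n) w = 0} = 2"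
        unfolding ker by (rule dim_range_plane) (auto simp: inj_def)
      moreover have "is_eigenvalue (L 0) (\<i> * of_real \<omega>)"
        unfolding is_eigenvalue_def N by (intro exI[of _ "((1, 0, 0), (0, \<omega>, 0))"]) (simp add: zero_prod_def)
      ultimately show ?thesis by (simp add: is_simple_eigenvalue_def)
    qed
  qed
qed

lemma andronov_hopfI:
  assumes "hopf_eigenvalue_crossing F p 0" "limit_cycle_branch F S p 0 (- sgn c) \<Gamma> T" "c \<noteq> 0"
  shows "andronov_hopf_bifurcation F S p 0 \<Gamma> T \<and> (c < 0 \<longrightarrow> supercritical_branch F S p 0 \<Gamma> T) \<and>
      (c > 0 \<longrightarrow> subcritical_branch F S p 0 \<Gamma> T)"
  using assms unfolding andronov_hopf_bifurcation_def supercritical_branch_def subcritical_branch_def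
  by (cases "c < 0") auto

theorem mainTheorem5:
  fixes \<phi>1 \<phi>2 \<phi>3 \<phi>4 :: "real fps fps"
    and U :: "(real \<times> real) set"
    and f1 f2 f3 f4 :: "real \<times> real \<Rightarrow> real"
  assumes "coeff2 \<phi>1 0 0 = 0" and "coeff2 \<phi>2 0 0 = 0"
    and "coeff2 \<phi>3 0 0 = 0" and "coeff2 \<phi>4 0 0 = 0"
    and nondegenerate: "coeff2 \<phi>2 1 0 \<noteq> 0"
    and "open U" and "(0, 0) \<in> U"
    and "realizes U f1 \<phi>1" and "realizes U f2 \<phi>2"
    and "realizes U f3 \<phi>3" and "realizes U f4 \<phi>4"
  defines "c \<equiv> coeff2 \<phi>2 1 0"
    and "S \<equiv> full_domain U" and "P \<equiv> planar_domain U"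
    and "F \<equiv> full_field f1 f2 f3 f4"
    and "G \<equiv> reduced_field f1 f2"
    and "K \<equiv> planar_field f1 f2"
  shows
    \<comment> \<open>invariance of the plane \<open>z = 0\<close>, and the reduced system on it\<close>
    "(\<forall>\<alpha>1 \<alpha>2 \<alpha>3 I y1 y2 z t0.
        is_interval I \<and> is_solution (F \<alpha>1 \<alpha>2 \<alpha>3) S I (\<lambda>t. (y1 t, y2 t, z t)) \<and>
        t0 \<in> I \<and> z t0 = 0 \<longrightarrow> (\<forall>t\<in>I. z t = 0)) \<and>
     (\<forall>\<alpha>1 \<alpha>2 \<alpha>3 I y1 y2.
        is_interval I \<longrightarrow>
        (is_solution (F \<alpha>1 \<alpha>2 \<alpha>3) S I (\<lambda>t. (y1 t, y2 t, 0)) \<longleftrightarrow>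
         is_solution (G \<alpha>1 \<alpha>2) P I (\<lambda>t. (y1 t, y2 t)))) \<and>
    \<comment> \<open>the change of variables to the planar system\<close>
     (\<forall>\<alpha>1 \<alpha>2 \<omega> I y1 y2.
        \<alpha>1 < 0 \<and> 0 < \<omega> \<and> \<omega>\<^sup>2 = - \<alpha>1 \<and> is_interval I \<longrightarrow>
        (is_solution (G \<alpha>1 \<alpha>2) P I (\<lambda>t. (y1 t, y2 t)) \<longleftrightarrow>
         is_solution (K \<omega> \<alpha>2) P I (\<lambda>t. (y1 t, - y2 t / \<omega>)))) \<and>
    \<comment> \<open>the bifurcation at \<open>\<alpha>2 = 0\<close>; \<open>\<Gamma> \<alpha>1 \<alpha>2\<close> and \<open>T \<alpha>1 \<alpha>2\<close> are the limit cycle and its period\<close>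
     (\<exists>\<Gamma> T.
        (\<forall>\<alpha>1<0.
           andronov_hopf_bifurcation (G \<alpha>1) P 0 0 (\<Gamma> \<alpha>1) (T \<alpha>1) \<and>
           (c < 0 \<longrightarrow> supercritical_branch (G \<alpha>1) P 0 0 (\<Gamma> \<alpha>1) (T \<alpha>1)) \<and>
           (c > 0 \<longrightarrow> subcritical_branch (G \<alpha>1) P 0 0 (\<Gamma> \<alpha>1) (T \<alpha>1)) \<and>
           (\<forall>\<alpha>3. \<alpha>3 \<noteq> 0 \<longrightarrow>
              (let F' = (\<lambda>\<alpha>2. F \<alpha>1 \<alpha>2 \<alpha>3);
                   \<Gamma>' = (\<lambda>\<alpha>2. (\<lambda>(y1, y2). (y1, y2, 0)) ` \<Gamma> \<alpha>1 \<alpha>2) in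
                 andronov_hopf_bifurcation F' S 0 0 \<Gamma>' (T \<alpha>1) \<and>
                 (c < 0 \<longrightarrow> supercritical_branch F' S 0 0 \<Gamma>' (T \<alpha>1)) \<and>
                 (c > 0 \<longrightarrow> subcritical_branch F' S 0 0 \<Gamma>' (T \<alpha>1)))) \<and>
           \<comment> \<open>frequency\<close>
           ((\<lambda>\<alpha>2. 2 * pi / T \<alpha>1 \<alpha>2) \<longlongrightarrow> sqrt (- \<alpha>1)) (at 0 within {\<alpha>2. 0 < - 4 * \<alpha>2 / c}) \<and>
           \<comment> \<open>polar normal form, and amplitude in both the original and the normal form coordinates\<close>
           (\<exists>H b C.
              polar_normal_form (K (sqrt (- \<alpha>1))) P H
                (\<lambda>\<alpha>2. \<alpha>2 / 2) (\<lambda>\<alpha>2. sqrt (- \<alpha>1 - (\<alpha>2 / 2)\<^sup>2)) (1 / 8 * c) b \<and>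
              (\<forall>\<^sub>F \<alpha>2 in at 0 within {\<alpha>2. 0 < - 4 * \<alpha>2 / c}.
                 \<forall>(y1, y2) \<in> \<Gamma> \<alpha>1 \<alpha>2.
                   let \<zeta> = Complex y1 (- y2 / sqrt (- \<alpha>1)) in
                     \<bar>cmod (H \<alpha>2 \<zeta>) - sqrt (- 4 * \<alpha>2 / c)\<bar> \<le> C * \<bar>\<alpha>2\<bar> powr (3 / 2) \<and>
                     \<bar>cmod \<zeta> - sqrt (- 4 * \<alpha>2 / c)\<bar> \<le> C * \<bar>\<alpha>2\<bar> powr (3 / 2)))) \<and>
        \<comment> \<open>the frequency is small for small \<open>\<alpha>1\<close>\<close>
        (\<forall>\<delta>>0. \<forall>\<^sub>F \<alpha>1 in at_left 0. \<forall>\<^sub>F \<alpha>2 in at 0 within {\<alpha>2. 0 < - 4 * \<alpha>2 / c}.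
           2 * pi / T \<alpha>1 \<alpha>2 < \<delta>))"
proof -
  have U: "open U" "(0, 0) \<in> U" by fact+
  have at0: "g differentiable (at (0, 0))" "g (0, 0) = coeff2 \<psi> 0 0" "continuous_on U g" if "realizes U g \<psi>" for g \<psi>
  proof -
    have sm: "smooth_on U g" using that by (simp add: realizes_def)
    show "g differentiable (at (0, 0))" by (rule smooth_on_imp_differentiable[OF sm U(2)])
    show "continuous_on U g" by (rule smooth_on_imp_continuous_on[OF sm])
    have "(dir_deriv (1, 0) ^^ 0) ((dir_deriv (0, 1) ^^ 0) g) (0, 0) = fact 0 * fact 0 * coeff2 \<psi> 0 0"
      using that unfolding realizes_def by blast
    then show "g (0, 0) = coeff2 \<psi> 0 0" by simp
  qed
  have f0: "f1 (0, 0) = 0" "f2 (0, 0) = 0" "f3 (0, 0) = 0" "f4 (0, 0) = 0"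
    using at0(2)[OF assms(8)] at0(2)[OF assms(9)] at0(2)[OF assms(10)] at0(2)[OF assms(11)] assms(1-4) by simp_all
  note fd = at0(1)[OF assms(8)] at0(1)[OF assms(9)] at0(1)[OF assms(10)] at0(1)[OF assms(11)]
  have cf3: "continuous_on U f3" by (rule at0(3)[OF assms(10)])
  have c: "c \<noteq> 0" using nondegenerate by (simp add: c_def)
  \<comment> \<open>The conclusions are bundled so that a single choice for each
    \<open>\<alpha>1\<close> yields a \<Gamma> and a \<open>T\<close> with all of them.\<close>
  define Q where "Q \<alpha>1 \<Gamma> T \<longleftrightarrow> limit_cycle_branch (G \<alpha>1) P 0 0 (- sgn c) \<Gamma> T \<and>
    ((\<lambda>\<alpha>2. 2 * pi / T \<alpha>2) \<longlongrightarrow> sqrt (- \<alpha>1)) (at 0 within {\<alpha>2. 0 < - 4 * \<alpha>2 / c}) \<and>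
    (\<exists>H b C. polar_normal_form (K (sqrt (- \<alpha>1))) P H
        (\<lambda>\<alpha>2. \<alpha>2 / 2) (\<lambda>\<alpha>2. sqrt (- \<alpha>1 - (\<alpha>2 / 2)\<^sup>2)) (1 / 8 * c) b \<and>
      (\<forall>\<^sub>F \<alpha>2 in at 0 within {\<alpha>2. 0 < - 4 * \<alpha>2 / c}. \<forall>(y1, y2) \<in> \<Gamma> \<alpha>2.
         let \<zeta> = Complex y1 (- y2 / sqrt (- \<alpha>1)) in
           \<bar>cmod (H \<alpha>2 \<zeta>) - sqrt (- 4 * \<alpha>2 / c)\<bar> \<le> C * \<bar>\<alpha>2\<bar> powr (3 / 2) \<and>
           \<bar>cmod \<zeta> - sqrt (- 4 * \<alpha>2 / c)\<bar> \<le> C * \<bar>\<alpha>2\<bar> powr (3 / 2)))" for \<alpha>1 :: real and \<Gamma> T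
  have "\<exists>\<Gamma> T. \<alpha>1 < 0 \<longrightarrow> Q \<alpha>1 \<Gamma> T" for \<alpha>1
  proof (cases "\<alpha>1 < 0")
    case True
    from reduced_bifurcation[OF U assms(8,9,1,2) nondegenerate this]
    show ?thesis unfolding Q_def G_def K_def P_def c_def by blast
  qed simp
  then obtain \<Gamma> T where Q: "\<And>\<alpha>1. \<alpha>1 < 0 \<Longrightarrow> Q \<alpha>1 (\<Gamma> \<alpha>1) (T \<alpha>1)" by metis
  have branch: "limit_cycle_branch (G \<alpha>1) P 0 0 (- sgn c) (\<Gamma> \<alpha>1) (T \<alpha>1)"
    and freq: "((\<lambda>\<alpha>2. 2 * pi / T \<alpha>1 \<alpha>2) \<longlongrightarrow> sqrt (- \<alpha>1)) (at 0 within {\<alpha>2. 0 < - 4 * \<alpha>2 / c})" if "\<alpha>1 < 0" for \<alpha>1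
    using Q[OF that] unfolding Q_def by blast+
  have pnf: "\<exists>H b C. polar_normal_form (K (sqrt (- \<alpha>1))) P H
        (\<lambda>\<alpha>2. \<alpha>2 / 2) (\<lambda>\<alpha>2. sqrt (- \<alpha>1 - (\<alpha>2 / 2)\<^sup>2)) (1 / 8 * c) b \<and>
      (\<forall>\<^sub>F \<alpha>2 in at 0 within {\<alpha>2. 0 < - 4 * \<alpha>2 / c}. \<forall>(y1, y2) \<in> \<Gamma> \<alpha>1 \<alpha>2.
         let \<zeta> = Complex y1 (- y2 / sqrt (- \<alpha>1)) in
           \<bar>cmod (H \<alpha>2 \<zeta>) - sqrt (- 4 * \<alpha>2 / c)\<bar> \<le> C * \<bar>\<alpha>2\<bar> powr (3 / 2) \<and>
           \<bar>cmod \<zeta> - sqrt (- 4 * \<alpha>2 / c)\<bar> \<le> C * \<bar>\<alpha>2\<bar> powr (3 / 2))" if "\<alpha>1 < 0" for \<alpha>1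
    using Q[OF that] unfolding Q_def by (elim conjE)
  have red: "andronov_hopf_bifurcation (G \<alpha>1) P 0 0 (\<Gamma> \<alpha>1) (T \<alpha>1) \<and>
      (c < 0 \<longrightarrow> supercritical_branch (G \<alpha>1) P 0 0 (\<Gamma> \<alpha>1) (T \<alpha>1)) \<and>
      (c > 0 \<longrightarrow> subcritical_branch (G \<alpha>1) P 0 0 (\<Gamma> \<alpha>1) (T \<alpha>1))" if "\<alpha>1 < 0" for \<alpha>1
    using hopf_crossing_reduced[of \<alpha>1 f1 f2] that fd f0 branch[OF that] by (intro andronov_hopfI c) (simp_all add: G_def)
  have full: "let F' = (\<lambda>\<alpha>2. F \<alpha>1 \<alpha>2 \<alpha>3); \<Gamma>' = (\<lambda>\<alpha>2. (\<lambda>(y1, y2). (y1, y2, 0)) ` \<Gamma> \<alpha>1 \<alpha>2) in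
      andronov_hopf_bifurcation F' S 0 0 \<Gamma>' (T \<alpha>1) \<and>
      (c < 0 \<longrightarrow> supercritical_branch F' S 0 0 \<Gamma>' (T \<alpha>1)) \<and>
      (c > 0 \<longrightarrow> subcritical_branch F' S 0 0 \<Gamma>' (T \<alpha>1))" if \<alpha>: "\<alpha>1 < 0" "\<alpha>3 \<noteq> 0" for \<alpha>1 \<alpha>3
    unfolding Let_def
  proof (rule andronov_hopfI[OF _ _ c])
    show "hopf_eigenvalue_crossing (\<lambda>\<alpha>2. F \<alpha>1 \<alpha>2 \<alpha>3) 0 0"
      unfolding F_def by (rule hopf_crossing_full[OF \<alpha> fd(1) f0(1) fd(2) f0(2) fd(3) f0(3) fd(4) f0(4)])
    have "\<bar>- sgn c\<bar> = 1" using c by (simp add: sgn_if)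
    from full_branch[OF U cf3 f0(3) \<alpha>(2) this] branch[OF \<alpha>(1)]
    show "limit_cycle_branch (\<lambda>\<alpha>2. F \<alpha>1 \<alpha>2 \<alpha>3) S 0 0 (- sgn c)
      (\<lambda>\<alpha>2. (\<lambda>(y1, y2). (y1, y2, 0)) ` \<Gamma> \<alpha>1 \<alpha>2) (T \<alpha>1)"
      unfolding F_def S_def G_def P_def by blast
  qed
  have small: "\<forall>\<^sub>F \<alpha>1 in at_left 0. \<forall>\<^sub>F \<alpha>2 in at 0 within {\<alpha>2. 0 < - 4 * \<alpha>2 / c}. 2 * pi / T \<alpha>1 \<alpha>2 < \<delta>"
    if \<delta>: "0 < \<delta>" for \<delta>
  proof -
    \<comment> \<open>In this range the limit frequency \<open>sqrt (- \<alpha>1)\<close> is below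
      \<delta>; for each such \<alpha>1 the limit in \<alpha>2 then bounds the frequency
      itself.\<close>
    have "\<forall>\<^sub>F \<alpha>1 in at_left 0. - (\<delta>\<^sup>2) < \<alpha>1 \<and> \<alpha>1 < (0 :: real)"
      using \<delta> by (subst eventually_at_left[of "- (\<delta>\<^sup>2)"]) (auto intro!: exI[of _ "- (\<delta>\<^sup>2)"])
    then show ?thesis
    proof (rule eventually_mono)
      fix \<alpha>1 assume \<alpha>: "- (\<delta>\<^sup>2) < \<alpha>1 \<and> \<alpha>1 < 0"
      then have "sqrt (- \<alpha>1) < sqrt (\<delta>\<^sup>2)" by (intro real_sqrt_less_mono) simp
      then have "sqrt (- \<alpha>1) < \<delta>" using \<delta> by simp
      then show "\<forall>\<^sub>F \<alpha>2 in at 0 within {\<alpha>2. 0 < - 4 * \<alpha>2 / c}. 2 * pi / T \<alpha>1 \<alpha>2 < \<delta>"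
        using order_tendstoD(2)[OF freq] \<alpha> by blast
    qed
  qed
  show ?thesis
  proof (intro conjI)
    show "\<forall>\<alpha>1 \<alpha>2 \<alpha>3 I y1 y2 z t0.
        is_interval I \<and> is_solution (F \<alpha>1 \<alpha>2 \<alpha>3) S I (\<lambda>t. (y1 t, y2 t, z t)) \<and>
        t0 \<in> I \<and> z t0 = 0 \<longrightarrow> (\<forall>t\<in>I. z t = 0)"
      unfolding F_def S_def using plane_invariant[OF cf3] by blast
    show "\<forall>\<alpha>1 \<alpha>2 \<alpha>3 I y1 y2.
        is_interval I \<longrightarrow>
        (is_solution (F \<alpha>1 \<alpha>2 \<alpha>3) S I (\<lambda>t. (y1 t, y2 t, 0)) \<longleftrightarrow>
         is_solution (G \<alpha>1 \<alpha>2) P I (\<lambda>t. (y1 t, y2 t)))"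
      unfolding F_def S_def G_def P_def full_plane_iff by simp
    show "\<forall>\<alpha>1 \<alpha>2 \<omega> I y1 y2.
        \<alpha>1 < 0 \<and> 0 < \<omega> \<and> \<omega>\<^sup>2 = - \<alpha>1 \<and> is_interval I \<longrightarrow>
        (is_solution (G \<alpha>1 \<alpha>2) P I (\<lambda>t. (y1 t, y2 t)) \<longleftrightarrow>
         is_solution (K \<omega> \<alpha>2) P I (\<lambda>t. (y1 t, - y2 t / \<omega>)))"
      unfolding G_def K_def P_def using reduced_iff_planar by blast
  qed (rule exI[of _ \<Gamma>], rule exI[of _ T], intro conjI allI impI,
      (erule freq | erule pnf | erule (1) full | erule small | (use red in blast))+)
qed

end
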